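(* Let $(\mathbf{G}_n)$ be a sequence of multigraphs such that for every multigraph $\mathbf{F}$ the sequence $t(\mathbf{F},\mathbf{G}_n)$ of node-and-edge homomorphism densities is convergent. Then there exist a weight function $\rho$ and a $\widehat{\mathcal{J}}_\rho$-graphon $W$ such that $t(\mathbf{F},\mathbf{G}_n)\to t(\mathbf{F}',W)$ for every multigraph $\mathbf{F}$.
   Context: Multigraphs are finite and loopless; a multigraph $\mathbf{G}$ on $[n]$ is given by multiplicities $g_{uv}=g_{vu}\in\mathbb{N}=\{0,1,2,\dots\}$, $g_{uu}=0$. For a multigraph $\mathbf{F}$ on $[k]$ with multiplicities $f_{ij}$ and edge set $E(F)=\{ij: f_{ij}>0\}$, the node-and-edge homomorphism density is $t(\mathbf{F},\mathbf{G})=n^{-k}\sum_{\varphi:[k]\to[n]}\prod_{ij\in E(F)}g_{\varphi(i)\varphi(j)}^{f_{ij}}$. A weight function is $\rho:\mathbb{N}\to(0,\infty)$ with $\sum_n\rho(n)n^p<\infty$ for all $p\ge0$. Let $\mathcal{C}_\rho=\{h:\mathbb{N}\to\mathbb{R}: h(m)\rho(m)\to0\}$ with norm $\sup_m|h(m)\rho(m)|$; each real polynomial $P$ gives the sequence $(P(0),P(1),\dots)\in\mathcal{C}_\rho$; $\mathcal{R}_\rho$ is the closure in $\mathcal{C}_\rho$ of the set of these sequences (a separable Banach space). $\widehat{\mathcal{J}}_\rho$ is the dual of $\mathcal{R}_\rho$; it is identified with the quotient of $\mathcal{J}_\rho=\{x\in\mathbb{R}^{\mathbb{N}}:\sum_m|x_m|/\rho(m)<\infty\}$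 in which two sequences are identified iff they have the same moments $\sum_m x_m m^p$ ($p\ge0$), with pairing $\langle P,[x]\rangle=\sum_m x_mP(m)$. A function $W:[0,1]^2\to\widehat{\mathcal{J}}_\rho$ is weak-* measurable if $\langle b,W\rangle$ is measurable for every $b\in\mathcal{R}_\rho$; a $\widehat{\mathcal{J}}_\rho$-graphon is a symmetric weak-* measurable $W$ such that $(x,y)\mapsto\|W(x,y)\|$ lies in $L^p([0,1]^2)$ for all $1\le p<\infty$. For a multigraph $\mathbf{F}$ on $[k]$, $\mathbf{F}'$ is the simple graph with edge set $E(F)$ where edge $ij$ is decorated by the polynomial $X^{f_{ij}}$, and $t(\mathbf{F}',W)=\int_{[0,1]^k}\prod_{ij\in E(F)}\langle X^{f_{ij}},W(x_i,x_j)\rangle\,dx$. *)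

theory Defs
  imports "HOL-Analysis.Analysis" "HOL-Computational_Algebra.Polynomial"
begin

text \<open>Finite loopless multigraphs on the node set \<open>{..<n}\<close>, \<open>n \<ge> 1\<close>. Only the values of
  \<open>mult G\<close> at pairs of nodes are relevant.\<close>

record multigraph =
  nodes :: nat
  mult :: "nat \<Rightarrow> nat \<Rightarrow> nat"

definition is_multigraph :: "multigraph \<Rightarrow> bool" where
  "is_multigraph G \<longleftrightarrow> nodes G \<ge> 1 \<and>
     (\<forall>u<nodes G. \<forall>v<nodes G. mult G u v = mult G v u) \<and>
     (\<forall>u<nodes G. mult G u u = 0)"

text \<open>Each unordered edge is represented once, by the pair with \<open>i < j\<close>.\<close>

definition edges :: "multigraph \<Rightarrow> (nat \<times> nat) set" where
  "edges F = {(i, j). i < j \<and> j < nodes F \<and> mult F i j > 0}"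

definition hom_density :: "multigraph \<Rightarrow> multigraph \<Rightarrow> real" where
  "hom_density F G =
     (\<Sum>\<phi> \<in> {..<nodes F} \<rightarrow>\<^sub>E {..<nodes G}.
        \<Prod>(i, j)\<in>edges F. real (mult G (\<phi> i) (\<phi> j)) ^ mult F i j)
     / real (nodes G) ^ nodes F"

definition weight_function :: "(nat \<Rightarrow> real) \<Rightarrow> bool" where
  "weight_function \<rho> \<longleftrightarrow> (\<forall>n. \<rho> n > 0) \<and> (\<forall>p::nat. summable (\<lambda>n. \<rho> n * real n ^ p))"

definition C_space :: "(nat \<Rightarrow> real) \<Rightarrow> (nat \<Rightarrow> real) set" where
  "C_space \<rho> = {h. (\<lambda>m. h m * \<rho> m) \<longlonglongrightarrow> 0}"

definition C_norm :: "(nat \<Rightarrow> real) \<Rightarrow> (nat \<Rightarrow> real) \<Rightarrow> real" where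
  "C_norm \<rho> h = (SUP m. \<bar>h m * \<rho> m\<bar>)"

definition poly_seq :: "real poly \<Rightarrow> nat \<Rightarrow> real" where
  "poly_seq P = (\<lambda>m. poly P (real m))"

text \<open>The closure, in the normed space \<open>C_space \<rho>\<close>, of the polynomial sequences.\<close>

definition R_space :: "(nat \<Rightarrow> real) \<Rightarrow> (nat \<Rightarrow> real) set" where
  "R_space \<rho> = {h \<in> C_space \<rho>. \<forall>\<epsilon>>0. \<exists>P. C_norm \<rho> (\<lambda>m. h m - poly_seq P m) < \<epsilon>}"

text \<open>The dual Banach space of \<open>R_space \<rho>\<close>: bounded linear functionals, made unique outside
  \<open>R_space \<rho>\<close> by extensionality. The pairing of \<open>b \<in> R_space \<rho>\<close> with \<open>\<xi> \<in> J_hat \<rho>\<close> is the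
  application \<open>\<xi> b\<close>. (A sequence \<open>x\<close> with \<open>\<Sum>m. \<bar>x m\<bar> / \<rho> m\<close> finite
  represents the functional \<open>h \<mapsto> \<Sum>m. x m * h m\<close>.)\<close>

definition J_hat :: "(nat \<Rightarrow> real) \<Rightarrow> ((nat \<Rightarrow> real) \<Rightarrow> real) set" where
  "J_hat \<rho> = {\<xi> \<in> extensional (R_space \<rho>).
     (\<forall>g\<in>R_space \<rho>. \<forall>h\<in>R_space \<rho>. \<xi> (\<lambda>m. g m + h m) = \<xi> g + \<xi> h) \<and>
     (\<forall>c. \<forall>h\<in>R_space \<rho>. \<xi> (\<lambda>m. c * h m) = c * \<xi> h) \<and>
     (\<exists>K. \<forall>h\<in>R_space \<rho>. \<bar>\<xi> h\<bar> \<le> K * C_norm \<rho> h)}"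

definition J_norm :: "(nat \<Rightarrow> real) \<Rightarrow> ((nat \<Rightarrow> real) \<Rightarrow> real) \<Rightarrow> real" where
  "J_norm \<rho> \<xi> = (SUP h\<in>{h \<in> R_space \<rho>. C_norm \<rho> h \<le> 1}. \<bar>\<xi> h\<bar>)"

type_synonym kernel = "real \<Rightarrow> real \<Rightarrow> (nat \<Rightarrow> real) \<Rightarrow> real"

abbreviation unit_square :: "(real \<times> real) measure" where
  "unit_square \<equiv> lebesgue_on ({0..1} \<times> {0..1})"

definition weak_star_measurable :: "(nat \<Rightarrow> real) \<Rightarrow> kernel \<Rightarrow> bool" where
  "weak_star_measurable \<rho> W \<longleftrightarrow>
     (\<forall>b\<in>R_space \<rho>. (\<lambda>(x, y). W x y b) \<in> borel_measurable unit_square)"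

definition J_graphon :: "(nat \<Rightarrow> real) \<Rightarrow> kernel \<Rightarrow> bool" where
  "J_graphon \<rho> W \<longleftrightarrow>
     (\<forall>x\<in>{0..1}. \<forall>y\<in>{0..1}. W x y \<in> J_hat \<rho> \<and> W x y = W y x) \<and>
     weak_star_measurable \<rho> W \<and>
     (\<forall>p::real. p \<ge> 1 \<longrightarrow> integrable unit_square (\<lambda>(x, y). J_norm \<rho> (W x y) powr p))"

text \<open>Lebesgue measure on \<open>[0,1]\<^sup>k\<close>. The completion matters: a kernel that is only Lebesgue
  measurable on the unit square need not give integrands measurable for the plain product.\<close>

definition unit_cube :: "nat \<Rightarrow> (nat \<Rightarrow> real) measure" where
  "unit_cube k = completion (\<Pi>\<^sub>M i\<in>{..<k}. restrict_space lborel {0..1})"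

definition decorated_density ::
    "nat \<Rightarrow> (nat \<times> nat) set \<Rightarrow> (nat \<Rightarrow> nat \<Rightarrow> nat \<Rightarrow> real) \<Rightarrow> kernel \<Rightarrow> real" where
  "decorated_density k E b W =
     (LINT x|unit_cube k. (\<Prod>(i, j)\<in>E. W (x i) (x j) (b i j)))"

text \<open>The density \<open>t(F', W)\<close>, where \<open>F'\<close> is the simple graph underlying \<open>F\<close> with each edge \<open>ij\<close>
  decorated by the polynomial \<open>X\<close> to the power \<open>mult F i j\<close>.\<close>

definition graphon_density :: "multigraph \<Rightarrow> kernel \<Rightarrow> real" where
  "graphon_density F W =
     decorated_density (nodes F) (edges F) (\<lambda>i j. poly_seq (monom 1 (mult F i j))) W"

lemma poly_seq_in_R_space:
  assumes "weight_function \<rho>"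
  shows "poly_seq P \<in> R_space \<rho>"
proof -
  have "summable (\<lambda>m. poly_seq P m * \<rho> m)"
  proof -
    have "summable (\<lambda>m. \<Sum>i\<le>degree P. coeff P i * (\<rho> m * real m ^ i))"
      using assms unfolding weight_function_def by (intro summable_sum summable_mult) blast
    moreover have "(\<lambda>m. \<Sum>i\<le>degree P. coeff P i * (\<rho> m * real m ^ i)) = (\<lambda>m. poly_seq P m * \<rho> m)"
      by (simp add: poly_seq_def poly_altdef sum_distrib_left mult_ac)
    ultimately show ?thesis by simp
  qed
  then have "poly_seq P \<in> C_space \<rho>"
    unfolding C_space_def by (simp add: summable_LIMSEQ_zero)
  moreover have "C_norm \<rho> (\<lambda>m. poly_seq P m - poly_seq P m) = 0"
    by (simp add: C_norm_def)
  ultimately show ?thesis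
    unfolding R_space_def by (auto intro!: exI[of _ P])
qed

end

theory Submission
  imports Defs
begin

text \<open>A multigraph is a complete graph whose edges are coloured by natural numbers. The indicator
  kernels of all colours are regularised simultaneously: repeatedly splitting a partition by a cut
  that nearly maximises the error over all colours increases an energy bounded by 1, so the cut errors are
  square-summable along the refinement, uniformly in the graph. Along a subsequence the part sizes,
  the colour densities and the cut errors of all levels converge; nested interval partitions of
  \<open>[0,1]\<close> with the limiting part sizes carry step kernels that are Cauchy in \<open>L\<^sup>1\<close>, again by
  monotonicity of the energy. Their limits \<open>\<mu> m\<close> are the colour kernels, and \<open>W(x,y)\<close> is the functional
  of the sequence \<open>m \<mapsto> \<mu> m x y\<close>. Convergence of all densities bounds all moments, hence
  the mean of \<open>\<mu> m\<close> decays faster than any power of \<open>m\<close>, which leaves room for a weight \<open>\<rho>\<close>;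
  and it lets multiplicities be truncated uniformly, so that the colour densities determine the densities of
  all powers.\<close>

section \<open>Weak regularity of edge colourings\<close>

text \<open>There are infinitely many colours, and regularising them one after another would spend a
  separate energy budget on each. A common budget exists because the indicators of the colours sum
  to 1 at every pair: summed over all colours, the squared block averages still total at most
  \<open>n^2\<close>. Hence the cut may be taken for whichever colour is worst, and the error of
  that one cut controls all colours.

  No accuracy is prescribed for a single level. Only the sum of the squared errors over the levels
  is bounded, and this bound survives the limit over the graphs, so the limiting errors tend to 0. A
  cut consists of two node sets and divides each cell into at most four, hence codes in base 4: a
  coarse code is a quotient of a finer one, both for nodes and for points of \<open>[0,1]\<close>,
  which lets inequalities between two levels pass from the graphs to the interval.

  The colour kernels are found along a subsequence only, but the densities converge along the whole
  sequence by hypothesis, so it is enough to identify each limit along the subsequence.\<close>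

definition cell :: "nat \<Rightarrow> (nat \<Rightarrow> nat) \<Rightarrow> nat \<Rightarrow> nat set" where
  "cell n c a = {u. u < n \<and> c u = a}"

text \<open>An empty cell gives the value 0 through division by zero, so multiplying the average by
  the block size recovers the block sum for empty cells too.\<close>

definition cell_avg ::
    "nat \<Rightarrow> (nat \<Rightarrow> nat) \<Rightarrow> (nat \<Rightarrow> nat \<Rightarrow> real) \<Rightarrow> nat \<Rightarrow> nat \<Rightarrow> real" where
  "cell_avg n c A a b = (\<Sum>u\<in>cell n c a. \<Sum>v\<in>cell n c b. A u v)
     / (real (card (cell n c a)) * real (card (cell n c b)))"

lemma finite_cell [simp]: "finite (cell n c a)"
  by (simp add: cell_def)

lemma sum_cells: "(\<Sum>u<n. f u) = (\<Sum>a\<in>c ` {..<n}. \<Sum>u\<in>cell n c a. f u)"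
  using sum.image_gen[of "{..<n}" f c] by (simp add: cell_def)

lemma sum_cells2:
  "(\<Sum>u<n. \<Sum>v<n. f u v) =
   (\<Sum>a\<in>c ` {..<n}. \<Sum>b\<in>c ` {..<n}. \<Sum>u\<in>cell n c a. \<Sum>v\<in>cell n c b. f u v)"
proof -
  have "(\<Sum>u<n. \<Sum>v<n. f u v) =
     (\<Sum>a\<in>c ` {..<n}. \<Sum>u\<in>cell n c a. \<Sum>b\<in>c ` {..<n}. \<Sum>v\<in>cell n c b. f u v)"
    by (subst sum_cells[of _ n c], intro sum.cong refl sum_cells)
  also have "\<dots> = (\<Sum>a\<in>c ` {..<n}. \<Sum>b\<in>c ` {..<n}. \<Sum>u\<in>cell n c a. \<Sum>v\<in>cell n c b. f u v)"
    by (intro sum.cong refl sum.swap)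
  finally show ?thesis .
qed

lemma cell_avg_times_card:
  "real (card (cell n c a)) * real (card (cell n c b)) * cell_avg n c A a b
     = (\<Sum>u\<in>cell n c a. \<Sum>v\<in>cell n c b. A u v)"
proof (cases "card (cell n c a) = 0 \<or> card (cell n c b) = 0")
  case True
  then have "cell n c a = {} \<or> cell n c b = {}" by simp
  then show ?thesis by (auto simp: cell_avg_def)
qed (simp add: cell_avg_def)

text \<open>Averaging over blocks is the orthogonal projection onto kernels that are constant on
  blocks: tested against such a kernel, \<open>A\<close> and its average agree.\<close>

lemma cell_avg_projection:
  "(\<Sum>u<n. \<Sum>v<n. cell_avg n c A (c u) (c v) * f (c u) (c v))
     = (\<Sum>u<n. \<Sum>v<n. A u v * f (c u) (c v))"
proof -
  have "(\<Sum>u\<in>cell n c a. \<Sum>v\<in>cell n c b. cell_avg n c A (c u) (c v) * f (c u) (c v))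
      = (\<Sum>u\<in>cell n c a. \<Sum>v\<in>cell n c b. A u v * f (c u) (c v))" for a b
  proof -
    have "(\<Sum>u\<in>cell n c a. \<Sum>v\<in>cell n c b. cell_avg n c A (c u) (c v) * f (c u) (c v))
       = (\<Sum>u\<in>cell n c a. \<Sum>v\<in>cell n c b. cell_avg n c A a b * f a b)"
      by (intro sum.cong refl) (auto simp: cell_def)
    also have "\<dots> = real (card (cell n c a)) * real (card (cell n c b)) * cell_avg n c A a b * f a b"
      by simp
    also have "\<dots> = (\<Sum>u\<in>cell n c a. \<Sum>v\<in>cell n c b. A u v) * f a b"
      by (simp only: cell_avg_times_card)
    also have "\<dots> = (\<Sum>u\<in>cell n c a. \<Sum>v\<in>cell n c b. A u v * f a b)"
      by (simp add: sum_distrib_right)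
    also have "\<dots> = (\<Sum>u\<in>cell n c a. \<Sum>v\<in>cell n c b. A u v * f (c u) (c v))"
      by (intro sum.cong refl) (auto simp: cell_def)
    finally show ?thesis .
  qed
  then show ?thesis
    unfolding sum_cells2[of _ n c] by simp
qed

text \<open>The coarse average is also constant on the blocks of the finer code \<open>c'\<close>,
  so the projection identity for \<open>c'\<close> and then for \<open>c\<close> turns the cross
  term into the coarse energy.\<close>

lemma cell_avg_pythagoras:
  assumes "\<And>u. u < n \<Longrightarrow> c u = p (c' u)"
  shows "(\<Sum>u<n. \<Sum>v<n. (cell_avg n c' A (c' u) (c' v) - cell_avg n c A (c u) (c v))\<^sup>2)
    = (\<Sum>u<n. \<Sum>v<n. (cell_avg n c' A (c' u) (c' v))\<^sup>2)
      - (\<Sum>u<n. \<Sum>v<n. (cell_avg n c A (c u) (c v))\<^sup>2)"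
proof -
  let ?U = "\<lambda>u v. cell_avg n c A (c u) (c v)" and ?V = "\<lambda>u v. cell_avg n c' A (c' u) (c' v)"
  have "(\<Sum>u<n. \<Sum>v<n. ?V u v * ?U u v)
      = (\<Sum>u<n. \<Sum>v<n. ?V u v * cell_avg n c A (p (c' u)) (p (c' v)))"
    by (intro sum.cong refl) (simp add: assms)
  also have "\<dots> = (\<Sum>u<n. \<Sum>v<n. A u v * cell_avg n c A (p (c' u)) (p (c' v)))"
    by (rule cell_avg_projection)
  also have "\<dots> = (\<Sum>u<n. \<Sum>v<n. A u v * cell_avg n c A (c u) (c v))"
    by (intro sum.cong refl) (simp add: assms)
  also have "\<dots> = (\<Sum>u<n. \<Sum>v<n. ?U u v * ?U u v)"
    by (rule cell_avg_projection[symmetric])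
  finally have cross: "(\<Sum>u<n. \<Sum>v<n. ?V u v * ?U u v) = (\<Sum>u<n. \<Sum>v<n. (?U u v)\<^sup>2)"
    by (simp add: power2_eq_square)
  have "(\<Sum>u<n. \<Sum>v<n. (?V u v - ?U u v)\<^sup>2)
     = (\<Sum>u<n. \<Sum>v<n. (?V u v)\<^sup>2 + (?U u v)\<^sup>2 - 2 * (?V u v * ?U u v))"
    by (simp add: power2_diff mult.assoc)
  also have "\<dots> = (\<Sum>u<n. \<Sum>v<n. (?V u v)\<^sup>2) + (\<Sum>u<n. \<Sum>v<n. (?U u v)\<^sup>2)
      - 2 * (\<Sum>u<n. \<Sum>v<n. ?V u v * ?U u v)"
    by (simp only: sum.distrib sum_subtractf sum_distrib_left)
  finally show ?thesis by (simp add: cross)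
qed

lemma cell_avg_bounds:
  assumes "\<And>u v. 0 \<le> A u v" "\<And>u v. A u v \<le> 1"
  shows "0 \<le> cell_avg n c A a b" "cell_avg n c A a b \<le> 1"
proof -
  show "0 \<le> cell_avg n c A a b"
    unfolding cell_avg_def using assms by (intro divide_nonneg_nonneg sum_nonneg) auto
  have "(\<Sum>u\<in>cell n c a. \<Sum>v\<in>cell n c b. A u v) \<le> (\<Sum>u\<in>cell n c a. \<Sum>v\<in>cell n c b. 1)"
    by (intro sum_mono assms)
  then have "(\<Sum>u\<in>cell n c a. \<Sum>v\<in>cell n c b. A u v)
      \<le> real (card (cell n c a)) * real (card (cell n c b))" by simp
  then show "cell_avg n c A a b \<le> 1"
    unfolding cell_avg_def
    by (cases "real (card (cell n c a)) * real (card (cell n c b)) = 0")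
      (simp only: div_by_0 zero_le_one, simp add: pos_divide_le_eq zero_less_mult_iff card_gt_0_iff)
qed

lemma cell_avg_sym:
  assumes "\<And>u v. u < n \<Longrightarrow> v < n \<Longrightarrow> A u v = A v u"
  shows "cell_avg n c A a b = cell_avg n c A b a"
proof -
  have "(\<Sum>u\<in>cell n c a. \<Sum>v\<in>cell n c b. A u v) = (\<Sum>v\<in>cell n c b. \<Sum>u\<in>cell n c a. A u v)"
    by (rule sum.swap)
  also have "\<dots> = (\<Sum>v\<in>cell n c b. \<Sum>u\<in>cell n c a. A v u)"
    by (intro sum.cong refl assms) (auto simp: cell_def)
  finally show ?thesis by (simp add: cell_avg_def mult.commute)
qed

lemma double_sum_Cauchy_Schwarz:
  fixes X Y :: "nat \<Rightarrow> nat \<Rightarrow> real"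
  shows "(\<Sum>u<n. \<Sum>v<n. X u v * Y u v)\<^sup>2
     \<le> (\<Sum>u<n. \<Sum>v<n. (X u v)\<^sup>2) * (\<Sum>u<n. \<Sum>v<n. (Y u v)\<^sup>2)"
  using Cauchy_Schwarz_ineq_sum[of "\<lambda>(u, v). X u v" "\<lambda>(u, v). Y u v" "{..<n} \<times> {..<n}"]
  by (simp add: sum.cartesian_product case_prod_unfold)

lemma double_sum_subset:
  fixes X :: "nat \<Rightarrow> nat \<Rightarrow> real"
  assumes "S \<subseteq> {..<n}" "T \<subseteq> {..<n}"
  shows "(\<Sum>u\<in>S. \<Sum>v\<in>T. X u v) = (\<Sum>u<n. \<Sum>v<n. X u v * (of_bool (u \<in> S) * of_bool (v \<in> T)))"
proof -
  have "(\<Sum>u<n. \<Sum>v<n. X u v * (of_bool (u \<in> S) * of_bool (v \<in> T)))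
     = (\<Sum>u<n. of_bool (u \<in> S) * (\<Sum>v<n. of_bool (v \<in> T) * X u v))"
    unfolding sum_distrib_left by (intro sum.cong refl) simp
  also have "\<dots> = (\<Sum>u<n. if u \<in> S then \<Sum>v<n. if v \<in> T then X u v else 0 else 0)"
  proof (intro sum.cong refl)
    fix u
    have "(\<Sum>v<n. of_bool (v \<in> T) * X u v) = (\<Sum>v<n. if v \<in> T then X u v else 0)"
      by (intro sum.cong) auto
    then show "of_bool (u \<in> S) * (\<Sum>v<n. of_bool (v \<in> T) * X u v)
        = (if u \<in> S then \<Sum>v<n. if v \<in> T then X u v else 0 else 0)" by simp
  qed
  also have "\<dots> = (\<Sum>u\<in>{..<n} \<inter> S. \<Sum>v\<in>{..<n} \<inter> T. X u v)"
    by (simp only: sum.inter_restrict[OF finite_lessThan])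
  also have "\<dots> = (\<Sum>u\<in>S. \<Sum>v\<in>T. X u v)"
    using assms by (simp only: Int_absorb1)
  finally show ?thesis by simp
qed

text \<open>Since \<open>S\<close> and \<open>T\<close> are unions of cells of \<open>c'\<close>,
  the indicator of their product is a step kernel for \<open>c'\<close>, and \<open>A\<close> may be
  replaced by its average over \<open>c'\<close>. Cauchy-Schwarz against this indicator, whose
  squared norm is at most \<open>n^2\<close>, reduces the claim to the Pythagorean identity.\<close>

lemma refinement_gain:
  assumes p: "\<And>u. u < n \<Longrightarrow> c u = p (c' u)"
    and S: "S = {u. u < n \<and> s (c' u)}" and T: "T = {v. v < n \<and> t (c' v)}"
  shows "(\<Sum>u\<in>S. \<Sum>v\<in>T. A u v - cell_avg n c A (c u) (c v))\<^sup>2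
    \<le> (real n)\<^sup>2 * ((\<Sum>u<n. \<Sum>v<n. (cell_avg n c' A (c' u) (c' v))\<^sup>2)
      - (\<Sum>u<n. \<Sum>v<n. (cell_avg n c A (c u) (c v))\<^sup>2))"
proof -
  let ?U = "\<lambda>u v. cell_avg n c A (c u) (c v)" and ?V = "\<lambda>u v. cell_avg n c' A (c' u) (c' v)"
  let ?f = "\<lambda>a b. of_bool (s a) * of_bool (t b) :: real"
  have "(\<Sum>u\<in>S. \<Sum>v\<in>T. A u v - ?U u v)
     = (\<Sum>u<n. \<Sum>v<n. (A u v - ?U u v) * (of_bool (u \<in> S) * of_bool (v \<in> T)))"
    by (rule double_sum_subset) (auto simp: S T)
  also have "\<dots> = (\<Sum>u<n. \<Sum>v<n. A u v * ?f (c' u) (c' v) - ?U u v * ?f (c' u) (c' v))"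
    by (intro sum.cong refl) (simp add: S T left_diff_distrib)
  also have "\<dots> = (\<Sum>u<n. \<Sum>v<n. A u v * ?f (c' u) (c' v)) - (\<Sum>u<n. \<Sum>v<n. ?U u v * ?f (c' u) (c' v))"
    by (simp only: sum_subtractf)
  also have "\<dots> = (\<Sum>u<n. \<Sum>v<n. ?V u v * ?f (c' u) (c' v)) - (\<Sum>u<n. \<Sum>v<n. ?U u v * ?f (c' u) (c' v))"
    using cell_avg_projection[of n c' A ?f] by simp
  also have "\<dots> = (\<Sum>u<n. \<Sum>v<n. (?V u v - ?U u v) * ?f (c' u) (c' v))"
    by (simp only: sum_subtractf left_diff_distrib)
  finally have "(\<Sum>u\<in>S. \<Sum>v\<in>T. A u v - ?U u v)\<^sup>2
      = (\<Sum>u<n. \<Sum>v<n. (?V u v - ?U u v) * ?f (c' u) (c' v))\<^sup>2" by simp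
  also have "\<dots> \<le> (\<Sum>u<n. \<Sum>v<n. (?V u v - ?U u v)\<^sup>2) * (\<Sum>u<n. \<Sum>v<n. (?f (c' u) (c' v))\<^sup>2)"
    by (rule double_sum_Cauchy_Schwarz)
  also have "\<dots> \<le> (\<Sum>u<n. \<Sum>v<n. (?V u v - ?U u v)\<^sup>2) * (\<Sum>u<n. \<Sum>v<n. 1)"
    by (intro mult_left_mono sum_mono sum_nonneg) auto
  also have "\<dots> = (real n)\<^sup>2 * (\<Sum>u<n. \<Sum>v<n. (?V u v - ?U u v)\<^sup>2)"
    by (simp add: power2_eq_square)
  also have "\<dots> = (real n)\<^sup>2 * ((\<Sum>u<n. \<Sum>v<n. (?V u v)\<^sup>2) - (\<Sum>u<n. \<Sum>v<n. (?U u v)\<^sup>2))"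
    using cell_avg_pythagoras[where c=c and p=p and A=A, OF p] by simp
  finally show ?thesis .
qed

section \<open>Edge colourings: cut errors and the joint energy of all colours\<close>

definition colour_class :: "(nat \<Rightarrow> nat \<Rightarrow> nat) \<Rightarrow> nat \<Rightarrow> nat \<Rightarrow> nat \<Rightarrow> real" where
  "colour_class g m u v = of_bool (g u v = m)"

definition avg_kernel ::
    "nat \<Rightarrow> (nat \<Rightarrow> nat) \<Rightarrow> (nat \<Rightarrow> nat \<Rightarrow> nat) \<Rightarrow> nat \<Rightarrow> nat \<Rightarrow> nat \<Rightarrow> real" where
  "avg_kernel n c g m u v = cell_avg n c (colour_class g m) (c u) (c v)"

definition cut_err ::
    "nat \<Rightarrow> (nat \<Rightarrow> nat) \<Rightarrow> (nat \<Rightarrow> nat \<Rightarrow> nat) \<Rightarrow> nat \<Rightarrow> nat set \<Rightarrow> nat set \<Rightarrow> real" where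
  "cut_err n c g m S T = (\<Sum>u\<in>S. \<Sum>v\<in>T. colour_class g m u v - avg_kernel n c g m u v)"

definition colour_energy :: "nat \<Rightarrow> (nat \<Rightarrow> nat) \<Rightarrow> (nat \<Rightarrow> nat \<Rightarrow> nat) \<Rightarrow> nat \<Rightarrow> real" where
  "colour_energy n c g m = (\<Sum>u<n. \<Sum>v<n. (avg_kernel n c g m u v)\<^sup>2)"

definition energy :: "nat \<Rightarrow> (nat \<Rightarrow> nat) \<Rightarrow> (nat \<Rightarrow> nat \<Rightarrow> nat) \<Rightarrow> real" where
  "energy n c g = (\<Sum>m\<in>{g u v | u v. u < n \<and> v < n}. colour_energy n c g m)"

lemma colour_class_bounds: "0 \<le> colour_class g m u v" "colour_class g m u v \<le> 1"
  by (auto simp: colour_class_def)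

lemma avg_kernel_bounds: "0 \<le> avg_kernel n c g m u v" "avg_kernel n c g m u v \<le> 1"
  unfolding avg_kernel_def by (intro cell_avg_bounds colour_class_bounds)+

lemma finite_colours: "finite {g u v | u v. u < (n::nat) \<and> v < n}"
  using finite_imageI[of "{..<n} \<times> {..<n}" "\<lambda>(u, v). g u v"]
  by (rule finite_subset[rotated]) (auto simp: image_iff)

text \<open>Averages lie in \<open>[0,1]\<close>, so their squares are at most the averages;
  averaging preserves the total; and every pair has exactly one colour. The number of colours does
  not enter.\<close>

lemma energy_le: "energy n c g \<le> (real n)\<^sup>2"
proof -
  let ?R = "{g u v | u v. u < n \<and> v < n}"
  have "energy n c g \<le> (\<Sum>m\<in>?R. \<Sum>u<n. \<Sum>v<n. avg_kernel n c g m u v)"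
    unfolding energy_def colour_energy_def
    by (intro sum_mono) (simp add: power2_eq_square avg_kernel_bounds mult_left_le)
  also have "\<dots> = (\<Sum>m\<in>?R. \<Sum>u<n. \<Sum>v<n. colour_class g m u v)"
    using cell_avg_projection[of n c _ "\<lambda>_ _. 1"] by (simp add: avg_kernel_def)
  also have "\<dots> = (\<Sum>u<n. \<Sum>v<n. \<Sum>m\<in>?R. colour_class g m u v)"
    by (subst sum.swap) (intro sum.cong refl sum.swap)
  also have "\<dots> = (\<Sum>u<n. \<Sum>v<n. 1)"
  proof (intro sum.cong refl)
    fix u v assume "u \<in> {..<n}" "v \<in> {..<n}"
    then have "g u v \<in> ?R" by auto
    then show "(\<Sum>m\<in>?R. colour_class g m u v) = 1"
      unfolding colour_class_def of_bool_def using finite_colours[of g n] by (simp add: sum.delta)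
  qed
  also have "\<dots> = (real n)\<^sup>2" by (simp add: power2_eq_square)
  finally show ?thesis .
qed

lemma colour_energy_mono:
  assumes "\<And>u. u < n \<Longrightarrow> c u = p (c' u)"
  shows "colour_energy n c g m \<le> colour_energy n c' g m"
proof -
  have "0 \<le> (\<Sum>u<n. \<Sum>v<n. (cell_avg n c' (colour_class g m) (c' u) (c' v)
     - cell_avg n c (colour_class g m) (c u) (c v))\<^sup>2)"
    by (intro sum_nonneg) auto
  then show ?thesis
    using cell_avg_pythagoras[where c=c and p=p and A="colour_class g m", OF assms]
    by (simp add: colour_energy_def avg_kernel_def)
qed

lemma cut_err_bound:
  assumes "S \<subseteq> {..<n}" "T \<subseteq> {..<n}"
  shows "\<bar>cut_err n c g m S T\<bar> \<le> (real n)\<^sup>2"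
proof -
  have fin: "finite S" "finite T" using assms finite_subset by auto
  have card: "card S \<le> n" "card T \<le> n"
    using card_mono[OF _ assms(1)] card_mono[OF _ assms(2)] by simp_all
  have "\<bar>cut_err n c g m S T\<bar> \<le> (\<Sum>u\<in>S. \<Sum>v\<in>T. \<bar>colour_class g m u v - avg_kernel n c g m u v\<bar>)"
    unfolding cut_err_def by (intro order.trans[OF sum_abs] sum_mono sum_abs)
  also have "\<dots> \<le> (\<Sum>u\<in>S. \<Sum>v\<in>T. 1)"
  proof (intro sum_mono)
    fix u v
    show "\<bar>colour_class g m u v - avg_kernel n c g m u v\<bar> \<le> 1"
      using colour_class_bounds[of g m u v] avg_kernel_bounds[of n c g m u v] by linarith
  qed
  also have "\<dots> = real (card S) * real (card T)" by simp
  also have "\<dots> \<le> real n * real n" using card by (intro mult_mono) auto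
  finally show ?thesis by (simp add: power2_eq_square)
qed

text \<open>The supremum in the regularity step ranges over all natural numbers as colours, while
  \<open>energy\<close> sums only over those that occur; the other colours have to contribute no
  error.\<close>

lemma cut_err_unused_colour:
  assumes "S \<subseteq> {..<n}" "T \<subseteq> {..<n}" "m \<notin> {g u v | u v. u < n \<and> v < n}"
  shows "cut_err n c g m S T = 0"
proof -
  have *: "colour_class g m u v = 0" if "u < n" "v < n" for u v
    using assms(3) that by (auto simp: colour_class_def)
  have "cell_avg n c (colour_class g m) a b = 0" for a b
  proof -
    have "(\<Sum>u\<in>cell n c a. \<Sum>v\<in>cell n c b. colour_class g m u v) = 0"
      by (intro sum.neutral ballI *) (auto simp: cell_def)
    then show ?thesis by (simp add: cell_avg_def)
  qed
  then show ?thesis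
    unfolding cut_err_def avg_kernel_def using assms(1,2) * by (auto intro!: sum.neutral simp: subset_iff)
qed

text \<open>\<open>\<delta>\<close> is the supremum of the normalised cut error over all colours and
  all pairs of node sets. Splitting by a cut that reaches half of it gains
  \<open>(\<delta> / 2)^2 * n^2\<close> in the energy of its colour, and refinement lowers the
  energy of no other colour.\<close>

lemma regularity_step:
  assumes n: "n \<ge> 1"
  shows "\<exists>c' \<delta>. (\<forall>u. c u = c' u div 4) \<and> 0 \<le> \<delta> \<and> \<delta> \<le> 1 \<and>
    (\<forall>m S T. S \<subseteq> {..<n} \<longrightarrow> T \<subseteq> {..<n} \<longrightarrow> \<bar>cut_err n c g m S T\<bar> \<le> \<delta> * (real n)\<^sup>2) \<and>
    energy n c g + (\<delta> / 2)\<^sup>2 * (real n)\<^sup>2 \<le> energy n c' g"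
proof -
  define I where "I = {(m::nat, S, T). S \<subseteq> {..<n} \<and> T \<subseteq> {..<n}}"
  define f where "f = (\<lambda>(m, S, T). \<bar>cut_err n c g m S T\<bar> / (real n)\<^sup>2)"
  define \<delta> where "\<delta> = (SUP i\<in>I. f i)"
  have n2: "(real n)\<^sup>2 > 0" using n by simp
  have I0: "(0, {}, {}) \<in> I" by (simp add: I_def)
  have f1: "0 \<le> f i \<and> f i \<le> 1" if "i \<in> I" for i
    using that cut_err_bound n2 by (auto simp: I_def f_def)
  have bdd: "bdd_above (f ` I)" using f1 by (auto intro!: bdd_aboveI[of _ 1])
  have \<delta>0: "0 \<le> \<delta>" unfolding \<delta>_def using f1[OF I0] by (intro cSUP_upper2[OF bdd I0]) auto
  have \<delta>1: "\<delta> \<le> 1" unfolding \<delta>_def using I0 f1 by (intro cSUP_least) auto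
  have cut: "\<bar>cut_err n c g m S T\<bar> \<le> \<delta> * (real n)\<^sup>2" if "S \<subseteq> {..<n}" "T \<subseteq> {..<n}" for m S T
  proof -
    have "f (m, S, T) \<le> \<delta>"
      unfolding \<delta>_def using that by (intro cSUP_upper bdd) (auto simp: I_def)
    then show ?thesis using n2 by (simp add: f_def field_simps)
  qed
  \<comment> \<open>Half the supremum is reached without showing that the supremum is attained: if
    it is positive, half of it is strictly smaller.\<close>
  obtain m S T where mST: "S \<subseteq> {..<n}" "T \<subseteq> {..<n}" "\<delta> / 2 \<le> f (m, S, T)"
  proof (cases "\<delta> = 0")
    case True
    with that[of "{}" "{}" 0] f1[OF I0] show ?thesis by simp
  next
    case False
    then have "\<delta> / 2 < (SUP i\<in>I. f i)" using \<delta>0 by (simp add: \<delta>_def)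
    then obtain i where "i \<in> I" "\<delta> / 2 < f i"
      using I0 bdd by (subst (asm) less_cSUP_iff) auto
    then show ?thesis using that[of "fst (snd i)" "snd (snd i)" "fst i"] by (auto simp: I_def)
  qed
  \<comment> \<open>Two new binary digits record membership in \<open>S\<close> and in
    \<open>T\<close>, so the old code is the quotient by 4 and both sets can be read off the new
    code.\<close>
  define c' where "c' u = 4 * c u + 2 * of_bool (u \<in> S) + of_bool (u \<in> T)" for u
  have code_arith: "Suc (4 * a) div 4 = a" "Suc (4 * a) mod 2 = 1" for a :: nat
    by presburger+
  then have c': "c u = c' u div 4" for u by (simp add: c'_def)
  have S: "S = {u. u < n \<and> c' u mod 4 div 2 = 1}" and T: "T = {u. u < n \<and> c' u mod 2 = 1}"
    using mST(1,2) code_arith by (auto simp: c'_def of_bool_def)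
  let ?R = "{g u v | u v. u < n \<and> v < n}"
  have mono: "colour_energy n c g m \<le> colour_energy n c' g m" for m
    using colour_energy_mono[of n c "\<lambda>a. a div 4" c'] c' by simp
  have "energy n c g + (\<delta> / 2)\<^sup>2 * (real n)\<^sup>2 \<le> energy n c' g"
  proof (cases "m \<in> ?R")
    case True
    have "(\<delta> / 2 * (real n)\<^sup>2)\<^sup>2 \<le> (cut_err n c g m S T)\<^sup>2"
      using mST(3) n2 \<delta>0 by (subst abs_le_square_iff[symmetric]) (simp add: f_def field_simps)
    also have "\<dots> \<le> (real n)\<^sup>2 * (colour_energy n c' g m - colour_energy n c g m)"
      unfolding cut_err_def colour_energy_def avg_kernel_def
      by (rule refinement_gain[where p="\<lambda>a. a div 4" and s="\<lambda>a. a mod 4 div 2 = 1"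
            and t="\<lambda>a. a mod 2 = 1"]) (use c' S T in auto)
    finally have "(real n)\<^sup>2 * ((\<delta> / 2)\<^sup>2 * (real n)\<^sup>2)
       \<le> (real n)\<^sup>2 * (colour_energy n c' g m - colour_energy n c g m)"
      by (simp add: power2_eq_square mult_ac)
    then have gain: "(\<delta> / 2)\<^sup>2 * (real n)\<^sup>2 \<le> colour_energy n c' g m - colour_energy n c g m"
      using n2 by (simp only: mult_le_cancel_left_pos)
    also have "\<dots> \<le> (\<Sum>m\<in>?R. colour_energy n c' g m - colour_energy n c g m)"
      using mono by (intro member_le_sum True finite_colours) auto
    finally show ?thesis by (simp add: energy_def sum_subtractf)
  next
    case False
    \<comment> \<open>If the near-maximiser belongs to a colour that does not occur, then
      \<open>\<delta>\<close> is 0 and monotonicity of the energy is enough.\<close>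
    then have "f (m, S, T) = 0" using cut_err_unused_colour[OF mST(1,2) False] by (simp add: f_def)
    then have "\<delta> = 0" using mST(3) \<delta>0 by simp
    then show ?thesis unfolding energy_def by (simp add: sum_mono mono)
  qed
  then show ?thesis using c' \<delta>0 \<delta>1 cut by blast
qed

text \<open>The bound 4 on the sum of squares arises from gains
  \<open>(\<delta> t / 2)^2 * n^2\<close> whose total is at most \<open>n^2\<close>.\<close>

definition regular_codes ::
    "nat \<Rightarrow> (nat \<Rightarrow> nat \<Rightarrow> nat) \<Rightarrow> (nat \<Rightarrow> nat \<Rightarrow> nat) \<Rightarrow> (nat \<Rightarrow> real) \<Rightarrow> bool" where
  "regular_codes n g c \<delta> \<longleftrightarrow>
    (\<forall>t u. c t u < 4 ^ t) \<and> (\<forall>t u. c t u = c (Suc t) u div 4) \<and>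
    (\<forall>t. 0 \<le> \<delta> t \<and> \<delta> t \<le> 1) \<and> (\<forall>K. (\<Sum>t<K. (\<delta> t)\<^sup>2) \<le> 4) \<and>
    (\<forall>t m S T. S \<subseteq> {..<n} \<longrightarrow> T \<subseteq> {..<n} \<longrightarrow> \<bar>cut_err n (c t) g m S T\<bar> \<le> \<delta> t * (real n)\<^sup>2)"

lemma ex_regular_codes:
  assumes n: "n \<ge> 1"
  shows "\<exists>c \<delta>. regular_codes n g c \<delta>"
proof -
  obtain nxt err where
    nxt: "\<And>c u. c u = nxt c u div 4" and err: "\<And>c. 0 \<le> err c" "\<And>c. err c \<le> 1"
    and cut: "\<And>c m S T. S \<subseteq> {..<n} \<Longrightarrow> T \<subseteq> {..<n} \<Longrightarrow> \<bar>cut_err n c g m S T\<bar> \<le> err c * (real n)\<^sup>2"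
    and en: "\<And>c. energy n c g + (err c / 2)\<^sup>2 * (real n)\<^sup>2 \<le> energy n (nxt c) g"
    using regularity_step[OF n, of _ g] by metis
  define c where "c t = (nxt ^^ t) (\<lambda>_. 0)" for t
  have step: "c (Suc t) = nxt (c t)" for t by (simp add: c_def)
  have lt: "c t u < 4 ^ t" for t u
  proof (induction t)
    case (Suc t)
    have "c (Suc t) u div 4 < 4 ^ t" using Suc nxt[of "c t" u] by (simp add: step)
    then show ?case by (simp add: div_less_iff_less_mult mult.commute)
  qed (simp add: c_def)
  have "(\<Sum>t<K. (err (c t) / 2)\<^sup>2 * (real n)\<^sup>2) \<le> energy n (c K) g" for K
  proof (induction K)
    case 0
    show ?case by (auto simp: energy_def colour_energy_def intro!: sum_nonneg)
  next
    case (Suc K)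
    then show ?case using en[of "c K"] by (simp add: step)
  qed
  then have "(\<Sum>t<K. (err (c t))\<^sup>2) * ((real n)\<^sup>2 / 4) \<le> (real n)\<^sup>2" for K
    using order.trans[OF _ energy_le[of n "c K" g]]
    unfolding sum_distrib_right power_divide by simp
  then have "(\<Sum>t<K. (err (c t))\<^sup>2) \<le> 4" for K
    using n by (simp add: field_simps)
  then have "regular_codes n g c (\<lambda>t. err (c t))"
    using lt nxt err cut step unfolding regular_codes_def by auto
  then show ?thesis by blast
qed

section \<open>Counting lemma and step kernels\<close>

text \<open>Exchanging the new value with the old one,
  \<open>(\<phi>, u) \<mapsto> (\<phi>(i := u), \<phi> i)\<close>, is an involution. The lemma
  replaces Fubini: coordinate \<open>i\<close> gets its own sum while the set of maps stays in one
  piece.\<close>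

lemma sum_PiE_resample:
  fixes F :: "(nat \<Rightarrow> nat) \<Rightarrow> real"
  assumes "i < k"
  shows "(\<Sum>\<phi>\<in>{..<k} \<rightarrow>\<^sub>E {..<n}. \<Sum>u<n. F (\<phi>(i := u))) = real n * (\<Sum>\<phi>\<in>{..<k} \<rightarrow>\<^sub>E {..<n}. F \<phi>)"
proof -
  let ?X = "{..<k} \<rightarrow>\<^sub>E {..<n}"
  have upd: "\<phi>(i := u) \<in> ?X" if "\<phi> \<in> ?X" "u < n" for \<phi> u
    using that assms by (auto simp: PiE_def extensional_def)
  have mem: "\<phi> i < n" if "\<phi> \<in> ?X" for \<phi> using that assms by auto
  have "(\<Sum>\<phi>\<in>?X. \<Sum>u<n. F (\<phi>(i := u))) = (\<Sum>(\<phi>, u)\<in>?X \<times> {..<n}. F (\<phi>(i := u)))"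
    by (simp add: sum.cartesian_product)
  also have "\<dots> = (\<Sum>(\<phi>, u)\<in>?X \<times> {..<n}. F \<phi>)"
    by (rule sum.reindex_bij_witness[of _ "\<lambda>(\<phi>, u). (\<phi>(i := u), \<phi> i)" "\<lambda>(\<phi>, u). (\<phi>(i := u), \<phi> i)"])
      (use upd mem in auto)
  also have "\<dots> = (\<Sum>\<phi>\<in>?X. \<Sum>u<n. F \<phi>)" by (rule sum.cartesian_product[symmetric])
  also have "\<dots> = real n * (\<Sum>\<phi>\<in>?X. F \<phi>)" by (simp add: sum_distrib_left)
  finally show ?thesis .
qed

text \<open>The sum is linear in the weights, so its extremes over \<open>[0,1]\<close>-valued
  weights occur at the indicators of \<open>{h \<ge> 0}\<close> and
  \<open>{h \<le> 0}\<close>.\<close>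

lemma sum_weighted_bound:
  fixes h f :: "nat \<Rightarrow> real"
  assumes bound: "\<And>S. S \<subseteq> {..<n} \<Longrightarrow> \<bar>\<Sum>u\<in>S. h u\<bar> \<le> B"
    and f: "\<And>u. u < n \<Longrightarrow> 0 \<le> f u \<and> f u \<le> 1"
  shows "\<bar>\<Sum>u<n. f u * h u\<bar> \<le> B"
proof -
  have "(\<Sum>u<n. f u * h u) \<le> (\<Sum>u<n. if h u \<ge> 0 then h u else 0)"
    using f by (intro sum_mono) (auto simp: mult_left_le_one_le mult_nonneg_nonpos)
  also have "\<dots> = (\<Sum>u\<in>{u. u < n \<and> h u \<ge> 0}. h u)"
    by (subst sum.inter_filter[symmetric]) auto
  also have "\<dots> \<le> B" by (rule abs_le_D1[OF bound]) auto
  finally have up: "(\<Sum>u<n. f u * h u) \<le> B" .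
  have "- B \<le> (\<Sum>u\<in>{u. u < n \<and> h u \<le> 0}. h u)"
    using abs_le_D2[OF bound, of "{u. u < n \<and> h u \<le> 0}"] by fastforce
  also have "\<dots> = (\<Sum>u<n. if h u \<le> 0 then h u else 0)"
    by (subst sum.inter_filter[symmetric]) auto
  also have "\<dots> \<le> (\<Sum>u<n. f u * h u)"
  proof (intro sum_mono)
    fix u assume "u \<in> {..<n}"
    then have "0 \<le> f u" "f u \<le> 1" using f by auto
    then show "(if h u \<le> 0 then h u else 0) \<le> f u * h u"
      using mult_right_mono_neg[of "f u" 1 "h u"] by auto
  qed
  finally show ?thesis using up by linarith
qed

text \<open>One application of the linear bound in each variable turns a bound for pairs of sets
  into a bound for pairs of \<open>[0,1]\<close>-valued weights.\<close>

lemma sum_bilinear_bound: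
  fixes D :: "nat \<Rightarrow> nat \<Rightarrow> real"
  assumes bound: "\<And>S T. S \<subseteq> {..<n} \<Longrightarrow> T \<subseteq> {..<n} \<Longrightarrow> \<bar>\<Sum>u\<in>S. \<Sum>v\<in>T. D u v\<bar> \<le> B"
    and f: "\<And>u. u < n \<Longrightarrow> 0 \<le> f u \<and> f u \<le> 1" and g: "\<And>v. v < n \<Longrightarrow> 0 \<le> g v \<and> g v \<le> 1"
  shows "\<bar>\<Sum>u<n. \<Sum>v<n. D u v * f u * g v\<bar> \<le> B"
proof -
  have "\<bar>\<Sum>v\<in>T. \<Sum>u<n. f u * D u v\<bar> \<le> B" if T: "T \<subseteq> {..<n}" for T
  proof -
    have "\<bar>\<Sum>u<n. f u * (\<Sum>v\<in>T. D u v)\<bar> \<le> B"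
      by (rule sum_weighted_bound[OF bound f]) (use T in auto)
    then show ?thesis by (subst sum.swap) (simp add: sum_distrib_left)
  qed
  then have "\<bar>\<Sum>v<n. g v * (\<Sum>u<n. f u * D u v)\<bar> \<le> B"
    by (rule sum_weighted_bound) (use g in auto)
  moreover have "(\<Sum>v<n. g v * (\<Sum>u<n. f u * D u v)) = (\<Sum>u<n. \<Sum>v<n. D u v * f u * g v)"
    by (subst sum.swap) (simp add: sum_distrib_left mult_ac)
  ultimately show ?thesis by simp
qed

text \<open>Each edge carries its own kernel, because different edges may ask for different colours
  and because the counting lemma exchanges kernels edge by edge.\<close>

definition kernel_hom ::
    "nat \<Rightarrow> (nat \<times> nat) set \<Rightarrow> nat \<Rightarrow> (nat \<times> nat \<Rightarrow> nat \<Rightarrow> nat \<Rightarrow> real) \<Rightarrow> real" where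
  "kernel_hom k E n K = (\<Sum>\<phi>\<in>{..<k} \<rightarrow>\<^sub>E {..<n}. \<Prod>e\<in>E. K e (\<phi> (fst e)) (\<phi> (snd e))) / real n ^ k"

definition edge_set :: "nat \<Rightarrow> (nat \<times> nat) set \<Rightarrow> bool" where
  "edge_set k E \<longleftrightarrow> (\<forall>e\<in>E. fst e < snd e \<and> snd e < k)"

lemma edge_set_finite: "edge_set k E \<Longrightarrow> finite E"
  by (rule finite_subset[of _ "{..<k} \<times> {..<k}"]) (force simp: edge_set_def)+

text \<open>With all nodes but \<open>i\<close> and \<open>j\<close> fixed, no remaining edge meets both \<open>i\<close> and \<open>j\<close>, so the other factors
  split into a function of \<open>\<phi> i\<close> and a function of \<open>\<phi> j\<close>.\<close>

lemma counting_single: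
  assumes E: "edge_set k E" and n: "n \<ge> 1" and ij: "i < j" "j < k" "(i, j) \<notin> E"
    and K: "\<And>e u v. 0 \<le> K e u v" "\<And>e u v. K e u v \<le> (1::real)"
    and D: "\<And>S T. S \<subseteq> {..<n} \<Longrightarrow> T \<subseteq> {..<n} \<Longrightarrow> \<bar>\<Sum>u\<in>S. \<Sum>v\<in>T. D u v\<bar> \<le> \<delta> * (real n)\<^sup>2"
  shows "\<bar>\<Sum>\<phi>\<in>{..<k} \<rightarrow>\<^sub>E {..<n}. D (\<phi> i) (\<phi> j) * (\<Prod>e\<in>E. K e (\<phi> (fst e)) (\<phi> (snd e)))\<bar>
     \<le> \<delta> * real n ^ k"
proof -
  let ?X = "{..<k} \<rightarrow>\<^sub>E {..<n}"
  define P where "P E \<phi> = (\<Prod>e\<in>E. K e (\<phi> (fst e)) (\<phi> (snd e)))" for E and \<phi> :: "nat \<Rightarrow> nat"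
  \<comment> \<open>The edges in \<open>E1\<close> avoid \<open>j\<close>, so their product does not
    depend on the value at \<open>j\<close>. An edge in \<open>E2\<close> meets \<open>j\<close>; it
    could meet \<open>i\<close> as well only as \<open>(i, j)\<close>, which is excluded.\<close>
  define E1 where "E1 = {e\<in>E. fst e \<noteq> j \<and> snd e \<noteq> j}"
  define E2 where "E2 = E - E1"
  have fin: "finite E" using edge_set_finite[OF E] .
  have P01: "0 \<le> P E' \<phi> \<and> P E' \<phi> \<le> 1" for E' \<phi>
    unfolding P_def using K by (auto intro!: prod_nonneg prod_le_1)
  have split: "P E \<phi> = P E1 \<phi> * P E2 \<phi>" for \<phi>
    using prod.subset_diff[of E1 E] fin unfolding P_def E2_def by (simp add: E1_def mult.commute)
  have P1: "P E1 (\<phi>(i := u, j := v)) = P E1 (\<phi>(i := u))" for \<phi> u v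
    unfolding P_def by (intro prod.cong refl) (auto simp: E1_def)
  have P2: "P E2 (\<phi>(i := u, j := v)) = P E2 (\<phi>(j := v))" for \<phi> u v
    unfolding P_def
  proof (intro prod.cong refl)
    fix e assume "e \<in> E2"
    then have "e \<in> E" "fst e = j \<or> snd e = j" "fst e < snd e"
      using E by (auto simp: E2_def E1_def edge_set_def)
    moreover have "e \<noteq> (i, j)" using \<open>e \<in> E\<close> ij by auto
    ultimately have "fst e \<noteq> i" "snd e \<noteq> i"
      using ij by (auto simp: prod_eq_iff)
    then show "K e ((\<phi>(i := u, j := v)) (fst e)) ((\<phi>(i := u, j := v)) (snd e))
        = K e ((\<phi>(j := v)) (fst e)) ((\<phi>(j := v)) (snd e))" by simp
  qed
  let ?F = "\<lambda>\<phi>. D (\<phi> i) (\<phi> j) * P E \<phi>"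
  have "(real n)\<^sup>2 * (\<Sum>\<phi>\<in>?X. ?F \<phi>) = real n * (\<Sum>\<phi>\<in>?X. \<Sum>v<n. ?F (\<phi>(j := v)))"
    unfolding sum_PiE_resample[where F="?F", OF \<open>j < k\<close>] by (simp add: power2_eq_square)
  also have "\<dots> = (\<Sum>\<phi>\<in>?X. \<Sum>u<n. \<Sum>v<n. ?F (\<phi>(i := u, j := v)))"
    using sum_PiE_resample[where i=i and k=k and n=n and F="\<lambda>\<phi>. \<Sum>v<n. ?F (\<phi>(j := v))"] ij by simp
  finally have "\<bar>(real n)\<^sup>2 * (\<Sum>\<phi>\<in>?X. ?F \<phi>)\<bar> = \<bar>\<Sum>\<phi>\<in>?X. \<Sum>u<n. \<Sum>v<n. ?F (\<phi>(i := u, j := v))\<bar>"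
    by (rule arg_cong)
  then have "(real n)\<^sup>2 * \<bar>\<Sum>\<phi>\<in>?X. ?F \<phi>\<bar> = \<bar>\<Sum>\<phi>\<in>?X. \<Sum>u<n. \<Sum>v<n. ?F (\<phi>(i := u, j := v))\<bar>"
    unfolding abs_mult by (simp only: abs_power2)
  also have "\<dots> \<le> (\<Sum>\<phi>\<in>?X. \<bar>\<Sum>u<n. \<Sum>v<n. ?F (\<phi>(i := u, j := v))\<bar>)" by (rule sum_abs)
  also have "\<dots> \<le> (\<Sum>\<phi>\<in>?X. \<delta> * (real n)\<^sup>2)"
  proof (intro sum_mono)
    fix \<phi>
    have "\<bar>\<Sum>u<n. \<Sum>v<n. D u v * P E1 (\<phi>(i := u)) * P E2 (\<phi>(j := v))\<bar> \<le> \<delta> * (real n)\<^sup>2"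
      by (rule sum_bilinear_bound[OF D]) (use P01 in auto)
    then show "\<bar>\<Sum>u<n. \<Sum>v<n. ?F (\<phi>(i := u, j := v))\<bar> \<le> \<delta> * (real n)\<^sup>2"
      using ij by (simp add: split P1 P2 mult.assoc)
  qed
  also have "\<dots> = real (card ?X) * (\<delta> * (real n)\<^sup>2)" by (rule sum_constant)
  also have "card ?X = n ^ k" by (subst card_PiE) simp_all
  also have "real (n ^ k) * (\<delta> * (real n)\<^sup>2) = (real n)\<^sup>2 * (\<delta> * real n ^ k)" by simp
  finally have "\<bar>\<Sum>\<phi>\<in>?X. ?F \<phi>\<bar> \<le> \<delta> * real n ^ k"
    using n by (simp add: mult_le_cancel_left_pos)
  then show ?thesis by (simp add: P_def)
qed

text \<open>Kernels \<open>A\<close> are replaced by \<open>U\<close> one edge at a time;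
  \<open>?K S\<close> is the hybrid in which the edges of \<open>S\<close> have been treated. Each
  exchange leaves a difference kernel on one edge and \<open>[0,1]\<close>-valued kernels elsewhere,
  and costs at most \<open>\<delta>\<close>.\<close>

lemma counting_lemma:
  assumes E: "edge_set k E" and n: "n \<ge> 1"
    and A: "\<And>e u v. 0 \<le> A e u v" "\<And>e u v. A e u v \<le> (1::real)"
    and U: "\<And>e u v. 0 \<le> U e u v" "\<And>e u v. U e u v \<le> (1::real)"
    and D: "\<And>e S T. S \<subseteq> {..<n} \<Longrightarrow> T \<subseteq> {..<n} \<Longrightarrow> \<bar>\<Sum>u\<in>S. \<Sum>v\<in>T. A e u v - U e u v\<bar> \<le> \<delta> * (real n)\<^sup>2"
  shows "\<bar>kernel_hom k E n A - kernel_hom k E n U\<bar> \<le> real (card E) * \<delta>"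
proof -
  have fin: "finite E" using edge_set_finite[OF E] .
  let ?K = "\<lambda>S e. if e \<in> S then U e else A e"
  have "\<bar>kernel_hom k E n A - kernel_hom k E n (?K S)\<bar> \<le> real (card S) * \<delta>" if "S \<subseteq> E" for S
    using finite_subset[OF that fin] that
  proof (induction S rule: finite_induct)
    case (insert e S)
    obtain i j where e: "e = (i, j)" by (cases e)
    have ij: "i < j" "j < k" using E insert.prems e by (auto simp: edge_set_def)
    let ?R = "\<lambda>\<phi>. \<Prod>e'\<in>E - {e}. ?K S e' (\<phi> (fst e')) (\<phi> (snd e'))"
    have R: "(\<Prod>e'\<in>E - {e}. ?K (insert e S) e' (\<phi> (fst e')) (\<phi> (snd e'))) = ?R \<phi>" for \<phi>
      by (intro prod.cong refl) auto
    have "kernel_hom k E n (?K S) - kernel_hom k E n (?K (insert e S))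
       = (\<Sum>\<phi>\<in>{..<k} \<rightarrow>\<^sub>E {..<n}. (A e (\<phi> i) (\<phi> j) - U e (\<phi> i) (\<phi> j)) * ?R \<phi>) / real n ^ k"
      unfolding kernel_hom_def diff_divide_distrib[symmetric] sum_subtractf[symmetric]
      using insert.prems insert.hyps
      by (subst (1 2) prod.remove[OF fin, of e]) (auto simp: R e left_diff_distrib)
    also have "\<bar>\<dots>\<bar> \<le> \<delta> * real n ^ k / real n ^ k"
      unfolding abs_divide
    proof (rule divide_mono)
      show "\<bar>\<Sum>\<phi>\<in>{..<k} \<rightarrow>\<^sub>E {..<n}. (A e (\<phi> i) (\<phi> j) - U e (\<phi> i) (\<phi> j)) * ?R \<phi>\<bar> \<le> \<delta> * real n ^ k"
        by (rule counting_single[where D="\<lambda>u v. A e u v - U e u v"])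
          (use E n ij A U D e in \<open>auto simp: edge_set_def\<close>)
    qed (use n D[of "{}" "{}" e] in \<open>auto simp: zero_le_mult_iff\<close>)
    finally have "\<bar>kernel_hom k E n (?K S) - kernel_hom k E n (?K (insert e S))\<bar> \<le> \<delta>"
      using n by simp
    moreover have "\<bar>kernel_hom k E n A - kernel_hom k E n (?K S)\<bar> \<le> real (card S) * \<delta>"
      using insert by auto
    ultimately have "\<bar>kernel_hom k E n A - kernel_hom k E n (?K (insert e S))\<bar>
        \<le> real (card S) * \<delta> + \<delta>" by linarith
    then show ?case using insert by (simp add: algebra_simps)
  qed simp
  from this[of E] have "\<bar>kernel_hom k E n A - kernel_hom k E n (?K E)\<bar> \<le> real (card E) * \<delta>" by simp
  moreover have "kernel_hom k E n (?K E) = kernel_hom k E n U"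
    unfolding kernel_hom_def by (intro arg_cong2[where f="(/)"] sum.cong prod.cong refl) auto
  ultimately show ?thesis by simp
qed

text \<open>Written as a combination of products of one-variable indicators, a function of a tuple
  of codes can be summed or integrated coordinate by coordinate. The tuple is restricted because
  elements of a \<open>PiE\<close> set are \<open>undefined\<close> off their domain.\<close>

lemma sum_PiE_expand:
  fixes x :: "nat \<Rightarrow> nat" and f :: "(nat \<Rightarrow> nat) \<Rightarrow> real"
  assumes "\<And>i. i < k \<Longrightarrow> x i < N"
  shows "f (restrict x {..<k})
    = (\<Sum>\<alpha>\<in>{..<k} \<rightarrow>\<^sub>E {..<N}. f \<alpha> * (\<Prod>i<k. of_bool (x i = \<alpha> i)))"
proof -
  have *: "(\<Prod>i<k. of_bool (x i = \<alpha> i)) = (of_bool (restrict x {..<k} = \<alpha>) :: real)"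
    if "\<alpha> \<in> {..<k} \<rightarrow>\<^sub>E {..<N}" for \<alpha>
  proof (cases "restrict x {..<k} = \<alpha>")
    case False
    have "restrict x {..<k} = \<alpha>" if "\<And>i. i < k \<Longrightarrow> x i = \<alpha> i"
    proof
      fix i show "restrict x {..<k} i = \<alpha> i"
        using that \<open>\<alpha> \<in> _\<close> by (cases "i < k") (auto simp: PiE_def extensional_def)
    qed
    then obtain i where "i < k" "x i \<noteq> \<alpha> i" using False by blast
    then have "\<exists>i\<in>{..<k}. of_bool (x i = \<alpha> i) = (0::real)" by auto
    then have "(\<Prod>i<k. of_bool (x i = \<alpha> i)) = (0::real)"
      by (intro prod_zero) simp_all
    then show ?thesis using False by simp
  qed auto
  have "(\<Sum>\<alpha>\<in>{..<k} \<rightarrow>\<^sub>E {..<N}. f \<alpha> * (\<Prod>i<k. of_bool (x i = \<alpha> i)))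
      = (\<Sum>\<alpha>\<in>{..<k} \<rightarrow>\<^sub>E {..<N}. f \<alpha> * of_bool (restrict x {..<k} = \<alpha>))"
    by (intro sum.cong refl) (simp add: *)
  also have "\<dots> = (\<Sum>\<alpha>\<in>{..<k} \<rightarrow>\<^sub>E {..<N}. if restrict x {..<k} = \<alpha> then f \<alpha> else 0)"
    by (intro sum.cong) auto
  also have "\<dots> = f (restrict x {..<k})"
    using assms by (subst sum.delta') (auto simp: finite_PiE)
  finally show ?thesis by simp
qed

lemma step_sum:
  fixes f :: "(nat \<Rightarrow> nat) \<Rightarrow> real"
  assumes "\<And>u. u < n \<Longrightarrow> c u < N"
  shows "(\<Sum>\<phi>\<in>{..<k} \<rightarrow>\<^sub>E {..<n}. f (restrict (c \<circ> \<phi>) {..<k})) / real n ^ k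
    = (\<Sum>\<alpha>\<in>{..<k} \<rightarrow>\<^sub>E {..<N}. f \<alpha> * (\<Prod>i<k. real (card (cell n c (\<alpha> i))) / real n))"
proof -
  have "(\<Sum>\<phi>\<in>{..<k} \<rightarrow>\<^sub>E {..<n}. f (restrict (c \<circ> \<phi>) {..<k}))
    = (\<Sum>\<phi>\<in>{..<k} \<rightarrow>\<^sub>E {..<n}. \<Sum>\<alpha>\<in>{..<k} \<rightarrow>\<^sub>E {..<N}. f \<alpha> * (\<Prod>i<k. of_bool ((c \<circ> \<phi>) i = \<alpha> i)))"
    by (intro sum.cong refl sum_PiE_expand) (use assms in auto)
  also have "\<dots> = (\<Sum>\<alpha>\<in>{..<k} \<rightarrow>\<^sub>E {..<N}. f \<alpha> * (\<Sum>\<phi>\<in>{..<k} \<rightarrow>\<^sub>E {..<n}. \<Prod>i<k. of_bool (c (\<phi> i) = \<alpha> i)))"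
    by (subst sum.swap) (simp add: sum_distrib_left)
  also have "\<dots> = (\<Sum>\<alpha>\<in>{..<k} \<rightarrow>\<^sub>E {..<N}. f \<alpha> * (\<Prod>i<k. real (card (cell n c (\<alpha> i)))))"
  proof (intro sum.cong refl arg_cong2[where f="(*)"])
    fix \<alpha>
    have "(\<Sum>\<phi>\<in>{..<k} \<rightarrow>\<^sub>E {..<n}. \<Prod>i<k. of_bool (c (\<phi> i) = \<alpha> i) :: real)
        = (\<Prod>i<k. \<Sum>u<n. of_bool (c u = \<alpha> i))"
      by (rule prod_sum_PiE[symmetric]) auto
    also have "\<dots> = (\<Prod>i<k. real (card (cell n c (\<alpha> i))))"
    proof (intro prod.cong refl)
      fix i
      have "{..<n} \<inter> {u. c u = \<alpha> i} = cell n c (\<alpha> i)" by (auto simp: cell_def)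
      then show "(\<Sum>u<n. of_bool (c u = \<alpha> i)) = real (card (cell n c (\<alpha> i)))"
        by simp
    qed
    finally show "(\<Sum>\<phi>\<in>{..<k} \<rightarrow>\<^sub>E {..<n}. \<Prod>i<k. of_bool (c (\<phi> i) = \<alpha> i))
        = (\<Prod>i<k. real (card (cell n c (\<alpha> i))))" .
  qed
  finally show ?thesis by (simp add: sum_divide_distrib prod_dividef)
qed

section \<open>Lebesgue measure on the unit interval and the unit cube\<close>

abbreviation unit_interval :: "real measure" where
  "unit_interval \<equiv> restrict_space lborel {0..1}"

text \<open>No completion is taken here: the kernels constructed below are Borel, and the completed
  measure \<open>unit_cube\<close> is compared with this one only for the final integral.\<close>

abbreviation cube :: "nat \<Rightarrow> (nat \<Rightarrow> real) measure" where
  "cube k \<equiv> (\<Pi>\<^sub>M i\<in>{..<k}. unit_interval)"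

lemma emeasure_unit_interval: "emeasure unit_interval {0..1} = 1"
  by (subst emeasure_restrict_space) auto

lemma finite_measure_unit_interval: "finite_measure unit_interval"
  by (rule finite_measureI) (simp add: emeasure_unit_interval)

interpretation UI: finite_measure unit_interval
  by (rule finite_measure_unit_interval)

interpretation UIP: product_sigma_finite "\<lambda>_::nat. unit_interval"
  by (simp add: product_sigma_finite_def UI.sigma_finite_measure_axioms)

lemma emeasure_cube_space: "emeasure (cube k) (space (cube k)) = 1"
  using UIP.emeasure_PiM[of "{..<k}" "\<lambda>_. {0..1}"]
  by (simp add: space_PiM emeasure_unit_interval sets_restrict_space_iff)

lemma finite_measure_cube: "finite_measure (cube k)"
  by (rule finite_measureI) (simp add: emeasure_cube_space)

text \<open>This is the finite sum of \<open>step_sum\<close> with lengths of index sets in place of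
  relative cell sizes. Together the two formulas let averages over graphs converge to integrals over
  the cube.\<close>

lemma step_integral:
  fixes f :: "(nat \<Rightarrow> nat) \<Rightarrow> real"
  assumes meas: "idx \<in> borel \<rightarrow>\<^sub>M count_space UNIV" and lt: "\<And>x. idx x < N"
  shows "(LINT x|cube k. f (restrict (idx \<circ> x) {..<k}))
    = (\<Sum>\<alpha>\<in>{..<k} \<rightarrow>\<^sub>E {..<N}. f \<alpha> * (\<Prod>i<k. measure lborel {x\<in>{0..1}. idx x = \<alpha> i}))"
proof -
  have meas': "idx \<in> unit_interval \<rightarrow>\<^sub>M count_space UNIV"
    by (rule measurable_restrict_space1) (use meas in simp)
  have int1: "integrable unit_interval (\<lambda>x. of_bool (idx x = a) :: real)" for a
    by (rule UI.integrable_const_bound[of _ 1]) (use meas' in auto)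
  have val: "(LINT x|unit_interval. of_bool (idx x = a)) = measure lborel {x\<in>{0..1}. idx x = a}" for a
  proof -
    have sets: "{x\<in>{0..1}. idx x = a} \<in> sets borel"
    proof -
      have "{x. idx x = a} \<in> sets borel"
        using measurable_sets[OF meas, of "{a}"] by (simp add: vimage_def)
      moreover have "{x\<in>{0..1}. idx x = a} = {0..1} \<inter> {x. idx x = a}" by auto
      ultimately show ?thesis by auto
    qed
    have "(LINT x|unit_interval. of_bool (idx x = a) :: real)
       = (LINT x|lborel. indicator {0..1} x *\<^sub>R of_bool (idx x = a))"
      using integral_restrict_space[of "{0..1}" lborel "\<lambda>x. of_bool (idx x = a) :: real"] by simp
    also have "\<dots> = (LINT x|lborel. indicator {x\<in>{0..1}. idx x = a} x)"
      by (intro Bochner_Integration.integral_cong) (auto simp: indicator_def)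
    finally show ?thesis using sets by simp
  qed
  have int: "integrable (cube k) (\<lambda>x. \<Prod>i<k. of_bool (idx (x i) = \<alpha> i) :: real)" for \<alpha>
    by (rule UIP.product_integrable_prod[where f="\<lambda>i y. of_bool (idx y = \<alpha> i)", OF _ int1]) simp
  have prod: "(LINT x|cube k. (\<Prod>i<k. of_bool (idx (x i) = \<alpha> i)))
      = (\<Prod>i<k. measure lborel {x\<in>{0..1}. idx x = \<alpha> i})" for \<alpha>
    unfolding val[symmetric]
    by (rule UIP.product_integral_prod[where f="\<lambda>i y. of_bool (idx y = \<alpha> i)", OF _ int1]) simp
  have "(LINT x|cube k. f (restrict (idx \<circ> x) {..<k}))
     = (LINT x|cube k. (\<Sum>\<alpha>\<in>{..<k} \<rightarrow>\<^sub>E {..<N}. f \<alpha> * (\<Prod>i<k. of_bool ((idx \<circ> x) i = \<alpha> i))))"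
    by (intro Bochner_Integration.integral_cong refl sum_PiE_expand) (use lt in auto)
  also have "\<dots> = (\<Sum>\<alpha>\<in>{..<k} \<rightarrow>\<^sub>E {..<N}. (LINT x|cube k. f \<alpha> * (\<Prod>i<k. of_bool (idx (x i) = \<alpha> i))))"
    unfolding o_def by (intro Bochner_Integration.integral_sum integrable_mult_right int)
  also have "\<dots> = (\<Sum>\<alpha>\<in>{..<k} \<rightarrow>\<^sub>E {..<N}. f \<alpha> * (\<Prod>i<k. measure lborel {x\<in>{0..1}. idx x = \<alpha> i}))"
    by (simp only: integral_mult_right_zero prod)
  finally show ?thesis .
qed

lemma step_transfer:
  fixes f :: "nat \<Rightarrow> (nat \<Rightarrow> nat) \<Rightarrow> real"
  assumes meas: "idx \<in> borel \<rightarrow>\<^sub>M count_space UNIV" and lt: "\<And>x. idx x < N"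
    and c: "\<And>l u. c l u < N"
    and w: "\<And>a. a < N \<Longrightarrow> (\<lambda>l. real (card (cell (n l) (c l) a)) / real (n l))
              \<longlonglongrightarrow> measure lborel {x\<in>{0..1}. idx x = a}"
    and f: "\<And>\<alpha>. (\<lambda>l. f l \<alpha>) \<longlonglongrightarrow> g \<alpha>"
  shows "(\<lambda>l. (\<Sum>\<phi>\<in>{..<k} \<rightarrow>\<^sub>E {..<n l}. f l (restrict (c l \<circ> \<phi>) {..<k})) / real (n l) ^ k)
    \<longlonglongrightarrow> (LINT x|cube k. g (restrict (idx \<circ> x) {..<k}))"
proof -
  have "(\<lambda>l. \<Sum>\<alpha>\<in>{..<k} \<rightarrow>\<^sub>E {..<N}. f l \<alpha> * (\<Prod>i<k. real (card (cell (n l) (c l) (\<alpha> i))) / real (n l)))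
    \<longlonglongrightarrow> (\<Sum>\<alpha>\<in>{..<k} \<rightarrow>\<^sub>E {..<N}. g \<alpha> * (\<Prod>i<k. measure lborel {x\<in>{0..1}. idx x = \<alpha> i}))"
    by (intro tendsto_sum tendsto_mult tendsto_prod f w) auto
  moreover have "(\<Sum>\<phi>\<in>{..<k} \<rightarrow>\<^sub>E {..<n l}. f l (restrict (c l \<circ> \<phi>) {..<k})) / real (n l) ^ k
    = (\<Sum>\<alpha>\<in>{..<k} \<rightarrow>\<^sub>E {..<N}. f l \<alpha> * (\<Prod>i<k. real (card (cell (n l) (c l) (\<alpha> i))) / real (n l)))" for l
    by (rule step_sum) (rule c)
  ultimately show ?thesis
    unfolding step_integral[OF meas lt] by simp
qed

section \<open>Interval codes and convergence in mean\<close>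

text \<open>At each level \<open>[0,1]\<close> is cut into consecutive intervals of lengths
  \<open>w t 0\<close>, \<open>w t 1\<close> and so on. Consistency of the weights makes the four
  children of \<open>a\<close>, with codes \<open>4 * a + b\<close>, fill exactly the interval of
  \<open>a\<close>.\<close>

lemma interval_code:
  fixes w :: "nat \<Rightarrow> nat \<Rightarrow> real"
  assumes nonneg: "\<And>t a. 0 \<le> w t a" and one: "\<And>t. (\<Sum>a<4 ^ t. w t a) = 1"
    and cons: "\<And>t a. a < 4 ^ t \<Longrightarrow> w t a = (\<Sum>b<4. w (Suc t) (4 * a + b))"
  shows "\<exists>idx :: nat \<Rightarrow> real \<Rightarrow> nat. (\<forall>t. idx t \<in> borel \<rightarrow>\<^sub>M count_space UNIV) \<and> (\<forall>t x. idx t x < 4 ^ t) \<and>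
    (\<forall>t x. idx t x = idx (Suc t) x div 4) \<and>
    (\<forall>t a. a < 4 ^ t \<longrightarrow> measure lborel {x\<in>{0..1}. idx t x = a} = w t a)"
proof -
  define s where "s t a = (\<Sum>b<a. w t b)" for t a
  have s0: "s t 0 = 0" and s1: "s t (4 ^ t) = 1" and sSuc: "s t (Suc a) = s t a + w t a" for t a
    by (simp_all add: s_def one)
  have mono: "s t a \<le> s t b" if "a \<le> b" for t a b
    unfolding s_def using that nonneg by (intro sum_mono2) auto
  have s4: "s (Suc t) (4 * a) = s t a" if "a \<le> 4 ^ t" for t a
    using that
  proof (induction a)
    case (Suc a)
    have "s (Suc t) (4 * Suc a) = s (Suc t) (4 * a) + (\<Sum>b<4. w (Suc t) (4 * a + b))"
      by (simp add: s_def eval_nat_numeral add.assoc)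
    then show ?case using Suc cons[of a t] by (simp add: sSuc)
  qed (simp add: s0)
  \<comment> \<open>The first and the last interval are extended to infinity, so that every real has
    a code below \<open>4^t\<close>; inside \<open>[0,1]\<close> this only puts the point 1 into the
    last interval.\<close>
  define C where "C t x a \<longleftrightarrow> a < 4 ^ t \<and> (a = 0 \<or> s t a \<le> x) \<and> (Suc a < 4 ^ t \<longrightarrow> x < s t (Suc a))"
    for t x and a :: nat
  define idx where "idx t x = card {a. 1 \<le> a \<and> a < 4 ^ t \<and> s t a \<le> x}" for t x
  have C_idx: "idx t x = a" if "C t x a" for t x a
  proof -
    have "{b. 1 \<le> b \<and> b < 4 ^ t \<and> s t b \<le> x} = {1..a}"
    proof (intro equalityI subsetI)
      fix b assume b: "b \<in> {b. 1 \<le> b \<and> b < 4 ^ t \<and> s t b \<le> x}"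
      have "b \<le> a"
      proof (rule ccontr)
        assume "\<not> b \<le> a"
        then have "Suc a \<le> b" by simp
        moreover from this have "x < s t (Suc a)" using that b by (auto simp: C_def)
        ultimately show False using b mono[of "Suc a" b t] by auto
      qed
      then show "b \<in> {1..a}" using b by auto
    next
      fix b assume "b \<in> {1..a}"
      then show "b \<in> {b. 1 \<le> b \<and> b < 4 ^ t \<and> s t b \<le> x}"
        using that mono[of b a t] by (auto simp: C_def)
    qed
    then show ?thesis by (simp add: idx_def)
  qed
  have C_ex: "\<exists>a. C t x a" for t x
  proof -
    let ?A = "{a. a < 4 ^ t \<and> (a = 0 \<or> s t a \<le> x)}"
    have fin: "finite ?A" and zero: "0 \<in> ?A" by auto
    have "Max ?A \<in> ?A" by (rule Max_in[OF fin]) (use zero in blast)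
    moreover have "x < s t (Suc (Max ?A))" if "Suc (Max ?A) < 4 ^ t"
    proof (rule ccontr)
      assume "\<not> x < s t (Suc (Max ?A))"
      then have "Suc (Max ?A) \<in> ?A" using that by auto
      then have "Suc (Max ?A) \<le> Max ?A" using fin by (rule Max_ge[rotated])
      then show False by simp
    qed
    ultimately have "C t x (Max ?A)" by (auto simp: C_def)
    then show ?thesis ..
  qed
  have idx_iff: "idx t x = a \<longleftrightarrow> C t x a" for t x a
    using C_idx C_ex by metis
  have C: "C t x (idx t x)" for t x using idx_iff by blast
  have div: "idx t x = idx (Suc t) x div 4" for t x
  proof -
    let ?c = "idx (Suc t) x"
    have c: "C (Suc t) x ?c" by (rule C)
    have "C t x (?c div 4)"
      unfolding C_def
    proof (intro conjI impI)
      show lt: "?c div 4 < 4 ^ t" using c by (simp add: C_def div_less_iff_less_mult mult.commute)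
      have "s t (?c div 4) = s (Suc t) (4 * (?c div 4))" using lt by (simp add: s4)
      also have "\<dots> \<le> s (Suc t) ?c" by (rule mono) simp
      finally show "?c div 4 = 0 \<or> s t (?c div 4) \<le> x" using c by (auto simp: C_def)
      assume lt': "Suc (?c div 4) < 4 ^ t"
      have le: "Suc ?c \<le> 4 * Suc (?c div 4)" by presburger
      moreover have "4 * Suc (?c div 4) < 4 ^ Suc t" using lt' by simp
      ultimately have "x < s (Suc t) (Suc ?c)" using c by (auto simp: C_def)
      also have "\<dots> \<le> s (Suc t) (4 * Suc (?c div 4))" using le by (rule mono)
      also have "\<dots> = s t (Suc (?c div 4))" using lt' by (intro s4) simp
      finally show "x < s t (Suc (?c div 4))" .
    qed
    then show ?thesis by (rule C_idx)
  qed
  have meas: "idx t \<in> borel \<rightarrow>\<^sub>M count_space UNIV" for t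
  proof -
    have "{x. C t x a} \<in> sets borel" for a
      unfolding C_def by measurable
    then show ?thesis
      by (subst measurable_count_space_eq2_countable) (auto simp: vimage_def idx_iff)
  qed
  have "measure lborel {x\<in>{0..1}. idx t x = a} = w t a" if a: "a < 4 ^ t" for t a
  proof -
    have nn: "0 \<le> s t a" using mono[of 0 a t] by (simp add: s0)
    have le1: "s t (Suc a) \<le> 1" using mono[of "Suc a" "4 ^ t" t] a by (simp add: s1)
    have w: "s t a \<le> s t (Suc a)" "s t (Suc a) - s t a = w t a" using nonneg by (simp_all add: sSuc)
    show ?thesis
    proof (cases "Suc a < 4 ^ t")
      case True
      then have "{x\<in>{0..1}. idx t x = a} = {s t a..<s t (Suc a)}"
        using a nn le1 by (auto simp: idx_iff C_def s0)
      then show ?thesis using w by simp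
    next
      case False
      then have "Suc a = 4 ^ t" using a by simp
      then have "s t (Suc a) = 1" using s1 by metis
      moreover have "{x\<in>{0..1}. idx t x = a} = {s t a..1}"
        using a nn False by (auto simp: idx_iff C_def s0)
      ultimately show ?thesis using w by simp
    qed
  qed
  moreover have "idx t x < 4 ^ t" for t x using C[of t x] unfolding C_def by blast
  ultimately show ?thesis
    using meas div by (intro exI[of _ idx]) blast
qed

section \<open>Compactness and convergence in mean\<close>

lemma countable_bounded_subsequence:
  fixes f :: "nat \<Rightarrow> 'i::countable \<Rightarrow> real"
  assumes "\<And>n i. 0 \<le> f n i \<and> f n i \<le> 1"
  shows "\<exists>r. strict_mono r \<and> (\<forall>i. convergent (\<lambda>n. f (r n) i))"
proof -
  \<comment> \<open>Tychonoff's theorem replaces a diagonal argument: over a countable index type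
    the product is metrizable, so its compact cube is sequentially compact.\<close>
  have "compactin (product_topology (\<lambda>_::'i. euclidean) UNIV) (PiE UNIV (\<lambda>_. {0..1::real}))"
    by (subst compactin_PiE) auto
  then have "compact (PiE UNIV (\<lambda>_::'i. {0..1::real}))"
    by (simp add: euclidean_product_topology)
  then have "seq_compact (PiE UNIV (\<lambda>_::'i. {0..1::real}))"
    by (simp add: compact_eq_seq_compact_metric)
  moreover have "\<forall>n. f n \<in> PiE UNIV (\<lambda>_. {0..1})" using assms by auto
  ultimately obtain l r where r: "strict_mono (r :: nat \<Rightarrow> nat)" "(f \<circ> r) \<longlonglongrightarrow> l"
    unfolding seq_compact_def by metis
  have "(\<lambda>n. f (r n) i) \<longlonglongrightarrow> l i" for i
    using continuous_on_tendsto_compose[OF continuous_on_product_coordinates r(2)]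
    by simp
  then show ?thesis using r(1) by (auto simp: convergent_def)
qed

text \<open>A subsequence with increments below \<open>(1/2)^j\<close> in mean has, by monotone
  convergence, an integrable sum of absolute increments; almost everywhere that sum is finite and
  the subsequence converges.\<close>

lemma L1_Cauchy_imp_AE_convergent_subseq:
  fixes f :: "nat \<Rightarrow> 'a \<Rightarrow> real"
  assumes "finite_measure M" and meas: "\<And>t. f t \<in> borel_measurable M"
    and bnd: "\<And>t x. 0 \<le> f t x \<and> f t x \<le> 1"
    and Cauchy: "\<And>e. e > 0 \<Longrightarrow> \<exists>T. \<forall>t\<ge>T. \<forall>s\<ge>t. (LINT x|M. \<bar>f s x - f t x\<bar>) < e"
  shows "\<exists>r. strict_mono r \<and> (AE x in M. convergent (\<lambda>j. f (r j) x))"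
proof -
  interpret finite_measure M by fact
  note meas [measurable]
  have bnd': "\<bar>f s x - f t x\<bar> \<le> 1" for s t x
    using bnd[of s x] bnd[of t x] by linarith
  obtain T where T: "\<And>j t s. T j \<le> t \<Longrightarrow> t \<le> s \<Longrightarrow> (LINT x|M. \<bar>f s x - f t x\<bar>) < (1/2) ^ j"
    using Cauchy[of "(1/2) ^ _"] by (metis half_gt_zero zero_less_one zero_less_power)
  \<comment> \<open>The summands \<open>Suc (T i)\<close> make \<open>r\<close> strictly increasing
    and at least \<open>T j\<close> at index \<open>j\<close>.\<close>
  define r where "r j = (\<Sum>i\<le>j. Suc (T i))" for j
  have r: "strict_mono r" by (rule strict_mono_Suc_iff[THEN iffD2]) (simp add: r_def)
  have rT: "T j \<le> r j" for j
    unfolding r_def using member_le_sum[of j "{..j}" "\<lambda>i. Suc (T i)"] by simp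
  let ?d = "\<lambda>j x. \<bar>f (r (Suc j)) x - f (r j) x\<bar>"
  have int: "integrable M (?d j)" for j
    by (rule integrable_const_bound[of _ 1]) (use bnd' in auto)
  have "(\<integral>\<^sup>+x. (\<Sum>j. ennreal (?d j x)) \<partial>M) = (\<Sum>j. \<integral>\<^sup>+x. ennreal (?d j x) \<partial>M)"
    by (rule nn_integral_suminf) measurable
  also have "\<dots> = (\<Sum>j. ennreal (LINT x|M. ?d j x))"
    by (intro suminf_cong nn_integral_eq_integral int) auto
  also have "\<dots> \<le> (\<Sum>j. ennreal ((1/2) ^ j))"
    using T[OF rT] strict_mono_leD[OF r]
    by (intro suminf_le summableI ennreal_leI less_imp_le) auto
  also have "\<dots> = ennreal (\<Sum>j. (1/2) ^ j)"
    by (rule suminf_ennreal2) (auto intro: summable_geometric)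
  finally have "(\<integral>\<^sup>+x. (\<Sum>j. ennreal (?d j x)) \<partial>M) \<noteq> \<infinity>"
    by (auto simp: top_unique)
  then have "AE x in M. (\<Sum>j. ennreal (?d j x)) \<noteq> \<infinity>"
    by (intro nn_integral_PInf_AE) measurable
  then have "AE x in M. convergent (\<lambda>j. f (r j) x)"
  proof eventually_elim
    case (elim x)
    have "summable (\<lambda>j. ?d j x)"
      using elim by (intro summable_suminf_not_top) auto
    then have "summable (\<lambda>j. f (r (Suc j)) x - f (r j) x)" by (rule summable_rabs_cancel)
    then have "convergent (\<lambda>n. \<Sum>j<n. f (r (Suc j)) x - f (r j) x)"
      by (simp add: summable_iff_convergent)
    then have "convergent (\<lambda>n. f (r n) x - f (r 0) x)"
      using sum_lessThan_telescope[of "\<lambda>j. f (r j) x"] by simp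
    then show ?case by (simp add: convergent_diff_const_right_iff)
  qed
  then show ?thesis using r by blast
qed

text \<open>With a default value where no limit exists, the limit kernel is defined at every point.
  Hence the bounds 0 and 1 and symmetry hold everywhere rather than almost everywhere.\<close>

definition subseq_limit :: "(nat \<Rightarrow> nat) \<Rightarrow> (nat \<Rightarrow> real) \<Rightarrow> real" where
  "subseq_limit r y = (if convergent (y \<circ> r) then lim (y \<circ> r) else 0)"

lemma subseq_limit_bounds:
  assumes "\<And>t. 0 \<le> y t \<and> y t \<le> 1"
  shows "0 \<le> subseq_limit r y" "subseq_limit r y \<le> 1"
proof -
  have "0 \<le> subseq_limit r y \<and> subseq_limit r y \<le> 1"
  proof (cases "convergent (y \<circ> r)")
    case True
    then have "(y \<circ> r) \<longlonglongrightarrow> subseq_limit r y"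
      by (simp add: subseq_limit_def convergent_LIMSEQ_iff)
    then show ?thesis
      using assms by (auto intro: LIMSEQ_le_const LIMSEQ_le_const2)
  qed (simp add: subseq_limit_def)
  then show "0 \<le> subseq_limit r y" "subseq_limit r y \<le> 1" by auto
qed

lemma subseq_limit_measurable:
  assumes [measurable]: "\<And>t. f t \<in> borel_measurable M"
  shows "(\<lambda>x. subseq_limit r (\<lambda>t. f t x)) \<in> borel_measurable M"
  unfolding subseq_limit_def o_def Cauchy_convergent_iff[symmetric]
  by (measurable; intro sets_Collect_Cauchy borel_measurable_lim_metric assms)

text \<open>Dominated convergence gives convergence in mean along \<open>r\<close>; the Cauchy
  property extends it to the whole sequence.\<close>

lemma subseq_limit_L1:
  fixes f :: "nat \<Rightarrow> 'a \<Rightarrow> real"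
  assumes "finite_measure M" and meas: "\<And>t. f t \<in> borel_measurable M"
    and bnd: "\<And>t x. 0 \<le> f t x \<and> f t x \<le> 1"
    and Cauchy: "\<And>e. e > 0 \<Longrightarrow> \<exists>T. \<forall>t\<ge>T. \<forall>s\<ge>t. (LINT x|M. \<bar>f s x - f t x\<bar>) < e"
    and r: "strict_mono r" and conv: "AE x in M. convergent (\<lambda>j. f (r j) x)"
  shows "(\<lambda>t. LINT x|M. \<bar>f t x - subseq_limit r (\<lambda>t. f t x)\<bar>) \<longlonglongrightarrow> 0"
proof -
  interpret finite_measure M by fact
  let ?g = "\<lambda>x. subseq_limit r (\<lambda>t. f t x)"
  note meas [measurable] subseq_limit_measurable[of f, OF meas, measurable]
  have g: "0 \<le> ?g x" "?g x \<le> 1" for x using subseq_limit_bounds[of "\<lambda>t. f t x"] bnd by auto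
  have bnd': "\<bar>f s x - f t x\<bar> \<le> 1" "\<bar>f s x - ?g x\<bar> \<le> 1" for s t x
    using bnd[of s x] bnd[of t x] g[of x] by linarith+
  have int: "integrable M (\<lambda>x. \<bar>f s x - f t x\<bar>)" "integrable M (\<lambda>x. \<bar>f s x - ?g x\<bar>)" for s t
    by (rule integrable_const_bound[of _ 1]; use bnd' in auto)+
  have "(\<lambda>j. LINT x|M. \<bar>f (r j) x - ?g x\<bar>) \<longlonglongrightarrow> (LINT x|M. 0)"
  proof (rule integral_dominated_convergence[where w="\<lambda>_. 1"])
    show "AE x in M. (\<lambda>j. \<bar>f (r j) x - ?g x\<bar>) \<longlonglongrightarrow> 0"
      using conv
    proof eventually_elim
      case (elim x)
      then have "(\<lambda>j. f (r j) x) \<longlonglongrightarrow> ?g x"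
        by (simp add: subseq_limit_def convergent_LIMSEQ_iff o_def)
      then show ?case by (intro tendsto_rabs_zero) (simp add: LIM_zero_iff)
    qed
  qed (use bnd' in auto)
  then have sub: "(\<lambda>j. LINT x|M. \<bar>f (r j) x - ?g x\<bar>) \<longlonglongrightarrow> 0" by simp
  show ?thesis
  proof (rule LIMSEQ_I)
    fix e :: real assume e: "e > 0"
    obtain T where T: "\<And>t s. T \<le> t \<Longrightarrow> t \<le> s \<Longrightarrow> (LINT x|M. \<bar>f s x - f t x\<bar>) < e / 2"
      using Cauchy[of "e / 2"] e by auto
    obtain J where J: "\<And>j. J \<le> j \<Longrightarrow> norm ((LINT x|M. \<bar>f (r j) x - ?g x\<bar>) - 0) < e / 2"
      using LIMSEQ_D[OF sub, of "e / 2"] e by auto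
    have "norm ((LINT x|M. \<bar>f t x - ?g x\<bar>) - 0) < e" if t: "t \<ge> T" for t
    proof -
      let ?j = "max J t"
      have rt: "t \<le> r ?j" using seq_suble[OF r, of ?j] by linarith
      have "(LINT x|M. \<bar>f t x - ?g x\<bar>) \<le> (LINT x|M. \<bar>f (r ?j) x - f t x\<bar> + \<bar>f (r ?j) x - ?g x\<bar>)"
        by (intro integral_mono Bochner_Integration.integrable_add int) auto
      also have "\<dots> = (LINT x|M. \<bar>f (r ?j) x - f t x\<bar>) + (LINT x|M. \<bar>f (r ?j) x - ?g x\<bar>)"
        by (intro Bochner_Integration.integral_add int)
      also have "\<dots> < e / 2 + e / 2"
        using T[OF t rt] J[of ?j] by (intro add_strict_mono) auto
      finally show ?thesis by simp
    qed
    then show "\<exists>N. \<forall>t\<ge>N. norm ((LINT x|M. \<bar>f t x - ?g x\<bar>) - 0) < e" by blast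
  qed
qed

section \<open>Two-coordinate marginals of the cube\<close>

abbreviation square :: "(real \<times> real) measure" where
  "square \<equiv> unit_interval \<Otimes>\<^sub>M unit_interval"

lemma measurable_square:
  assumes f: "f \<in> borel \<Otimes>\<^sub>M borel \<rightarrow>\<^sub>M N"
  shows "f \<in> square \<rightarrow>\<^sub>M N"
proof -
  have "(\<lambda>p. (fst p, snd p)) \<in> square \<rightarrow>\<^sub>M borel \<Otimes>\<^sub>M borel"
    by (intro measurable_Pair measurable_compose[OF measurable_fst] measurable_compose[OF measurable_snd]
        measurable_restrict_space1) auto
  from measurable_compose[OF this f] show ?thesis by simp
qed

text \<open>The preimage of a rectangle is a box whose other sides are all of \<open>[0,1]\<close>
  and have measure 1. This reduces estimates for one edge of a density to the square.\<close>

lemma distr_cube_pair: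
  assumes ij: "i < k" "j < k" "i \<noteq> j"
  shows "distr (cube k) square (\<lambda>x. (x i, x j)) = square"
proof (rule sym, rule pair_measure_eqI)
  have [measurable]: "(\<lambda>x. (x i, x j)) \<in> cube k \<rightarrow>\<^sub>M square"
    using ij by (intro measurable_Pair measurable_component_singleton) auto
  fix A B assume AB: "A \<in> sets unit_interval" "B \<in> sets unit_interval"
  then have sub: "A \<subseteq> {0..1}" "B \<subseteq> {0..1}"
    by (auto simp: sets_restrict_space)
  define X where "X l = (if l = i then A else if l = j then B else {0..1})" for l
  have "(\<lambda>x. (x i, x j)) -` (A \<times> B) \<inter> space (cube k) = PiE {..<k} X"
  proof (intro equalityI subsetI)
    fix x assume x: "x \<in> PiE {..<k} X"
    have "X l \<subseteq> {0..1}" for l using sub by (simp add: X_def)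
    then have "x \<in> space (cube k)" using x by (force simp: space_PiM PiE_iff)
    moreover have "x i \<in> A" "x j \<in> B"
      using ij x by (auto simp: X_def PiE_iff split: if_splits dest: bspec[of _ _ i] bspec[of _ _ j])
    ultimately show "x \<in> (\<lambda>x. (x i, x j)) -` (A \<times> B) \<inter> space (cube k)" by simp
  qed (auto simp: space_PiM PiE_iff X_def)
  then have "emeasure (distr (cube k) square (\<lambda>x. (x i, x j))) (A \<times> B) = emeasure (cube k) (PiE {..<k} X)"
    using AB by (subst emeasure_distr) auto
  also have "\<dots> = (\<Prod>l<k. emeasure unit_interval (X l))"
    using AB by (intro UIP.emeasure_PiM) (auto simp: X_def sets_restrict_space_iff)
  also have "\<dots> = emeasure unit_interval (X i) * (\<Prod>l\<in>{..<k} - {i}. emeasure unit_interval (X l))"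
    using ij by (intro prod.remove) auto
  also have "(\<Prod>l\<in>{..<k} - {i}. emeasure unit_interval (X l))
     = emeasure unit_interval (X j) * (\<Prod>l\<in>{..<k} - {i} - {j}. emeasure unit_interval (X l))"
    using ij by (intro prod.remove) auto
  also have "(\<Prod>l\<in>{..<k} - {i} - {j}. emeasure unit_interval (X l)) = 1"
    by (intro prod.neutral) (auto simp: X_def emeasure_unit_interval)
  finally show "emeasure unit_interval A * emeasure unit_interval B
      = emeasure (distr (cube k) square (\<lambda>x. (x i, x j))) (A \<times> B)"
    using ij by (simp add: X_def)
qed (simp_all add: UI.sigma_finite_measure_axioms)

lemma integral_cube_pair:
  fixes f :: "real \<times> real \<Rightarrow> real"
  assumes ij: "i < k" "j < k" "i \<noteq> j" and f: "f \<in> borel_measurable square"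
  shows "(LINT x|cube k. f (x i, x j)) = (LINT p|square. f p)"
proof -
  have "(\<lambda>x. (x i, x j)) \<in> cube k \<rightarrow>\<^sub>M square"
    using ij by (intro measurable_Pair measurable_component_singleton) auto
  from integral_distr[OF this f] show ?thesis by (simp add: distr_cube_pair[OF ij])
qed

lemma AE_cube_pair:
  assumes ij: "i < k" "j < k" "i \<noteq> j" and "AE p in square. P p"
  shows "AE x in cube k. P (x i, x j)"
proof -
  have "(\<lambda>x. (x i, x j)) \<in> cube k \<rightarrow>\<^sub>M square"
    using ij by (intro measurable_Pair measurable_component_singleton) auto
  then show ?thesis
    by (rule AE_distrD) (simp only: distr_cube_pair[OF ij] assms(4))
qed

section \<open>Limit kernels of edge colourings\<close>

text \<open>Here \<open>l\<close> runs over graphs and \<open>t\<close> over levels. For fixed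
  \<open>t\<close> the error \<open>\<eta> l t\<close> need not vanish as \<open>l\<close> grows;
  only its limit \<open>h t\<close> tends to 0 with \<open>t\<close>, so the level is fixed before
  \<open>l\<close> is taken large.\<close>

lemma double_limit:
  fixes a B h :: "nat \<Rightarrow> real" and b \<eta> :: "nat \<Rightarrow> nat \<Rightarrow> real"
  assumes ab: "\<And>l t. \<bar>a l - b l t\<bar> \<le> \<eta> l t"
    and b: "\<And>t. (\<lambda>l. b l t) \<longlonglongrightarrow> B t" and \<eta>: "\<And>t. (\<lambda>l. \<eta> l t) \<longlonglongrightarrow> h t"
    and h: "h \<longlonglongrightarrow> 0" and B: "B \<longlonglongrightarrow> L"
  shows "a \<longlonglongrightarrow> L"
proof (rule LIMSEQ_I)
  fix e :: real assume "e > 0"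
  then have e: "e / 4 > 0" by simp
  have "eventually (\<lambda>t. dist (h t) 0 < e / 4 \<and> dist (B t) L < e / 4) sequentially"
    using tendstoD[OF h e] tendstoD[OF B e] by eventually_elim auto
  then obtain t where t: "dist (h t) 0 < e / 4" "dist (B t) L < e / 4"
    using eventually_happens'[OF sequentially_bot] by blast
  have "eventually (\<lambda>l. norm (a l - L) < e) sequentially"
    using tendstoD[OF b[of t] e] tendstoD[OF \<eta>[of t] e]
  proof eventually_elim
    case (elim l)
    have "\<bar>a l - L\<bar> \<le> \<bar>a l - b l t\<bar> + \<bar>b l t - B t\<bar> + \<bar>B t - L\<bar>" by linarith
    moreover have "\<eta> l t \<le> \<bar>\<eta> l t - h t\<bar> + \<bar>h t\<bar>" by linarith
    ultimately show ?case
      using elim t ab[of l t] unfolding dist_real_def real_norm_def by simp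
  qed
  then show "\<exists>N. \<forall>l\<ge>N. norm (a l - L) < e" by (simp add: eventually_sequentially)
qed

lemma sum_PiE_two:
  fixes F :: "nat \<Rightarrow> nat \<Rightarrow> real"
  shows "(\<Sum>\<phi>\<in>{..<2::nat} \<rightarrow>\<^sub>E {..<n}. F (\<phi> 0) (\<phi> 1)) = (\<Sum>u<n. \<Sum>v<n. F u v)"
proof -
  have "(\<Sum>\<phi>\<in>{..<2::nat} \<rightarrow>\<^sub>E {..<n}. F (\<phi> 0) (\<phi> 1)) = (\<Sum>(u, v)\<in>{..<n} \<times> {..<n}. F u v)"
    by (rule sum.reindex_bij_witness[of _ "\<lambda>(u, v). \<lambda>i\<in>{..<2}. if i = 0 then u else v" "\<lambda>\<phi>. (\<phi> 0, \<phi> 1)"])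
      (auto simp: PiE_iff less_2_cases_iff extensional_def)
  then show ?thesis by (simp add: sum.cartesian_product)
qed

lemma card_cell_sum: "real (card (cell n c a)) = (\<Sum>u<n. of_bool (c u = a))"
proof -
  have "{..<n} \<inter> {u. c u = a} = cell n c a" by (auto simp: cell_def)
  then show ?thesis by simp
qed

lemma sum_card_cells:
  assumes "\<And>u. u < n \<Longrightarrow> c u < N"
  shows "(\<Sum>a<N. real (card (cell n c a))) = real n"
proof -
  have "(\<Sum>a<N. real (card (cell n c a))) = (\<Sum>u<n. \<Sum>a<N. of_bool (c u = a))"
    unfolding card_cell_sum by (rule sum.swap)
  also have "\<dots> = (\<Sum>u<n. 1)"
  proof (intro sum.cong refl)
    fix u assume "u \<in> {..<n}"
    then have "{..<N} \<inter> {a. c u = a} = {c u}" using assms by auto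
    then show "(\<Sum>a<N. of_bool (c u = a)) = (1::real)" by simp
  qed
  finally show ?thesis by simp
qed

lemma card_cell_children:
  assumes "\<And>u. u < n \<Longrightarrow> c u = c' u div 4"
  shows "real (card (cell n c a)) = (\<Sum>b<4. real (card (cell n c' (4 * a + b))))"
proof -
  have *: "of_bool (x div 4 = a) = (\<Sum>b<4. of_bool (x = 4 * a + b) :: real)" for x
  proof -
    have "{..<4} \<inter> {b. x = 4 * a + b} = (if x div 4 = a then {x mod 4} else {})"
      using mult_div_mod_eq[of 4 x] by (auto, presburger)
    then show ?thesis by simp
  qed
  have "real (card (cell n c a)) = (\<Sum>u<n. \<Sum>b<4. of_bool (c' u = 4 * a + b))"
    unfolding card_cell_sum using assms by (simp only: *[symmetric]) (auto intro!: sum.cong)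
  then show ?thesis unfolding card_cell_sum by (simp only: sum.swap[of _ "{..<4}"])
qed

text \<open>Cauchy-Schwarz bounds the mean distance of two levels by their distance in mean square,
  which is the energy increment.\<close>

lemma avg_kernel_L1_le:
  assumes n: "n \<ge> 1" and p: "\<And>u. u < n \<Longrightarrow> c u = p (c' u)"
  shows "(\<Sum>u<n. \<Sum>v<n. \<bar>avg_kernel n c' g m u v - avg_kernel n c g m u v\<bar>) / (real n)\<^sup>2
    \<le> sqrt (colour_energy n c' g m / (real n)\<^sup>2 - colour_energy n c g m / (real n)\<^sup>2)"
proof (rule real_le_rsqrt)
  let ?X = "\<lambda>u v. \<bar>avg_kernel n c' g m u v - avg_kernel n c g m u v\<bar>"
  have "(\<Sum>u<n. \<Sum>v<n. ?X u v * 1)\<^sup>2 \<le> (\<Sum>u<n. \<Sum>v<n. (?X u v)\<^sup>2) * (\<Sum>u<n. \<Sum>v<n. 1\<^sup>2)"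
    by (rule double_sum_Cauchy_Schwarz)
  then have "(\<Sum>u<n. \<Sum>v<n. ?X u v)\<^sup>2 \<le> (colour_energy n c' g m - colour_energy n c g m) * (real n)\<^sup>2"
    using cell_avg_pythagoras[where c=c and p=p and c'=c' and A="colour_class g m", OF p]
    by (simp add: avg_kernel_def colour_energy_def power2_eq_square)
  then show "((\<Sum>u<n. \<Sum>v<n. ?X u v) / (real n)\<^sup>2)\<^sup>2
     \<le> colour_energy n c' g m / (real n)\<^sup>2 - colour_energy n c g m / (real n)\<^sup>2"
    using n by (simp add: divide_simps power2_eq_square mult_ac)
qed

lemma colour_energy_bounds: "0 \<le> colour_energy n c g m" "colour_energy n c g m \<le> (real n)\<^sup>2"
proof -
  show "0 \<le> colour_energy n c g m" unfolding colour_energy_def by (intro sum_nonneg) auto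
  have "colour_energy n c g m \<le> (\<Sum>u<n. \<Sum>v<n. 1)"
    unfolding colour_energy_def
    by (intro sum_mono) (simp add: avg_kernel_bounds power_le_one)
  then show "colour_energy n c g m \<le> (real n)\<^sup>2" by (simp add: power2_eq_square)
qed

text \<open>One subsequence and one family of kernels serve all edge sets and all prescribed
  colours. The kernels are not claimed to sum to 1: without a bound on moments, mass can escape to
  ever larger colours.\<close>

lemma coloured_limit:
  fixes n :: "nat \<Rightarrow> nat" and g :: "nat \<Rightarrow> nat \<Rightarrow> nat \<Rightarrow> nat"
  assumes n: "\<And>l. n l \<ge> 1"
    and sym: "\<And>l u v. u < n l \<Longrightarrow> v < n l \<Longrightarrow> g l u v = g l v u"
  shows "\<exists>r \<mu>. strict_mono r \<and> (\<forall>m. (\<lambda>(x, y). \<mu> m x y) \<in> borel_measurable (borel \<Otimes>\<^sub>M borel)) \<and>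
    (\<forall>m x y. 0 \<le> \<mu> m x y \<and> \<mu> m x y \<le> 1 \<and> \<mu> m x y = \<mu> m y x) \<and>
    (\<forall>k E c. edge_set k E \<longrightarrow>
      (\<lambda>l. kernel_hom k E (n (r l)) (\<lambda>e. colour_class (g (r l)) (c e)))
        \<longlonglongrightarrow> (LINT x|cube k. (\<Prod>e\<in>E. \<mu> (c e) (x (fst e)) (x (snd e)))))"
proof -
  have "\<forall>l. \<exists>p. regular_codes (n l) (g l) (fst p) (snd p)"
    using ex_regular_codes[OF n] by (simp add: split_paired_Ex)
  from choice[OF this] obtain p where p: "\<And>l. regular_codes (n l) (g l) (fst (p l)) (snd (p l))"
    by blast
  define C where "C l = fst (p l)" for l
  define \<delta> where "\<delta> l = snd (p l)" for l
  have "regular_codes (n l) (g l) (C l) (\<delta> l)" for l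
    unfolding C_def \<delta>_def by (rule p)
  note reg = this[unfolded regular_codes_def]
  note C_lt = reg[THEN conjunct1, rule_format]
    and C_div = reg[THEN conjunct2, THEN conjunct1, rule_format]
    and \<delta>01 = reg[THEN conjunct2, THEN conjunct2, THEN conjunct1, rule_format]
    and \<delta>_sum = reg[THEN conjunct2, THEN conjunct2, THEN conjunct2, THEN conjunct1, rule_format]
    and cut = reg[THEN conjunct2, THEN conjunct2, THEN conjunct2, THEN conjunct2, rule_format]
  define wt where "wt l t a = real (card (cell (n l) (C l t) a)) / real (n l)" for l t a
  define D where "D l t m = cell_avg (n l) (C l t) (colour_class (g l) m)" for l t m
  define En where "En l t m = colour_energy (n l) (C l t) (g l) m / (real (n l))\<^sup>2" for l t m
  have wt01: "0 \<le> wt l t a \<and> wt l t a \<le> 1" for l t a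
  proof -
    have "card (cell (n l) (C l t) a) \<le> card {..<n l}" by (intro card_mono) (auto simp: cell_def)
    then show ?thesis using n[of l] by (simp add: wt_def divide_le_eq_1)
  qed
  have D01: "0 \<le> D l t m a b \<and> D l t m a b \<le> 1" for l t m a b
    unfolding D_def by (intro conjI cell_avg_bounds colour_class_bounds)
  have En01: "0 \<le> En l t m \<and> En l t m \<le> 1" for l t m
    unfolding En_def using colour_energy_bounds[of "n l" "C l t" "g l" m] n[of l]
    by (simp add: divide_le_eq_1)
  have C_div': "C l t u = C l s u div 4 ^ (s - t)" if "t \<le> s" for l t s u
    using that
  proof (induction s rule: dec_induct)
    case (step s)
    have "C l t u = C l (Suc s) u div 4 div 4 ^ (s - t)" using step C_div[of l s u] by simp
    then show ?case using step by (simp add: div_mult2_eq[symmetric] Suc_diff_le)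
  qed simp
  \<comment> \<open>Cell weights, block densities, cut errors and energies are packed into one
    family over a countable sum type, so that a single subsequence serves all of them.\<close>
  define F :: "nat \<Rightarrow> (nat \<times> nat) + (nat \<times> nat \<times> nat \<times> nat) + nat + (nat \<times> nat) \<Rightarrow> real" where
    "F l i = (case i of Inl (t, a) \<Rightarrow> wt l t a
      | Inr (Inl (t, m, a, b)) \<Rightarrow> D l t m a b
      | Inr (Inr (Inl t)) \<Rightarrow> \<delta> l t
      | Inr (Inr (Inr (t, m))) \<Rightarrow> En l t m)" for l i
  have "0 \<le> F l i \<and> F l i \<le> 1" for l i
    unfolding F_def using wt01 D01 \<delta>01 En01 by (auto split: sum.split)
  from countable_bounded_subsequence[of F, OF this] obtain r where
    r: "strict_mono r" and conv: "\<And>i. convergent (\<lambda>l. F (r l) i)" by blast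
  define w where "w t a = lim (\<lambda>l. wt (r l) t a)" for t a
  have w: "(\<lambda>l. wt (r l) t a) \<longlonglongrightarrow> w t a" for t a
    using conv[of "Inl (t, a)"] by (simp add: F_def w_def convergent_LIMSEQ_iff)
  define d where "d t m a b = lim (\<lambda>l. D (r l) t m a b)" for t m a b
  have d: "(\<lambda>l. D (r l) t m a b) \<longlonglongrightarrow> d t m a b" for t m a b
    using conv[of "Inr (Inl (t, m, a, b))"] by (simp add: F_def d_def convergent_LIMSEQ_iff)
  define h where "h t = lim (\<lambda>l. \<delta> (r l) t)" for t
  have h: "(\<lambda>l. \<delta> (r l) t) \<longlonglongrightarrow> h t" for t
    using conv[of "Inr (Inr (Inl t))"] by (simp add: F_def h_def convergent_LIMSEQ_iff)
  define en where "en t m = lim (\<lambda>l. En (r l) t m)" for t m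
  have en: "(\<lambda>l. En (r l) t m) \<longlonglongrightarrow> en t m" for t m
    using conv[of "Inr (Inr (Inr (t, m)))"] by (simp add: F_def en_def convergent_LIMSEQ_iff)

  have w0: "0 \<le> w t a" for t a
    by (rule LIMSEQ_le_const[OF w]) (use wt01 in auto)
  have d01: "0 \<le> d t m a b \<and> d t m a b \<le> 1" for t m a b
    using LIMSEQ_le_const[OF d] LIMSEQ_le_const2[OF d] D01 by blast
  have w1: "(\<Sum>a<4 ^ t. w t a) = 1" for t
  proof (rule LIMSEQ_unique)
    show "(\<lambda>l. \<Sum>a<4 ^ t. wt (r l) t a) \<longlonglongrightarrow> (\<Sum>a<4 ^ t. w t a)" by (intro tendsto_sum w)
    have "(\<Sum>a<4 ^ t. wt l t a) = 1" for l
      unfolding wt_def sum_divide_distrib[symmetric] using n[of l] C_lt by (simp add: sum_card_cells)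
    then show "(\<lambda>l. \<Sum>a<4 ^ t. wt (r l) t a) \<longlonglongrightarrow> 1" by simp
  qed
  have w4: "w t a = (\<Sum>b<4. w (Suc t) (4 * a + b))" for t a
  proof (rule LIMSEQ_unique[OF w])
    have "wt l t a = (\<Sum>b<4. wt l (Suc t) (4 * a + b))" for l
      using card_cell_children[where n="n l" and c="C l t" and c'="C l (Suc t)" and a=a, OF C_div]
      unfolding wt_def sum_divide_distrib[symmetric] by simp
    moreover have "(\<lambda>l. \<Sum>b<4. wt (r l) (Suc t) (4 * a + b)) \<longlonglongrightarrow> (\<Sum>b<4. w (Suc t) (4 * a + b))"
      by (intro tendsto_sum w)
    ultimately show "(\<lambda>l. wt (r l) t a) \<longlonglongrightarrow> (\<Sum>b<4. w (Suc t) (4 * a + b))" by simp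
  qed
  from interval_code[of w, OF w0 w1 w4] obtain idx :: "nat \<Rightarrow> real \<Rightarrow> nat" where
    idx_meas: "\<And>t. idx t \<in> borel \<rightarrow>\<^sub>M count_space UNIV" and idx_lt: "\<And>t x. idx t x < 4 ^ t" and
    idx_div: "\<And>t x. idx t x = idx (Suc t) x div 4" and
    idx_w: "\<And>t a. a < 4 ^ t \<Longrightarrow> measure lborel {x\<in>{0..1}. idx t x = a} = w t a" by blast
  have idx_div': "idx t x = idx s x div 4 ^ (s - t)" if "t \<le> s" for t s x
    using that
  proof (induction s rule: dec_induct)
    case (step s)
    have "idx t x = idx (Suc s) x div 4 div 4 ^ (s - t)" using step idx_div[of s x] by simp
    then show ?case using step by (simp add: div_mult2_eq[symmetric] Suc_diff_le)
  qed simp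
  define W where "W t m = (\<lambda>(x, y). d t m (idx t x) (idx t y))" for t m
  have W01: "0 \<le> W t m p \<and> W t m p \<le> 1" for t m p
    using d01 by (simp add: W_def case_prod_unfold)
  have W_meas: "W t m \<in> borel_measurable (borel \<Otimes>\<^sub>M borel)" for t m
  proof -
    note idx_meas [measurable]
    have "(\<lambda>p. (idx t (fst p), idx t (snd p))) \<in> borel \<Otimes>\<^sub>M borel \<rightarrow>\<^sub>M count_space UNIV \<Otimes>\<^sub>M count_space UNIV"
      by measurable
    then have "(\<lambda>p. (idx t (fst p), idx t (snd p))) \<in> borel \<Otimes>\<^sub>M borel \<rightarrow>\<^sub>M count_space UNIV"
      by (simp add: pair_measure_countable)
    then have "(\<lambda>q. d t m (fst q) (snd q)) \<circ> (\<lambda>p. (idx t (fst p), idx t (snd p)))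
        \<in> borel_measurable (borel \<Otimes>\<^sub>M borel)"
      by (rule measurable_comp) simp
    then show ?thesis by (simp add: W_def o_def case_prod_unfold)
  qed
  have transfer: "(\<lambda>l. (\<Sum>\<phi>\<in>{..<k} \<rightarrow>\<^sub>E {..<n (r l)}. f l (restrict (C (r l) t \<circ> \<phi>) {..<k})) / real (n (r l)) ^ k)
    \<longlonglongrightarrow> (LINT x|cube k. f' (restrict (idx t \<circ> x) {..<k}))"
    if "\<And>\<alpha>. (\<lambda>l. f l \<alpha>) \<longlonglongrightarrow> f' \<alpha>" for k t f f'
    using step_transfer[where idx="idx t" and n="\<lambda>l. n (r l)" and c="\<lambda>l. C (r l) t" and N="4 ^ t"
        and f=f and g=f' and k=k, OF idx_meas idx_lt C_lt _ that] w idx_w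
    by (simp add: wt_def)

  \<comment> \<open>The finite inequality between two levels is carried to the limit by
    \<open>transfer\<close> for two nodes. Codes of level \<open>t\<close> are quotients of codes of
    level \<open>s\<close>, so both kernels are step kernels of level \<open>s\<close>.\<close>
  have L1: "(LINT p|square. \<bar>W s m p - W t m p\<bar>) \<le> sqrt (en s m - en t m)" if ts: "t \<le> s" for s t m
  proof (rule LIMSEQ_le)
    let ?q = "4 ^ (s - t) :: nat"
    define f where "f l \<alpha> = \<bar>D (r l) s m (\<alpha> 0) (\<alpha> 1) - D (r l) t m (\<alpha> 0 div ?q) (\<alpha> 1 div ?q)\<bar>"
      for l and \<alpha> :: "nat \<Rightarrow> nat"
    define f' where "f' \<alpha> = \<bar>d s m (\<alpha> 0) (\<alpha> 1) - d t m (\<alpha> 0 div ?q) (\<alpha> 1 div ?q)\<bar>"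
      for \<alpha> :: "nat \<Rightarrow> nat"
    have "(\<lambda>l. (\<Sum>\<phi>\<in>{..<2} \<rightarrow>\<^sub>E {..<n (r l)}. f l (restrict (C (r l) s \<circ> \<phi>) {..<2})) / real (n (r l)) ^ 2)
      \<longlonglongrightarrow> (LINT x|cube 2. f' (restrict (idx s \<circ> x) {..<2}))"
      by (rule transfer) (auto simp: f_def f'_def intro!: tendsto_intros d)
    moreover have "(LINT x|cube 2. f' (restrict (idx s \<circ> x) {..<2})) = (LINT x|cube 2. \<bar>W s m (x 0, x 1) - W t m (x 0, x 1)\<bar>)"
      by (simp add: f'_def W_def idx_div'[OF ts])
    also have "\<dots> = (LINT p|square. \<bar>W s m p - W t m p\<bar>)"
      by (rule integral_cube_pair[where f="\<lambda>p. \<bar>W s m p - W t m p\<bar>"])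
        (auto intro!: borel_measurable_abs borel_measurable_diff measurable_square W_meas)
    ultimately show "(\<lambda>l. (\<Sum>\<phi>\<in>{..<2} \<rightarrow>\<^sub>E {..<n (r l)}. f l (restrict (C (r l) s \<circ> \<phi>) {..<2})) / real (n (r l)) ^ 2)
      \<longlonglongrightarrow> (LINT p|square. \<bar>W s m p - W t m p\<bar>)" by (simp only:)
    show "(\<lambda>l. sqrt (En (r l) s m - En (r l) t m)) \<longlonglongrightarrow> sqrt (en s m - en t m)"
      by (intro tendsto_intros en)
    have "(\<Sum>\<phi>\<in>{..<2} \<rightarrow>\<^sub>E {..<n (r l)}. f l (restrict (C (r l) s \<circ> \<phi>) {..<2})) / real (n (r l)) ^ 2
        \<le> sqrt (En (r l) s m - En (r l) t m)" for l
    proof -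
      have "(\<Sum>\<phi>\<in>{..<2} \<rightarrow>\<^sub>E {..<n (r l)}. f l (restrict (C (r l) s \<circ> \<phi>) {..<2}))
        = (\<Sum>\<phi>\<in>{..<2::nat} \<rightarrow>\<^sub>E {..<n (r l)}. \<bar>avg_kernel (n (r l)) (C (r l) s) (g (r l)) m (\<phi> 0) (\<phi> 1)
             - avg_kernel (n (r l)) (C (r l) t) (g (r l)) m (\<phi> 0) (\<phi> 1)\<bar>)"
        by (simp add: f_def D_def avg_kernel_def C_div'[OF ts])
      also have "\<dots> = (\<Sum>u<n (r l). \<Sum>v<n (r l). \<bar>avg_kernel (n (r l)) (C (r l) s) (g (r l)) m u v
             - avg_kernel (n (r l)) (C (r l) t) (g (r l)) m u v\<bar>)"
        by (rule sum_PiE_two)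
      finally show ?thesis
        unfolding En_def
        using avg_kernel_L1_le[OF n, where c="C (r l) t" and c'="C (r l) s" and p="\<lambda>a. a div ?q"
            and g="g (r l)" and m=m, OF C_div'[OF ts]] by simp
    qed
    then show "\<exists>N. \<forall>l\<ge>N. (\<Sum>\<phi>\<in>{..<2} \<rightarrow>\<^sub>E {..<n (r l)}. f l (restrict (C (r l) s \<circ> \<phi>) {..<2})) / real (n (r l)) ^ 2
        \<le> sqrt (En (r l) s m - En (r l) t m)" by blast
  qed
  have en_inc: "en t m \<le> en (Suc t) m" for t m
  proof (rule LIMSEQ_le[OF en en], intro exI allI impI)
    fix l
    show "En (r l) t m \<le> En (r l) (Suc t) m"
      unfolding En_def using colour_energy_mono[where p="\<lambda>a. a div 4" and c="C (r l) t" and c'="C (r l) (Suc t)", OF C_div]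
      by (intro divide_right_mono) auto
  qed
  have en1: "en t m \<le> 1" for t m
    using LIMSEQ_le_const2[OF en] En01 by blast
  \<comment> \<open>For each colour the limiting energies increase and stay below 1, so their
    increments, and with them the mean distances of the step kernels, become small.\<close>
  have Cauchy: "\<exists>T. \<forall>t\<ge>T. \<forall>s\<ge>t. (LINT p|square. \<bar>W s m p - W t m p\<bar>) < e" if e: "e > 0" for e m
  proof -
    have "incseq (\<lambda>t. en t m)" using en_inc by (simp add: incseq_Suc_iff)
    then have "Cauchy (\<lambda>t. en t m)"
      using en1 by (metis incseq_convergent LIMSEQ_imp_Cauchy)
    then obtain T where T: "\<And>t s. T \<le> t \<Longrightarrow> T \<le> s \<Longrightarrow> norm (en s m - en t m) < e\<^sup>2"
      using e by (metis CauchyD zero_less_power)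
    have "(LINT p|square. \<bar>W s m p - W t m p\<bar>) < e" if "T \<le> t" "t \<le> s" for t s
    proof -
      have "en s m - en t m < e\<^sup>2" using T[of t s] that by auto
      then have "sqrt (en s m - en t m) < sqrt (e\<^sup>2)" by (rule real_sqrt_less_mono)
      then show ?thesis using L1[OF \<open>t \<le> s\<close>, of m] e by simp
    qed
    then show ?thesis by blast
  qed
  have fin_sq: "finite_measure square"
    by (intro finite_measure_pair_measure finite_measure_unit_interval)
  \<comment> \<open>Here \<open>\<rho> m\<close> is a subsequence of levels that depends on the
    colour \<open>m\<close>. The dependence is harmless, since \<open>\<mu>_L1\<close> below gives
    convergence in mean along all levels.\<close>
  have "\<exists>\<rho>. \<forall>m. strict_mono (\<rho> m) \<and> (AE p in square. convergent (\<lambda>j. W (\<rho> m j) m p))"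
    by (intro choice allI L1_Cauchy_imp_AE_convergent_subseq[where f="\<lambda>t. W t _"] fin_sq measurable_square W_meas W01 Cauchy)
  then obtain \<rho> where \<rho>: "\<And>m. strict_mono (\<rho> m)"
    and \<rho>_conv: "\<And>m. AE p in square. convergent (\<lambda>j. W (\<rho> m j) m p)" by blast
  define \<mu> where "\<mu> m x y = subseq_limit (\<rho> m) (\<lambda>t. W t m (x, y))" for m x y
  have \<mu>_meas: "(\<lambda>(x, y). \<mu> m x y) \<in> borel_measurable (borel \<Otimes>\<^sub>M borel)" for m
    using subseq_limit_measurable[of "\<lambda>t. W t m", OF W_meas] by (simp add: \<mu>_def case_prod_unfold)
  have \<mu>01: "0 \<le> \<mu> m x y \<and> \<mu> m x y \<le> 1" for m x y
    unfolding \<mu>_def by (intro conjI subseq_limit_bounds W01)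
  have d_sym: "d t m a b = d t m b a" for t m a b
  proof -
    have "D l t m a b = D l t m b a" for l
      unfolding D_def by (rule cell_avg_sym) (simp add: colour_class_def sym)
    then show ?thesis unfolding d_def by (intro arg_cong[where f=lim] ext)
  qed
  have \<mu>_sym: "\<mu> m x y = \<mu> m y x" for m x y
  proof -
    have "W t m (x, y) = W t m (y, x)" for t using d_sym by (simp add: W_def)
    then show ?thesis by (simp add: \<mu>_def)
  qed
  have \<mu>_L1: "(\<lambda>t. LINT p|square. \<bar>W t m p - (case p of (x, y) \<Rightarrow> \<mu> m x y)\<bar>) \<longlonglongrightarrow> 0" for m
    using subseq_limit_L1[where f="\<lambda>t. W t m" and r="\<rho> m", OF fin_sq measurable_square[OF W_meas] W01 Cauchy \<rho> \<rho>_conv]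
    by (simp add: \<mu>_def case_prod_unfold)
  \<comment> \<open>For each finite \<open>K\<close> the bound on the sum of squares passes to the
    limit over the graphs; the resulting series converges, so its terms tend to 0.\<close>
  have h0: "h \<longlonglongrightarrow> 0"
  proof -
    have "(\<Sum>t<K. (h t)\<^sup>2) \<le> 4" for K
      by (rule LIMSEQ_le_const2[of "\<lambda>l. \<Sum>t<K. (\<delta> (r l) t)\<^sup>2"]) (auto intro!: tendsto_intros h \<delta>_sum)
    then have "summable (\<lambda>t. (h t)\<^sup>2)" by (intro summableI_nonneg_bounded) auto
    then have "(\<lambda>t. (h t)\<^sup>2) \<longlonglongrightarrow> 0" by (rule summable_LIMSEQ_zero)
    then have "(\<lambda>t. sqrt ((h t)\<^sup>2)) \<longlonglongrightarrow> sqrt 0" by (intro tendsto_intros)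
    then show ?thesis by (simp add: tendsto_rabs_zero_iff)
  qed
  have hom: "(\<lambda>l. kernel_hom k E (n (r l)) (\<lambda>e. colour_class (g (r l)) (c e)))
        \<longlonglongrightarrow> (LINT x|cube k. (\<Prod>e\<in>E. \<mu> (c e) (x (fst e)) (x (snd e))))"
    if E: "edge_set k E" for k E and c :: "nat \<times> nat \<Rightarrow> nat"
  proof (rule double_limit)
    show "\<bar>kernel_hom k E (n (r l)) (\<lambda>e. colour_class (g (r l)) (c e))
       - kernel_hom k E (n (r l)) (\<lambda>e. avg_kernel (n (r l)) (C (r l) t) (g (r l)) (c e))\<bar>
       \<le> real (card E) * \<delta> (r l) t" for l t
      using cut unfolding cut_err_def
      by (intro counting_lemma[OF E n] colour_class_bounds avg_kernel_bounds) auto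
    show "(\<lambda>l. real (card E) * \<delta> (r l) t) \<longlonglongrightarrow> real (card E) * h t" for t
      by (intro tendsto_intros h)
    show "(\<lambda>t. real (card E) * h t) \<longlonglongrightarrow> 0" using tendsto_mult_right_zero[OF h0] by simp
    have lt: "fst e < k" "snd e < k" "fst e \<noteq> snd e" if "e \<in> E" for e
      using E that by (force simp: edge_set_def)+
    show "(\<lambda>l. kernel_hom k E (n (r l)) (\<lambda>e. avg_kernel (n (r l)) (C (r l) t) (g (r l)) (c e)))
      \<longlonglongrightarrow> (LINT x|cube k. (\<Prod>e\<in>E. W t (c e) (x (fst e), x (snd e))))" for t
    proof -
      have "(\<lambda>l. (\<Sum>\<phi>\<in>{..<k} \<rightarrow>\<^sub>E {..<n (r l)}. (\<lambda>\<alpha>. \<Prod>e\<in>E. D (r l) t (c e) (\<alpha> (fst e)) (\<alpha> (snd e)))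
            (restrict (C (r l) t \<circ> \<phi>) {..<k})) / real (n (r l)) ^ k)
        \<longlonglongrightarrow> (LINT x|cube k. (\<lambda>\<alpha>. \<Prod>e\<in>E. d t (c e) (\<alpha> (fst e)) (\<alpha> (snd e))) (restrict (idx t \<circ> x) {..<k}))"
        by (rule transfer) (intro tendsto_prod d)
      moreover have "(\<Prod>e\<in>E. D l t (c e) (restrict (C l t \<circ> \<phi>) {..<k} (fst e)) (restrict (C l t \<circ> \<phi>) {..<k} (snd e)))
         = (\<Prod>e\<in>E. avg_kernel (n l) (C l t) (g l) (c e) (\<phi> (fst e)) (\<phi> (snd e)))" for l \<phi>
        by (intro prod.cong refl) (simp add: lt D_def avg_kernel_def)
      moreover have "(\<Prod>e\<in>E. d t (c e) (restrict (idx t \<circ> x) {..<k} (fst e)) (restrict (idx t \<circ> x) {..<k} (snd e)))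
         = (\<Prod>e\<in>E. W t (c e) (x (fst e), x (snd e)))" for x
        by (intro prod.cong refl) (simp add: lt W_def)
      ultimately show ?thesis by (simp add: kernel_hom_def)
    qed
    interpret cube: finite_measure "cube k" by (rule finite_measure_cube)
    let ?\<mu> = "\<lambda>m p. case p of (x, y) \<Rightarrow> \<mu> m x y"
    let ?W = "\<lambda>t x. \<Prod>e\<in>E. W t (c e) (x (fst e), x (snd e))"
    let ?M = "\<lambda>x. \<Prod>e\<in>E. ?\<mu> (c e) (x (fst e), x (snd e))"
    have pair: "(\<lambda>x. (x (fst e), x (snd e))) \<in> cube k \<rightarrow>\<^sub>M square" if "e \<in> E" for e
      using lt[OF that] by (intro measurable_Pair measurable_component_singleton) auto
    have meas: "(\<lambda>x. W t (c e) (x (fst e), x (snd e))) \<in> borel_measurable (cube k)"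
      "(\<lambda>x. ?\<mu> (c e) (x (fst e), x (snd e))) \<in> borel_measurable (cube k)" if "e \<in> E" for e t
      using measurable_compose[OF pair[OF that] measurable_square[OF W_meas]]
        measurable_compose[OF pair[OF that] measurable_square[OF \<mu>_meas]] by auto
    have intW: "integrable (cube k) (?W t)" for t
      using W01 by (intro cube.integrable_const_bound[of _ 1] borel_measurable_prod meas)
        (auto simp: abs_prod intro!: prod_le_1)
    have intM: "integrable (cube k) ?M"
      using \<mu>01 by (intro cube.integrable_const_bound[of _ 1] borel_measurable_prod meas)
        (auto simp: abs_prod intro!: prod_le_1)
    have int1: "integrable (cube k) (\<lambda>x. \<bar>W t (c e) (x (fst e), x (snd e)) - ?\<mu> (c e) (x (fst e), x (snd e))\<bar>)"
      if "e \<in> E" for e t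
    proof (rule cube.integrable_const_bound[of _ 1])
      show "AE x in cube k. norm \<bar>W t (c e) (x (fst e), x (snd e)) - ?\<mu> (c e) (x (fst e), x (snd e))\<bar> \<le> 1"
      proof (rule AE_I2)
        fix x
        show "norm \<bar>W t (c e) (x (fst e), x (snd e)) - ?\<mu> (c e) (x (fst e), x (snd e))\<bar> \<le> 1"
          using W01[of t "c e" "(x (fst e), x (snd e))"] \<mu>01[of "c e" "x (fst e)" "x (snd e)"]
          by (simp add: abs_le_iff)
      qed
    qed (intro borel_measurable_abs borel_measurable_diff meas that)
    \<comment> \<open>All factors lie in \<open>[0,1]\<close>, so the difference of the products is
      at most the sum of the differences of the factors. Each summand depends on two coordinates and
      integrates over the square.\<close>
    have bound: "\<bar>(LINT x|cube k. ?W t x) - (LINT x|cube k. ?M x)\<bar>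
       \<le> (\<Sum>e\<in>E. LINT p|square. \<bar>W t (c e) p - ?\<mu> (c e) p\<bar>)" for t
    proof -
      have "\<bar>(LINT x|cube k. ?W t x) - (LINT x|cube k. ?M x)\<bar> = \<bar>LINT x|cube k. ?W t x - ?M x\<bar>"
        using intW intM by simp
      also have "\<dots> \<le> (LINT x|cube k. \<bar>?W t x - ?M x\<bar>)" by (rule integral_abs_bound)
      also have "\<dots> \<le> (LINT x|cube k. (\<Sum>e\<in>E. \<bar>W t (c e) (x (fst e), x (snd e)) - ?\<mu> (c e) (x (fst e), x (snd e))\<bar>))"
      proof (rule integral_mono)
        show "integrable (cube k) (\<lambda>x. \<bar>?W t x - ?M x\<bar>)"
          by (intro integrable_abs Bochner_Integration.integrable_diff intW intM)
        show "integrable (cube k)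
            (\<lambda>x. \<Sum>e\<in>E. \<bar>W t (c e) (x (fst e), x (snd e)) - ?\<mu> (c e) (x (fst e), x (snd e))\<bar>)"
          by (intro Bochner_Integration.integrable_sum int1)
        fix x
        show "\<bar>?W t x - ?M x\<bar> \<le> (\<Sum>e\<in>E. \<bar>W t (c e) (x (fst e), x (snd e)) - ?\<mu> (c e) (x (fst e), x (snd e))\<bar>)"
          using norm_prod_diff[of E "\<lambda>e. W t (c e) (x (fst e), x (snd e))" "\<lambda>e. ?\<mu> (c e) (x (fst e), x (snd e))"]
            W01 \<mu>01 by auto
      qed
      also have "\<dots> = (\<Sum>e\<in>E. LINT x|cube k. \<bar>W t (c e) (x (fst e), x (snd e)) - ?\<mu> (c e) (x (fst e), x (snd e))\<bar>)"
        by (intro Bochner_Integration.integral_sum int1)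
      also have "\<dots> = (\<Sum>e\<in>E. LINT p|square. \<bar>W t (c e) p - ?\<mu> (c e) p\<bar>)"
        using lt measurable_square[OF W_meas] measurable_square[OF \<mu>_meas]
        by (intro sum.cong refl integral_cube_pair[where f="\<lambda>p. \<bar>W t _ p - ?\<mu> _ p\<bar>"]
            borel_measurable_abs borel_measurable_diff) auto
      finally show ?thesis .
    qed
    have "(\<lambda>t. \<Sum>e\<in>E. LINT p|square. \<bar>W t (c e) p - ?\<mu> (c e) p\<bar>) \<longlonglongrightarrow> (\<Sum>e\<in>E. 0)"
      by (intro tendsto_sum \<mu>_L1)
    then have lim0: "(\<lambda>t. \<Sum>e\<in>E. LINT p|square. \<bar>W t (c e) p - ?\<mu> (c e) p\<bar>) \<longlonglongrightarrow> 0"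
      by (simp only: sum.neutral_const)
    have "(\<lambda>t. (LINT x|cube k. ?W t x) - (LINT x|cube k. ?M x)) \<longlonglongrightarrow> 0"
      by (rule Lim_null_comparison[OF _ lim0], rule always_eventually, rule allI, unfold real_norm_def, rule bound)
    then show "(\<lambda>t. LINT x|cube k. ?W t x) \<longlonglongrightarrow> (LINT x|cube k. (\<Prod>e\<in>E. \<mu> (c e) (x (fst e)) (x (snd e))))"
      by (simp add: LIM_zero_iff)
  qed
  show ?thesis
  proof (rule exI[of _ r], rule exI[of _ \<mu>], intro conjI allI impI)
    show "strict_mono r" by (rule r)
    show "(\<lambda>(x, y). \<mu> m x y) \<in> borel_measurable (borel \<Otimes>\<^sub>M borel)" for m by (rule \<mu>_meas)
    show "0 \<le> \<mu> m x y" "\<mu> m x y \<le> 1" for m x y using \<mu>01[of m x y] by auto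
    show "\<mu> m x y = \<mu> m y x" for m x y by (rule \<mu>_sym)
    show "(\<lambda>l. kernel_hom k E (n (r l)) (\<lambda>e. colour_class (g (r l)) (c e)))
        \<longlonglongrightarrow> (LINT x|cube k. (\<Prod>e\<in>E. \<mu> (c e) (x (fst e)) (x (snd e))))"
      if "edge_set k E" for k E and c :: "nat \<times> nat \<Rightarrow> nat" using that by (rule hom)
  qed
qed

section \<open>Weights and sequence functionals\<close>

lemma summable_inverse_squares: "summable (\<lambda>m. 1 / real (m + 1) ^ 2)"
  using sums_summable[OF inverse_squares_sums] by simp

text \<open>The weight is \<open>(m + 1) powr - j m\<close>, where \<open>j m\<close> grows so slowly that \<open>b m\<close> still decays
  essentially like \<open>(m + 1) powr - (j m)\<^sup>2\<close>; then every fixed power of \<open>1 / \<rho> m\<close> is absorbed by \<open>b m\<close>.\<close>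

lemma exists_weight_function:
  fixes b :: "nat \<Rightarrow> real"
  assumes b0: "\<And>m. 0 \<le> b m" and decay: "\<And>p. \<exists>C. \<forall>m. b m * real (m + 1) ^ p \<le> C"
  shows "\<exists>\<rho>. weight_function \<rho> \<and> (\<forall>p q. summable (\<lambda>m. b m * (real (m + 1) ^ p / \<rho> m ^ q)))"
proof -
  obtain C where C: "\<And>p m. b m * real (m + 1) ^ p \<le> C p" using decay by metis
  \<comment> \<open>The test at \<open>p * p\<close> bounds \<open>b m\<close> by
    \<open>(m+1) / (m+1)^((j m)^2)\<close> once \<open>j m > 0\<close>. The clause
    \<open>p \<le> m\<close> keeps the set finite, \<open>p = 0\<close> keeps it nonempty, and every
    fixed \<open>p\<close> belongs to it eventually.\<close>
  define J where "J m = {p. p \<le> m \<and> (p = 0 \<or> C (p * p) \<le> real (m + 1))}" for m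
  define j where "j m = Max (J m)" for m
  have fin: "finite (J m)" for m by (rule finite_subset[of _ "{..m}"]) (auto simp: J_def)
  have jJ: "j m \<in> J m" for m
    unfolding j_def by (rule Max_in[OF fin]) (auto simp: J_def)
  have j_large: "eventually (\<lambda>m. p \<le> j m) sequentially" for p
  proof -
    obtain N where N: "C (p * p) \<le> real N" using real_arch_simple by blast
    show ?thesis
      unfolding eventually_sequentially
    proof (intro exI[of _ "max p N"] allI impI)
      fix m assume "max p N \<le> m"
      then have "p \<in> J m" using N by (auto simp: J_def)
      then show "p \<le> j m" unfolding j_def by (rule Max_ge[OF fin])
    qed
  qed
  define \<rho> where "\<rho> m = 1 / real (m + 1) ^ j m" for m
  have pos: "\<rho> m > 0" for m by (simp add: \<rho>_def)
  have quot: "real (m + 1) ^ s / real (m + 1) ^ t \<le> 1 / real (m + 1) ^ 2" if "s + 2 \<le> t" for m s t :: nat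
  proof -
    have "real (m + 1) ^ s * real (m + 1) ^ 2 \<le> real (m + 1) ^ t"
      using that by (subst power_add[symmetric]) (rule power_increasing, auto)
    then show ?thesis by (subst frac_le_eq) (auto simp: field_simps divide_le_0_iff)
  qed
  have "summable (\<lambda>m. \<rho> m * real m ^ p)" for p
  proof (rule summable_comparison_test_ev[OF _ summable_inverse_squares])
    show "eventually (\<lambda>m. norm (\<rho> m * real m ^ p) \<le> 1 / real (m + 1) ^ 2) sequentially"
      using j_large[of "p + 2"]
    proof eventually_elim
      case (elim m)
      have "norm (\<rho> m * real m ^ p) = real m ^ p / real (m + 1) ^ j m"
        by (simp add: \<rho>_def)
      also have "\<dots> \<le> real (m + 1) ^ p / real (m + 1) ^ j m"
        by (intro divide_right_mono power_mono) auto
      also have "\<dots> \<le> 1 / real (m + 1) ^ 2" using elim by (rule quot)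
      finally show ?case .
    qed
  qed
  then have "weight_function \<rho>" using pos by (simp add: weight_function_def)
  moreover have "summable (\<lambda>m. b m * (real (m + 1) ^ p / \<rho> m ^ q))" for p q
  proof (rule summable_comparison_test_ev[OF _ summable_inverse_squares])
    show "eventually (\<lambda>m. norm (b m * (real (m + 1) ^ p / \<rho> m ^ q)) \<le> 1 / real (m + 1) ^ 2) sequentially"
      \<comment> \<open>With \<open>j = j m\<close>, the exponent to be absorbed is
        \<open>1 + p + j * q\<close>, and 2 more are needed for inverse squares. As
        \<open>j \<ge> 1\<close>, the total \<open>j * q + p + 3\<close> is at most
        \<open>j * (q + p + 3)\<close>, hence at most \<open>j * j\<close>.\<close>
      using j_large[of "q + p + 3"]
    proof eventually_elim
      case (elim m)
      let ?x = "real (m + 1)" and ?j = "j m"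
      have "C (?j * ?j) \<le> ?x" using jJ[of m] elim by (auto simp: J_def)
      then have "b m * ?x ^ (?j * ?j) \<le> ?x" using C[of m "?j * ?j"] by linarith
      then have bm: "b m \<le> ?x / ?x ^ (?j * ?j)"
        by (subst pos_le_divide_eq) auto
      have "norm (b m * (?x ^ p / \<rho> m ^ q)) = b m * ?x ^ (p + ?j * q)"
        using b0[of m] by (simp add: \<rho>_def power_divide power_add power_mult)
      also have "\<dots> \<le> ?x / ?x ^ (?j * ?j) * ?x ^ (p + ?j * q)"
        using bm by (intro mult_right_mono) auto
      also have "\<dots> = ?x ^ Suc (p + ?j * q) / ?x ^ (?j * ?j)" by simp
      also have "\<dots> \<le> 1 / ?x ^ 2"
      proof (rule quot)
        have "Suc (p + ?j * q) + 2 = ?j * q + 1 * (p + 3)" by simp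
        also have "\<dots> \<le> ?j * q + ?j * (p + 3)" using elim by (intro add_left_mono mult_right_mono) auto
        also have "\<dots> = ?j * (q + p + 3)" by (simp add: algebra_simps)
        also have "\<dots> \<le> ?j * ?j" using elim by (intro mult_left_mono) auto
        finally show "Suc (p + ?j * q) + 2 \<le> ?j * ?j" .
      qed
      finally show ?case .
    qed
  qed
  ultimately show ?thesis by blast
qed

section \<open>The weighted supremum norm and the closure of the polynomials\<close>

lemma C_norm_upper:
  assumes "h \<in> C_space \<rho>"
  shows "\<bar>h m * \<rho> m\<bar> \<le> C_norm \<rho> h"
proof -
  have "Bseq (\<lambda>m. h m * \<rho> m)"
    using assms by (intro convergent_imp_Bseq) (auto simp: C_space_def convergent_def)
  then obtain B where "\<And>m. \<bar>h m * \<rho> m\<bar> \<le> B" unfolding Bseq_def by auto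
  then have "bdd_above (range (\<lambda>m. \<bar>h m * \<rho> m\<bar>))" by (intro bdd_aboveI[of _ B]) auto
  then show ?thesis unfolding C_norm_def by (intro cSUP_upper) auto
qed

lemma C_norm_least: "(\<And>m. \<bar>h m * \<rho> m\<bar> \<le> B) \<Longrightarrow> C_norm \<rho> h \<le> B"
  unfolding C_norm_def by (rule cSUP_least) auto

lemma C_norm_nonneg: "h \<in> C_space \<rho> \<Longrightarrow> 0 \<le> C_norm \<rho> h"
  using C_norm_upper[of h \<rho> 0] by linarith

lemma C_space_add: "g \<in> C_space \<rho> \<Longrightarrow> h \<in> C_space \<rho> \<Longrightarrow> (\<lambda>m. g m + h m) \<in> C_space \<rho>"
  using tendsto_add[of "\<lambda>m. g m * \<rho> m" 0 sequentially "\<lambda>m. h m * \<rho> m" 0]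
  by (simp add: C_space_def distrib_right)

lemma C_space_scale: "h \<in> C_space \<rho> \<Longrightarrow> (\<lambda>m. c * h m) \<in> C_space \<rho>"
  using tendsto_mult_right_zero[of "\<lambda>m. h m * \<rho> m" sequentially c]
  by (simp add: C_space_def mult.assoc)

lemma C_space_diff: "g \<in> C_space \<rho> \<Longrightarrow> h \<in> C_space \<rho> \<Longrightarrow> (\<lambda>m. g m - h m) \<in> C_space \<rho>"
  using C_space_add[of g \<rho> "\<lambda>m. - 1 * h m"] C_space_scale[of h \<rho> "- 1"] by simp

lemma C_norm_add_le:
  assumes "g \<in> C_space \<rho>" "h \<in> C_space \<rho>"
  shows "C_norm \<rho> (\<lambda>m. g m + h m) \<le> C_norm \<rho> g + C_norm \<rho> h"
proof (rule C_norm_least)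
  fix m
  have "\<bar>(g m + h m) * \<rho> m\<bar> \<le> \<bar>g m * \<rho> m\<bar> + \<bar>h m * \<rho> m\<bar>"
    by (simp add: distrib_right abs_triangle_ineq)
  also have "\<dots> \<le> C_norm \<rho> g + C_norm \<rho> h" by (intro add_mono C_norm_upper assms)
  finally show "\<bar>(g m + h m) * \<rho> m\<bar> \<le> C_norm \<rho> g + C_norm \<rho> h" .
qed

lemma C_norm_scale_le:
  assumes "h \<in> C_space \<rho>"
  shows "C_norm \<rho> (\<lambda>m. c * h m) \<le> \<bar>c\<bar> * C_norm \<rho> h"
proof (rule C_norm_least)
  fix m
  show "\<bar>c * h m * \<rho> m\<bar> \<le> \<bar>c\<bar> * C_norm \<rho> h"
    using mult_left_mono[OF C_norm_upper[OF assms, of m], of "\<bar>c\<bar>"] by (simp add: abs_mult mult.assoc)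
qed

lemma R_space_C: "h \<in> R_space \<rho> \<Longrightarrow> h \<in> C_space \<rho>"
  by (simp add: R_space_def)

lemma R_space_approx: "h \<in> R_space \<rho> \<Longrightarrow> \<epsilon> > 0 \<Longrightarrow> \<exists>P. C_norm \<rho> (\<lambda>m. h m - poly_seq P m) < \<epsilon>"
  by (simp add: R_space_def)

lemma poly_seq_C: "weight_function \<rho> \<Longrightarrow> poly_seq P \<in> C_space \<rho>"
  by (intro R_space_C poly_seq_in_R_space)

lemma R_space_add:
  assumes \<rho>: "weight_function \<rho>" and gh: "g \<in> R_space \<rho>" "h \<in> R_space \<rho>"
  shows "(\<lambda>m. g m + h m) \<in> R_space \<rho>"
  unfolding R_space_def
proof (intro CollectI conjI allI impI)
  show "(\<lambda>m. g m + h m) \<in> C_space \<rho>" by (intro C_space_add R_space_C gh)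
  fix \<epsilon> :: real assume "\<epsilon> > 0"
  then obtain P Q where PQ: "C_norm \<rho> (\<lambda>m. g m - poly_seq P m) < \<epsilon> / 2" "C_norm \<rho> (\<lambda>m. h m - poly_seq Q m) < \<epsilon> / 2"
    using R_space_approx[OF gh(1), of "\<epsilon> / 2"] R_space_approx[OF gh(2), of "\<epsilon> / 2"] by auto
  have "C_norm \<rho> (\<lambda>m. g m + h m - poly_seq (P + Q) m)
      = C_norm \<rho> (\<lambda>m. (g m - poly_seq P m) + (h m - poly_seq Q m))"
    by (intro arg_cong[where f="C_norm \<rho>"]) (simp add: poly_seq_def fun_eq_iff)
  also have "\<dots> \<le> C_norm \<rho> (\<lambda>m. g m - poly_seq P m) + C_norm \<rho> (\<lambda>m. h m - poly_seq Q m)"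
    by (intro C_norm_add_le C_space_diff R_space_C gh poly_seq_in_R_space \<rho>)
  also have "\<dots> < \<epsilon>" using PQ by simp
  finally show "\<exists>P. C_norm \<rho> (\<lambda>m. g m + h m - poly_seq P m) < \<epsilon>" by blast
qed

lemma R_space_scale:
  assumes \<rho>: "weight_function \<rho>" and h: "h \<in> R_space \<rho>"
  shows "(\<lambda>m. c * h m) \<in> R_space \<rho>"
  unfolding R_space_def
proof (intro CollectI conjI allI impI)
  show "(\<lambda>m. c * h m) \<in> C_space \<rho>" by (intro C_space_scale R_space_C h)
  fix \<epsilon> :: real assume \<epsilon>: "\<epsilon> > 0"
  \<comment> \<open>The denominator is increased by 1 to cover the case
    \<open>c = 0\<close>.\<close>
  then obtain P where P: "C_norm \<rho> (\<lambda>m. h m - poly_seq P m) < \<epsilon> / (\<bar>c\<bar> + 1)"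
    using R_space_approx[OF h, of "\<epsilon> / (\<bar>c\<bar> + 1)"] by auto
  have hP: "(\<lambda>m. h m - poly_seq P m) \<in> C_space \<rho>"
    by (intro C_space_diff R_space_C h poly_seq_in_R_space \<rho>)
  have "C_norm \<rho> (\<lambda>m. c * h m - poly_seq (smult c P) m) = C_norm \<rho> (\<lambda>m. c * (h m - poly_seq P m))"
    by (simp add: poly_seq_def right_diff_distrib)
  also have "\<dots> \<le> \<bar>c\<bar> * C_norm \<rho> (\<lambda>m. h m - poly_seq P m)"
    by (rule C_norm_scale_le[OF hP])
  also have "\<dots> \<le> (\<bar>c\<bar> + 1) * C_norm \<rho> (\<lambda>m. h m - poly_seq P m)"
    using C_norm_nonneg[OF hP] by (intro mult_right_mono) auto
  also have "\<dots> < (\<bar>c\<bar> + 1) * (\<epsilon> / (\<bar>c\<bar> + 1))"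
    using P by (intro mult_strict_left_mono) auto
  also have "\<dots> = \<epsilon>"
    using abs_ge_zero[of c] by (simp add: field_simps)
  finally show "\<exists>P. C_norm \<rho> (\<lambda>m. c * h m - poly_seq P m) < \<epsilon>" by blast
qed

lemma R_space_diff:
  assumes "weight_function \<rho>" "g \<in> R_space \<rho>" "h \<in> R_space \<rho>"
  shows "(\<lambda>m. g m - h m) \<in> R_space \<rho>"
  using R_space_add[OF assms(1,2) R_space_scale[OF assms(1,3), of "- 1"]] by simp

text \<open>Lists of rationals form a countable type, so a supremum over them preserves
  measurability.\<close>

definition rat_poly :: "rat list \<Rightarrow> real poly" where
  "rat_poly xs = (\<Sum>i<length xs. monom (of_rat (xs ! i)) i)"

text \<open>Changing the coefficient of the \<open>i\<close>-th power by less than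
  \<open>\<eta>\<close> moves the sequence by at most \<open>\<eta> * B i\<close>, with
  \<open>B i\<close> the norm of that power, and there are finitely many coefficients.\<close>

lemma rat_poly_dense:
  assumes \<rho>: "weight_function \<rho>" and \<epsilon>: "\<epsilon> > 0"
  shows "\<exists>xs. C_norm \<rho> (\<lambda>m. poly_seq P m - poly_seq (rat_poly xs) m) < \<epsilon>"
proof -
  define B where "B i = C_norm \<rho> (poly_seq (monom 1 i))" for i
  have B0: "0 \<le> B i" for i unfolding B_def by (intro C_norm_nonneg poly_seq_C \<rho>)
  have B: "real m ^ i * \<rho> m \<le> B i" for m i
    using C_norm_upper[OF poly_seq_C[OF \<rho>, of "monom 1 i"], of m]
    by (simp add: B_def poly_seq_def poly_monom)
  have pos: "0 \<le> \<rho> m" for m using \<rho> by (simp add: weight_function_def less_imp_le)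
  let ?n = "degree P"
  define \<eta> where "\<eta> = \<epsilon> / ((\<Sum>i\<le>?n. B i) + 1)"
  have den: "0 < (\<Sum>i\<le>?n. B i) + 1" using B0 by (intro add_nonneg_pos sum_nonneg) auto
  have \<eta>: "\<eta> > 0" using \<epsilon> den by (simp add: \<eta>_def)
  have "\<exists>q::rat. \<bar>coeff P i - of_rat q\<bar> < \<eta>" for i
  proof -
    obtain q where "q \<in> \<rat>" "coeff P i - \<eta> < q" "q < coeff P i"
      using Rats_dense_in_real[of "coeff P i - \<eta>" "coeff P i"] \<eta> by auto
    then obtain q' where "q = of_rat q'" by (auto elim: Rats_cases)
    then show ?thesis
      using \<open>coeff P i - \<eta> < q\<close> \<open>q < coeff P i\<close> \<eta> by (intro exI[of _ q']) (simp add: abs_less_iff)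
  qed
  then obtain q :: "nat \<Rightarrow> rat" where q: "\<And>i. \<bar>coeff P i - of_rat (q i)\<bar> < \<eta>" by metis
  define xs where "xs = map q [0..<Suc ?n]"
  have eval: "poly_seq (rat_poly xs) m = (\<Sum>i\<le>?n. of_rat (q i) * real m ^ i)" for m
    unfolding poly_seq_def rat_poly_def poly_sum poly_monom xs_def
    by (rule sum.cong) (auto simp del: upt_Suc)
  have "C_norm \<rho> (\<lambda>m. poly_seq P m - poly_seq (rat_poly xs) m) \<le> \<eta> * (\<Sum>i\<le>?n. B i)"
  proof (rule C_norm_least)
    fix m
    have "(poly_seq P m - poly_seq (rat_poly xs) m) * \<rho> m
       = (\<Sum>i\<le>?n. (coeff P i - of_rat (q i)) * (real m ^ i * \<rho> m))"
      unfolding eval unfolding poly_seq_def poly_altdef sum_subtractf[symmetric] sum_distrib_right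
      by (intro sum.cong refl) (simp add: algebra_simps)
    also have "\<bar>\<dots>\<bar> \<le> (\<Sum>i\<le>?n. \<eta> * B i)"
    proof (intro order.trans[OF sum_abs] sum_mono)
      fix i
      show "\<bar>(coeff P i - of_rat (q i)) * (real m ^ i * \<rho> m)\<bar> \<le> \<eta> * B i"
        unfolding abs_mult using q[of i] B[of m i] pos[of m] \<eta> by (intro mult_mono) auto
    qed
    finally show "\<bar>(poly_seq P m - poly_seq (rat_poly xs) m) * \<rho> m\<bar> \<le> \<eta> * (\<Sum>i\<le>?n. B i)"
      by (simp add: sum_distrib_left)
  qed
  also have "\<dots> < \<eta> * ((\<Sum>i\<le>?n. B i) + 1)" using \<eta> by (intro mult_strict_left_mono) auto
  also have "\<dots> = \<epsilon>" using den by (simp add: \<eta>_def)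
  finally show ?thesis by blast
qed

lemma J_hat_bound:
  assumes "\<xi> \<in> J_hat \<rho>"
  obtains K where "0 \<le> K" "\<And>h. h \<in> R_space \<rho> \<Longrightarrow> \<bar>\<xi> h\<bar> \<le> K * C_norm \<rho> h"
proof -
  obtain K where K: "\<And>h. h \<in> R_space \<rho> \<Longrightarrow> \<bar>\<xi> h\<bar> \<le> K * C_norm \<rho> h"
    using assms unfolding J_hat_def by blast
  have "\<bar>\<xi> h\<bar> \<le> max 0 K * C_norm \<rho> h" if "h \<in> R_space \<rho>" for h
    by (rule order.trans[OF K[OF that]], rule mult_right_mono) (auto intro: C_norm_nonneg R_space_C that)
  then show ?thesis using that[of "max 0 K"] by auto
qed

lemma zero_in_R_space: "weight_function \<rho> \<Longrightarrow> (\<lambda>_. 0) \<in> R_space \<rho>"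
  using poly_seq_in_R_space[of \<rho> 0] by (simp add: poly_seq_def)

text \<open>The norm is a supremum over countably many functionals because the rational polynomials are
  dense in \<open>R_space \<rho>\<close>; the zero polynomial contributes \<open>0/0 = 0\<close>.\<close>

lemma J_norm_rat_poly:
  assumes \<rho>: "weight_function \<rho>" and \<xi>: "\<xi> \<in> J_hat \<rho>"
  shows "bdd_above (range (\<lambda>xs. \<bar>\<xi> (poly_seq (rat_poly xs))\<bar> / C_norm \<rho> (poly_seq (rat_poly xs))))"
    and "J_norm \<rho> \<xi> = (SUP xs. \<bar>\<xi> (poly_seq (rat_poly xs))\<bar> / C_norm \<rho> (poly_seq (rat_poly xs)))"
proof -
  let ?p = "\<lambda>xs. poly_seq (rat_poly xs)"
  let ?f = "\<lambda>xs. \<bar>\<xi> (?p xs)\<bar> / C_norm \<rho> (?p xs)"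
  obtain K where K0: "0 \<le> K" and K: "\<And>h. h \<in> R_space \<rho> \<Longrightarrow> \<bar>\<xi> h\<bar> \<le> K * C_norm \<rho> h"
    using J_hat_bound[OF \<xi>] by blast
  have pR: "?p xs \<in> R_space \<rho>" for xs by (rule poly_seq_in_R_space[OF \<rho>])
  have p0: "0 \<le> C_norm \<rho> (?p xs)" for xs by (intro C_norm_nonneg R_space_C pR)
  have fK: "?f xs \<le> K" for xs
    using K[OF pR[of xs]] p0[of xs] K0 by (cases "C_norm \<rho> (?p xs) = 0") (auto simp: pos_divide_le_eq)
  show bdd: "bdd_above (range ?f)" using fK by (intro bdd_aboveI[of _ K]) auto
  define \<sigma> where "\<sigma> = (SUP xs. ?f xs)"
  have \<sigma>: "?f xs \<le> \<sigma>" for xs unfolding \<sigma>_def by (intro cSUP_upper bdd) auto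
  have "0 \<le> ?f []" using p0[of "[]"] by simp
  then have \<sigma>0: "0 \<le> \<sigma>" using \<sigma>[of "[]"] by linarith
  have add: "\<xi> (\<lambda>m. g m + h m) = \<xi> g + \<xi> h" if "g \<in> R_space \<rho>" "h \<in> R_space \<rho>" for g h
    using \<xi> that by (auto simp: J_hat_def)
  have scale: "\<xi> (\<lambda>m. c * h m) = c * \<xi> h" if "h \<in> R_space \<rho>" for c h
    using \<xi> that by (auto simp: J_hat_def)
  let ?H = "{h \<in> R_space \<rho>. C_norm \<rho> h \<le> 1}"
  have H0: "(\<lambda>_. 0) \<in> ?H" using zero_in_R_space[OF \<rho>] by (simp add: C_norm_def)
  have "\<bar>\<xi> h\<bar> \<le> K" if "h \<in> ?H" for h
    using K[of h] that K0 by (intro order.trans[OF K]) (auto intro: mult_left_le)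
  then have bddH: "bdd_above ((\<lambda>h. \<bar>\<xi> h\<bar>) ` ?H)" by (intro bdd_aboveI[of _ K]) auto
  have upper: "\<bar>\<xi> h\<bar> \<le> J_norm \<rho> \<xi>" if "h \<in> ?H" for h
    unfolding J_norm_def using that by (intro cSUP_upper bddH)
  show "J_norm \<rho> \<xi> = (SUP xs. ?f xs)"
    unfolding \<sigma>_def[symmetric]
  proof (rule antisym)
    have "\<bar>\<xi> h\<bar> \<le> \<sigma>" if h: "h \<in> ?H" for h
    proof (rule field_le_epsilon)
      fix e :: real assume e: "e > 0"
      \<comment> \<open>An approximant within \<open>\<epsilon>\<close> of \<open>h\<close> has norm
        at most \<open>1 + \<epsilon>\<close>, so the value at \<open>h\<close> is at most
        \<open>\<sigma> * (1 + \<epsilon>) + K * \<epsilon>\<close>. The excess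
        \<open>\<epsilon> * (\<sigma> + K)\<close> stays below \<open>e\<close>; the extra 1 keeps
        the denominator positive.\<close>
      define \<epsilon> where "\<epsilon> = e / (\<sigma> + K + 1)"
      have \<epsilon>: "\<epsilon> > 0" using e \<sigma>0 K0 by (simp add: \<epsilon>_def)
      obtain P where P: "C_norm \<rho> (\<lambda>m. h m - poly_seq P m) < \<epsilon> / 2"
        using R_space_approx[of h \<rho> "\<epsilon> / 2"] h \<epsilon> by auto
      obtain xs where xs: "C_norm \<rho> (\<lambda>m. poly_seq P m - ?p xs m) < \<epsilon> / 2"
        using rat_poly_dense[OF \<rho>, of "\<epsilon> / 2"] \<epsilon> by auto
      have hR: "h \<in> R_space \<rho>" and h1: "C_norm \<rho> h \<le> 1" using h by auto
      have PR: "poly_seq P \<in> R_space \<rho>" by (rule poly_seq_in_R_space[OF \<rho>])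
      have "C_norm \<rho> (\<lambda>m. h m - ?p xs m)
          = C_norm \<rho> (\<lambda>m. (h m - poly_seq P m) + (poly_seq P m - ?p xs m))" by simp
      also have "\<dots> \<le> C_norm \<rho> (\<lambda>m. h m - poly_seq P m) + C_norm \<rho> (\<lambda>m. poly_seq P m - ?p xs m)"
        by (intro C_norm_add_le C_space_diff R_space_C hR PR pR)
      finally have close: "C_norm \<rho> (\<lambda>m. h m - ?p xs m) \<le> \<epsilon>" using P xs by linarith
      have dR: "(\<lambda>m. h m - ?p xs m) \<in> R_space \<rho>" by (intro R_space_diff \<rho> hR pR)
      have "C_norm \<rho> (?p xs) = C_norm \<rho> (\<lambda>m. h m + - 1 * (h m - ?p xs m))" by simp
      also have "\<dots> \<le> C_norm \<rho> h + C_norm \<rho> (\<lambda>m. - 1 * (h m - ?p xs m))"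
        by (intro C_norm_add_le C_space_scale R_space_C hR dR)
      also have "\<dots> \<le> 1 + \<bar>- 1\<bar> * \<epsilon>"
        using close h1 C_norm_scale_le[OF R_space_C[OF dR], of "- 1"] by simp
      finally have pn: "C_norm \<rho> (?p xs) \<le> 1 + \<epsilon>" by simp
      have "\<xi> h = \<xi> (\<lambda>m. ?p xs m + (h m - ?p xs m))" by simp
      also have "\<dots> = \<xi> (?p xs) + \<xi> (\<lambda>m. h m - ?p xs m)" by (rule add[OF pR dR])
      finally have "\<bar>\<xi> h\<bar> \<le> \<bar>\<xi> (?p xs)\<bar> + \<bar>\<xi> (\<lambda>m. h m - ?p xs m)\<bar>" by simp
      also have "\<bar>\<xi> (?p xs)\<bar> \<le> \<sigma> * C_norm \<rho> (?p xs)"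
        using \<sigma>[of xs] p0[of xs] K[OF pR[of xs]]
        by (cases "C_norm \<rho> (?p xs) = 0") (auto simp: pos_divide_le_eq)
      also have "\<dots> \<le> \<sigma> * (1 + \<epsilon>)" using pn \<sigma>0 by (rule mult_left_mono)
      also have "\<bar>\<xi> (\<lambda>m. h m - ?p xs m)\<bar> \<le> K * \<epsilon>"
        using K[OF dR] mult_left_mono[OF close K0] by linarith
      finally have "\<bar>\<xi> h\<bar> \<le> \<sigma> + \<epsilon> * (\<sigma> + K)" by (simp add: algebra_simps)
      also have "\<dots> \<le> \<sigma> + \<epsilon> * (\<sigma> + K + 1)" using \<epsilon> by (intro add_left_mono mult_left_mono) auto
      also have "\<epsilon> * (\<sigma> + K + 1) = e" using \<sigma>0 K0 by (simp add: \<epsilon>_def)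
      finally show "\<bar>\<xi> h\<bar> \<le> \<sigma> + e" by simp
    qed
    then show "J_norm \<rho> \<xi> \<le> \<sigma>"
      unfolding J_norm_def using H0 by (intro cSUP_least) auto
    show "\<sigma> \<le> J_norm \<rho> \<xi>"
      unfolding \<sigma>_def
    proof (rule cSUP_least)
      fix xs :: "rat list"
      show "?f xs \<le> J_norm \<rho> \<xi>"
      proof (cases "C_norm \<rho> (?p xs) = 0")
        case True
        then show ?thesis using upper[OF H0] by simp
      next
        case False
        let ?c = "1 / C_norm \<rho> (?p xs)"
        have "C_norm \<rho> (\<lambda>m. ?c * ?p xs m) \<le> \<bar>?c\<bar> * C_norm \<rho> (?p xs)"
          by (rule C_norm_scale_le[OF R_space_C[OF pR]])
        also have "\<dots> = 1" using False p0[of xs] by simp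
        finally have "(\<lambda>m. ?c * ?p xs m) \<in> ?H" using R_space_scale[OF \<rho> pR, of ?c xs] by blast
        from upper[OF this] show ?thesis
          unfolding scale[OF pR] using p0[of xs] by (simp add: abs_mult)
      qed
    qed simp
  qed
qed

text \<open>Sequences for which \<open>\<Sum>m. x m / \<rho> m\<close> diverges are sent to the zero functional.\<close>

definition seq_functional :: "(nat \<Rightarrow> real) \<Rightarrow> (nat \<Rightarrow> real) \<Rightarrow> (nat \<Rightarrow> real) \<Rightarrow> real" where
  "seq_functional \<rho> x = (\<lambda>h\<in>R_space \<rho>. if summable (\<lambda>m. x m / \<rho> m) then \<Sum>m. x m * h m else 0)"

text \<open>This is the duality of weighted \<open>l^1\<close> and supremum norms:
  \<open>x m * h m\<close> is \<open>x m / \<rho> m\<close> times \<open>h m * \<rho> m\<close>, and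
  the second factor is bounded by the norm of \<open>h\<close>.\<close>

lemma summable_seq_pairing:
  assumes \<rho>: "weight_function \<rho>" and x: "\<And>m. 0 \<le> x m" and S: "summable (\<lambda>m. x m / \<rho> m)"
    and h: "h \<in> C_space \<rho>"
  shows "summable (\<lambda>m. x m * h m)" "\<bar>\<Sum>m. x m * h m\<bar> \<le> (\<Sum>m. x m / \<rho> m) * C_norm \<rho> h"
proof -
  have le: "\<bar>x m * h m\<bar> \<le> x m / \<rho> m * C_norm \<rho> h" for m
  proof -
    have pos: "\<rho> m > 0" using \<rho> by (simp add: weight_function_def)
    have "\<bar>x m * h m\<bar> = x m / \<rho> m * \<bar>h m * \<rho> m\<bar>"
      using pos x[of m] by (simp add: abs_mult)
    also have "\<dots> \<le> x m / \<rho> m * C_norm \<rho> h"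
      using pos x[of m] by (intro mult_left_mono C_norm_upper h) auto
    finally show ?thesis .
  qed
  have S': "summable (\<lambda>m. x m / \<rho> m * C_norm \<rho> h)" using S by (rule summable_mult2)
  have abs: "summable (\<lambda>m. \<bar>x m * h m\<bar>)"
    by (rule summable_comparison_test'[OF S', of 0]) (use le in simp)
  then show "summable (\<lambda>m. x m * h m)" by (rule summable_rabs_cancel)
  have "\<bar>\<Sum>m. x m * h m\<bar> \<le> (\<Sum>m. \<bar>x m * h m\<bar>)" by (rule summable_rabs[OF abs])
  also have "\<dots> \<le> (\<Sum>m. x m / \<rho> m * C_norm \<rho> h)" by (rule suminf_le[OF le abs S'])
  also have "\<dots> = (\<Sum>m. x m / \<rho> m) * C_norm \<rho> h" by (rule suminf_mult2[OF S, symmetric])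
  finally show "\<bar>\<Sum>m. x m * h m\<bar> \<le> (\<Sum>m. x m / \<rho> m) * C_norm \<rho> h" .
qed

lemma seq_functional_bound:
  assumes \<rho>: "weight_function \<rho>" and x: "\<And>m. 0 \<le> x m" and h: "h \<in> R_space \<rho>"
  shows "\<bar>seq_functional \<rho> x h\<bar> \<le> (if summable (\<lambda>m. x m / \<rho> m) then \<Sum>m. x m / \<rho> m else 0) * C_norm \<rho> h"
  using summable_seq_pairing(2)[OF \<rho> x _ R_space_C[OF h]] h by (simp add: seq_functional_def)

lemma seq_functional_J_hat:
  assumes \<rho>: "weight_function \<rho>" and x: "\<And>m. 0 \<le> x m"
  shows "seq_functional \<rho> x \<in> J_hat \<rho>"
  unfolding J_hat_def
proof (intro CollectI conjI ballI allI)
  show "seq_functional \<rho> x \<in> extensional (R_space \<rho>)" by (simp add: seq_functional_def)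
  fix g h assume g: "g \<in> R_space \<rho>" and h: "h \<in> R_space \<rho>"
  show "seq_functional \<rho> x (\<lambda>m. g m + h m) = seq_functional \<rho> x g + seq_functional \<rho> x h"
    using g h R_space_add[OF \<rho> g h]
      suminf_add[OF summable_seq_pairing(1)[OF \<rho> x _ R_space_C[OF g]] summable_seq_pairing(1)[OF \<rho> x _ R_space_C[OF h]]]
    by (simp add: seq_functional_def distrib_left)
next
  fix c h assume h: "h \<in> R_space \<rho>"
  show "seq_functional \<rho> x (\<lambda>m. c * h m) = c * seq_functional \<rho> x h"
    using h R_space_scale[OF \<rho> h, of c]
      suminf_mult[where c=c, OF summable_seq_pairing(1)[OF \<rho> x _ R_space_C[OF h]]]
    by (simp add: seq_functional_def mult.left_commute)
next
  show "\<exists>K. \<forall>h\<in>R_space \<rho>. \<bar>seq_functional \<rho> x h\<bar> \<le> K * C_norm \<rho> h"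
    by (rule exI, rule ballI, rule seq_functional_bound[where x=x, OF \<rho> x])
qed

text \<open>In general this is only an upper bound, because the functional is tested on
  \<open>R_space \<rho>\<close> alone, which may be smaller than
  \<open>C_space \<rho>\<close>.\<close>

lemma J_norm_seq_functional_le:
  assumes \<rho>: "weight_function \<rho>" and x: "\<And>m. 0 \<le> x m"
  shows "J_norm \<rho> (seq_functional \<rho> x) \<le> (if summable (\<lambda>m. x m / \<rho> m) then \<Sum>m. x m / \<rho> m else 0)"
    (is "_ \<le> ?S")
proof -
  have pos: "0 < \<rho> m" for m using \<rho> by (simp add: weight_function_def)
  have S0: "0 \<le> ?S" using x pos by (auto intro!: suminf_nonneg divide_nonneg_pos)
  show ?thesis
    unfolding J_norm_def
  proof (rule cSUP_least)
    show "{h \<in> R_space \<rho>. C_norm \<rho> h \<le> 1} \<noteq> {}"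
      using zero_in_R_space[OF \<rho>] by (auto simp: C_norm_def intro!: exI[of _ "\<lambda>_. 0"])
    fix h assume h: "h \<in> {h \<in> R_space \<rho>. C_norm \<rho> h \<le> 1}"
    then have "\<bar>seq_functional \<rho> x h\<bar> \<le> ?S * C_norm \<rho> h" by (intro seq_functional_bound \<rho> x) auto
    also have "\<dots> \<le> ?S * 1" using h S0 by (intro mult_left_mono) auto
    finally show "\<bar>seq_functional \<rho> x h\<bar> \<le> ?S" by simp
  qed
qed

lemma J_norm_nonneg:
  assumes "weight_function \<rho>" "\<xi> \<in> J_hat \<rho>"
  shows "0 \<le> J_norm \<rho> \<xi>"
proof -
  have "0 \<le> \<bar>\<xi> (poly_seq (rat_poly []))\<bar> / C_norm \<rho> (poly_seq (rat_poly []))"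
    by (intro divide_nonneg_nonneg C_norm_nonneg poly_seq_C assms) simp
  also have "\<dots> \<le> J_norm \<rho> \<xi>"
    unfolding J_norm_rat_poly(2)[OF assms] by (intro cSUP_upper J_norm_rat_poly(1)[OF assms]) simp
  finally show ?thesis .
qed

text \<open>The \<open>k\<close>-th power of a series is bounded by a series that is linear in
  \<open>x\<close>, which can be integrated term by term when \<open>x\<close> depends on a point.
  Since \<open>x m \<le> 1\<close>, also \<open>x m ^ k \<le> x m\<close>; hence the
  \<open>k\<close>-th power of \<open>x m * a m * (m+1)^2\<close> is at most one term of the new
  series, and inverse squares make the sum over \<open>m\<close> converge.\<close>

lemma sum_weighted_power_le:
  fixes x a :: "nat \<Rightarrow> real"
  assumes x: "\<And>m. 0 \<le> x m \<and> x m \<le> 1" and a: "\<And>m. 0 \<le> a m" and k: "k \<ge> 1"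
    and T: "summable (\<lambda>m. x m * (real (m + 1) ^ (2 * k) * a m ^ k))"
  shows "summable (\<lambda>m. x m * a m)"
    "(\<Sum>m. x m * a m) ^ k \<le> (\<Sum>m. 1 / real (m + 1) ^ 2) ^ k * (\<Sum>m. x m * (real (m + 1) ^ (2 * k) * a m ^ k))"
proof -
  define T' where "T' m = x m * (real (m + 1) ^ (2 * k) * a m ^ k)" for m
  define c where "c m = 1 / real (m + 1) ^ 2" for m
  have T': "summable T'" using T by (simp only: T'_def[abs_def])
  have c: "summable c" using summable_inverse_squares by (simp only: c_def[abs_def])
  have T'0: "0 \<le> T' m" for m using x[of m] a[of m] by (simp add: T'_def)
  have T0: "0 \<le> suminf T'" using T'0 T' by (intro suminf_nonneg) auto
  have k0: "k > 0" using k by simp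
  have xa0: "0 \<le> x m * a m" for m using x a by simp
  have le: "x m * a m \<le> root k (suminf T') * c m" for m
  proof -
    let ?q = "real (m + 1) ^ 2"
    have "(x m * a m * ?q) ^ k = x m ^ k * (real (m + 1) ^ (2 * k) * a m ^ k)"
      by (simp only: power_mult_distrib power_mult[symmetric] mult_ac)
    also have "\<dots> \<le> x m ^ 1 * (real (m + 1) ^ (2 * k) * a m ^ k)"
      using x[of m] a[of m] k by (intro mult_right_mono power_decreasing) auto
    also have "\<dots> = sum T' {m}" by (simp add: T'_def)
    also have "\<dots> \<le> suminf T'" by (rule sum_le_suminf[OF T']) (simp_all add: T'0)
    also have "\<dots> = root k (suminf T') ^ k" by (rule real_root_pow_pos2[OF k0 T0, symmetric])
    finally have "x m * a m * ?q \<le> root k (suminf T')"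
      using power_le_imp_le_base[of "x m * a m * ?q" "k - 1" "root k (suminf T')"] k0 T0
      by (simp only: Suc_diff_1 real_root_ge_zero)
    then have "x m * a m \<le> root k (suminf T') / ?q" by (subst pos_le_divide_eq) simp_all
    then show ?thesis by (simp add: c_def)
  qed
  have sum: "summable (\<lambda>m. root k (suminf T') * c m)" by (rule summable_mult[OF c])
  show S: "summable (\<lambda>m. x m * a m)"
    by (rule summable_comparison_test'[OF sum, of 0]) (simp only: real_norm_def abs_of_nonneg[OF xa0] le)
  have "(\<Sum>m. x m * a m) \<le> (\<Sum>m. root k (suminf T') * c m)"
    by (rule suminf_le[OF le S sum])
  also have "\<dots> = root k (suminf T') * suminf c" by (rule suminf_mult[OF c])
  finally have "(\<Sum>m. x m * a m) ^ k \<le> (root k (suminf T') * suminf c) ^ k"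
    by (rule power_mono) (intro suminf_nonneg S xa0)
  also have "\<dots> = suminf c ^ k * suminf T'"
    unfolding power_mult_distrib real_root_pow_pos2[OF k0 T0] by (rule mult.commute)
  finally show "(\<Sum>m. x m * a m) ^ k \<le> (\<Sum>m. 1 / real (m + 1) ^ 2) ^ k * (\<Sum>m. x m * (real (m + 1) ^ (2 * k) * a m ^ k))"
    by (simp only: c_def[abs_def] T'_def[abs_def])
qed

text \<open>The norm of a graphon is integrated for completed Lebesgue measure on the plane, the
  kernels for the product of two unit intervals. On nonnegative Borel functions completion changes
  nothing and Tonelli identifies the two.\<close>

lemma nn_integral_unit_square:
  assumes f [measurable]: "f \<in> borel_measurable (borel \<Otimes>\<^sub>M borel)"
  shows "(\<integral>\<^sup>+p. f p \<partial>unit_square) = (\<integral>\<^sup>+p. f p \<partial>square)"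
proof -
  let ?S = "{0..1} \<times> {0..1} :: (real \<times> real) set"
  have f': "f \<in> borel_measurable borel" using f by (simp add: borel_prod)
  have fsq: "f \<in> borel_measurable square" by (rule measurable_square[OF f])
  have S: "?S \<in> sets borel" by (intro borel_closed closed_Times) auto
  have "(\<integral>\<^sup>+p. f p \<partial>unit_square) = (\<integral>\<^sup>+p. f p * indicator ?S p \<partial>lebesgue)"
    using S by (subst nn_integral_restrict_space) auto
  also have "\<dots> = (\<integral>\<^sup>+p. f p * indicator ?S p \<partial>lborel)" by (rule nn_integral_completion)
  also have "\<dots> = (\<integral>\<^sup>+p. f p * indicator ?S p \<partial>(lborel \<Otimes>\<^sub>M lborel))" by (simp add: lborel_prod)
  also have "\<dots> = (\<integral>\<^sup>+x. \<integral>\<^sup>+y. f (x, y) * indicator ?S (x, y) \<partial>lborel \<partial>lborel)"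
    using S f' by (subst lborel.nn_integral_fst[symmetric]) (auto simp: lborel_prod)
  also have "\<dots> = (\<integral>\<^sup>+x. (\<integral>\<^sup>+y. f (x, y) * indicator {0..1} y \<partial>lborel) * indicator {0..1} x \<partial>lborel)"
    by (intro nn_integral_cong) (auto simp: indicator_def intro!: nn_integral_cong)
  also have "\<dots> = (\<integral>\<^sup>+x. \<integral>\<^sup>+y. f (x, y) \<partial>unit_interval \<partial>unit_interval)"
    by (simp add: nn_integral_restrict_space)
  also have "\<dots> = (\<integral>\<^sup>+p. f p \<partial>square)"
    by (rule UI.nn_integral_fst[OF fsq])
  finally show ?thesis .
qed

section \<open>The limit graphon\<close>

lemma measurable_unit_square:
  assumes f: "f \<in> borel_measurable (borel \<Otimes>\<^sub>M borel)"
  shows "f \<in> borel_measurable unit_square"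
proof -
  have "f \<in> borel_measurable lborel" using f by (simp add: borel_prod)
  then have "f \<in> borel_measurable lebesgue" by (rule measurable_completion)
  then show ?thesis by (rule measurable_restrict_space1)
qed

lemma seq_functional_measurable:
  assumes \<mu>: "\<And>m. \<mu> m \<in> borel_measurable M"
  shows "(\<lambda>p. seq_functional \<rho> (\<lambda>m. \<mu> m p) h) \<in> borel_measurable M"
\<comment> \<open>Off \<open>R_space \<rho>\<close> the functional has the constant value
  \<open>undefined\<close>.\<close>
proof (cases "h \<in> R_space \<rho>")
  case True
  note \<mu> [measurable]
  have "{p \<in> space M. summable (\<lambda>m. \<mu> m p / \<rho> m)} \<in> sets M"
    unfolding summable_iff_convergent Cauchy_convergent_iff[symmetric]
    by (rule sets_Collect_Cauchy) measurable
  moreover have "(\<lambda>p. \<Sum>m. \<mu> m p * h m) \<in> borel_measurable M" by measurable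
  ultimately have "(\<lambda>p. if summable (\<lambda>m. \<mu> m p / \<rho> m) then \<Sum>m. \<mu> m p * h m else 0) \<in> borel_measurable M"
    by (intro measurable_If) auto
  then show ?thesis using True by (simp add: seq_functional_def)
qed (simp add: seq_functional_def)

text \<open>Graphons require integrability for real exponents; this reduces it to natural
  ones.\<close>

lemma powr_le_one_plus_power:
  fixes x p :: real
  assumes x: "0 \<le> x" and p: "p \<ge> 1" and k: "p \<le> real k"
  shows "x powr p \<le> 1 + x ^ k"
proof (cases "x \<le> 1")
  case True
  then have "x powr p \<le> 1" using x p by (intro powr_le1) auto
  then show ?thesis using zero_le_power[OF x, of k] by linarith
next
  case False
  then have "x powr p \<le> x powr real k" using k by (intro powr_mono) auto
  also have "\<dots> = x ^ k" using False by (intro powr_realpow) auto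
  finally show ?thesis by simp
qed

text \<open>\<open>\<mu>_sum\<close> is the bridge between kernels and weight: the mean of
  \<open>\<mu> m\<close> is summable against every power of \<open>m + 1\<close> and every power of
  \<open>1 / \<rho> m\<close>.\<close>

context
  fixes \<mu> :: "nat \<Rightarrow> real \<Rightarrow> real \<Rightarrow> real" and \<rho> :: "nat \<Rightarrow> real"
  assumes \<rho>: "weight_function \<rho>"
    and \<mu>_meas: "\<And>m. (\<lambda>(x, y). \<mu> m x y) \<in> borel_measurable (borel \<Otimes>\<^sub>M borel)"
    and \<mu>01: "\<And>m x y. 0 \<le> \<mu> m x y \<and> \<mu> m x y \<le> 1"
    and \<mu>_sym: "\<And>m x y. \<mu> m x y = \<mu> m y x"
    and \<mu>_sum: "\<And>p q. summable (\<lambda>m. (LINT z|square. (case z of (x, y) \<Rightarrow> \<mu> m x y)) * (real (m + 1) ^ p / \<rho> m ^ q))"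
begin

lemma weight_pos: "0 < \<rho> m" using \<rho> by (simp add: weight_function_def)

lemma component_measurable: "(\<lambda>p. \<mu> m (fst p) (snd p)) \<in> borel_measurable (borel \<Otimes>\<^sub>M borel)"
  using \<mu>_meas by (simp add: case_prod_unfold)

lemma seq_moment_finite:
  "(\<integral>\<^sup>+p. (\<Sum>m. ennreal (\<mu> m (fst p) (snd p) * (real (m + 1) ^ i / \<rho> m ^ j))) \<partial>square) < \<infinity>"
proof -
  let ?a = "\<lambda>m. real (m + 1) ^ i / \<rho> m ^ j"
  interpret sq: finite_measure square
    by (intro finite_measure_pair_measure finite_measure_unit_interval)
  have meas: "(\<lambda>p. \<mu> m (fst p) (snd p)) \<in> borel_measurable square" for m
    by (rule measurable_square[OF component_measurable])
  have a0: "0 \<le> ?a m" for m using weight_pos[of m] by simp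
  have int: "integrable square (\<lambda>p. \<mu> m (fst p) (snd p))" for m
    by (rule sq.integrable_const_bound[of _ 1]) (use \<mu>01 meas in auto)
  define b where "b m = (LINT p|square. \<mu> m (fst p) (snd p))" for m
  have b0: "0 \<le> b m" for m unfolding b_def using \<mu>01 by (intro integral_nonneg_AE) auto
  have bs: "summable (\<lambda>m. b m * ?a m)"
    using \<mu>_sum[of i j] by (simp add: b_def case_prod_unfold)
  have "(\<integral>\<^sup>+p. (\<Sum>m. ennreal (\<mu> m (fst p) (snd p) * ?a m)) \<partial>square)
     = (\<Sum>m. \<integral>\<^sup>+p. ennreal (\<mu> m (fst p) (snd p) * ?a m) \<partial>square)"
    by (rule nn_integral_suminf) (intro measurable_compose[OF _ measurable_ennreal] borel_measurable_times meas borel_measurable_const)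
  also have "\<dots> = (\<Sum>m. ennreal (b m * ?a m))"
  proof (intro suminf_cong)
    fix m
    have "(\<integral>\<^sup>+p. ennreal (\<mu> m (fst p) (snd p) * ?a m) \<partial>square)
        = ennreal (LINT p|square. \<mu> m (fst p) (snd p) * ?a m)"
      by (rule nn_integral_eq_integral[OF integrable_mult_left[OF int]])
        (intro AE_I2 mult_nonneg_nonneg a0 \<mu>01[THEN conjunct1])
    also have "(LINT p|square. \<mu> m (fst p) (snd p) * ?a m) = b m * ?a m"
      unfolding b_def by (rule integral_mult_left_zero)
    finally show "(\<integral>\<^sup>+p. ennreal (\<mu> m (fst p) (snd p) * ?a m) \<partial>square) = ennreal (b m * ?a m)" .
  qed
  also have "\<dots> = ennreal (\<Sum>m. b m * ?a m)"
    using b0 a0 by (intro suminf_ennreal2 bs) (rule mult_nonneg_nonneg)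
  finally show ?thesis by simp
qed

text \<open>The moment bound with exponents 0 and 1 makes the series integrable, hence finite almost
  everywhere. On the remaining null set the default 0 of \<open>seq_functional\<close> is in
  force.\<close>

lemma AE_seq_summable: "AE p in square. summable (\<lambda>m. \<mu> m (fst p) (snd p) / \<rho> m)"
proof -
  have meas: "(\<lambda>p. \<mu> m (fst p) (snd p)) \<in> borel_measurable square" for m
    by (rule measurable_square[OF component_measurable])
  have "AE p in square. (\<Sum>m. ennreal (\<mu> m (fst p) (snd p) * (real (m + 1) ^ 0 / \<rho> m ^ 1))) \<noteq> \<infinity>"
    using seq_moment_finite[of 0 1]
    by (intro nn_integral_PInf_AE borel_measurable_suminf_order measurable_compose[OF _ measurable_ennreal]
        borel_measurable_times meas borel_measurable_const) (simp add: less_top)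
  then show ?thesis
  proof eventually_elim
    case (elim p)
    then have "(\<Sum>m. ennreal (\<mu> m (fst p) (snd p) / \<rho> m)) \<noteq> top" by simp
    then show ?case
      using \<mu>01 weight_pos by (intro summable_suminf_not_top divide_nonneg_pos) auto
  qed
qed

lemma J_norm_measurable:
  "(\<lambda>p. J_norm \<rho> (seq_functional \<rho> (\<lambda>m. \<mu> m (fst p) (snd p)))) \<in> borel_measurable (borel \<Otimes>\<^sub>M borel)"
proof -
  have J: "seq_functional \<rho> (\<lambda>m. \<mu> m (fst p) (snd p)) \<in> J_hat \<rho>" for p
    using \<mu>01 by (intro seq_functional_J_hat \<rho>) auto
  show ?thesis
    unfolding J_norm_rat_poly(2)[OF \<rho> J]
    by (intro borel_measurable_cSUP borel_measurable_divide borel_measurable_abs seq_functional_measurable component_measurable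
        borel_measurable_const J_norm_rat_poly(1)[OF \<rho> J]) auto
qed

text \<open>In \<open>ennreal\<close> the bound makes sense at every point, also where the series
  diverges. Its right-hand side has a finite integral by the moment bound with exponents
  \<open>2 * k\<close> and \<open>k\<close>.\<close>

lemma J_norm_powr_le:
  assumes p: "p \<ge> 1" and k: "p \<le> real k"
  shows "ennreal (J_norm \<rho> (seq_functional \<rho> (\<lambda>m. \<mu> m x y)) powr p)
    \<le> 1 + ennreal ((\<Sum>m. 1 / real (m + 1) ^ 2) ^ k) *
        (\<Sum>m. ennreal (\<mu> m x y * (real (m + 1) ^ (2 * k) / \<rho> m ^ k)))"
proof (cases "(\<Sum>m. ennreal (\<mu> m x y * (real (m + 1) ^ (2 * k) / \<rho> m ^ k))) = top")
  case True
  \<comment> \<open>Positivity of the constant matters, since \<open>0 * top\<close> is 0 in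
    \<open>ennreal\<close>.\<close>
  have "0 < (\<Sum>m. 1 / real (m + 1) ^ 2)"
    by (rule suminf_pos[OF summable_inverse_squares]) simp
  then have "0 < ennreal ((\<Sum>m. 1 / real (m + 1) ^ 2) ^ k)"
    unfolding ennreal_less_zero_iff by (rule zero_less_power)
  then have "ennreal ((\<Sum>m. 1 / real (m + 1) ^ 2) ^ k) \<noteq> 0" by (rule less_imp_neq[symmetric])
  then have "ennreal ((\<Sum>m. 1 / real (m + 1) ^ 2) ^ k) * top = top"
    by (simp only: ennreal_mult_top if_False)
  then show ?thesis unfolding True by simp
next
  case False
  let ?J = "J_norm \<rho> (seq_functional \<rho> (\<lambda>m. \<mu> m x y))"
  let ?c = "(\<Sum>m. 1 / real (m + 1) ^ 2) ^ k"
  let ?T = "\<lambda>m. \<mu> m x y * (real (m + 1) ^ (2 * k) / \<rho> m ^ k)"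
  have T0: "0 \<le> ?T m" for m using \<mu>01[of m x y] weight_pos[of m] by simp
  have c0: "0 \<le> ?c" by (intro zero_le_power suminf_nonneg summable_inverse_squares) simp
  have T: "summable ?T" by (rule summable_suminf_not_top[OF T0 False])
  have k1: "k \<ge> 1" using p k by linarith
  have quot: "real (m + 1) ^ (2 * k) * (1 / \<rho> m) ^ k = real (m + 1) ^ (2 * k) / \<rho> m ^ k" for m
    by (simp add: power_divide)
  have T': "summable (\<lambda>m. \<mu> m x y * (real (m + 1) ^ (2 * k) * (1 / \<rho> m) ^ k))"
    using T by (simp only: quot)
  have a0: "0 \<le> 1 / \<rho> m" for m using weight_pos[of m] by simp
  note S = sum_weighted_power_le[where x="\<lambda>m. \<mu> m x y" and a="\<lambda>m. 1 / \<rho> m", OF \<mu>01 a0 k1 T']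
  have S1: "summable (\<lambda>m. \<mu> m x y / \<rho> m)" using S(1) by simp
  have J0: "0 \<le> ?J"
    using \<mu>01 by (intro J_norm_nonneg seq_functional_J_hat \<rho>) auto
  have "?J \<le> (\<Sum>m. \<mu> m x y / \<rho> m)"
    using J_norm_seq_functional_le[where x="\<lambda>m. \<mu> m x y", OF \<rho>] \<mu>01 S1 by simp
  then have "?J ^ k \<le> (\<Sum>m. \<mu> m x y / \<rho> m) ^ k" using J0 by (rule power_mono)
  also have "\<dots> \<le> ?c * suminf ?T"
    using S(2) unfolding quot by simp
  finally have "?J powr p \<le> 1 + ?c * suminf ?T"
    using powr_le_one_plus_power[OF J0 p k] by linarith
  then have "ennreal (?J powr p) \<le> ennreal (1 + ?c * suminf ?T)" by (rule ennreal_leI)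
  also have "\<dots> = 1 + ennreal ?c * ennreal (suminf ?T)"
    using c0 suminf_nonneg[OF T T0] by (simp add: ennreal_plus ennreal_mult)
  also have "ennreal (suminf ?T) = (\<Sum>m. ennreal (?T m))"
    by (rule suminf_ennreal2[OF T0 T, symmetric])
  finally show ?thesis .
qed

lemma seq_functional_graphon: "J_graphon \<rho> (\<lambda>x y. seq_functional \<rho> (\<lambda>m. \<mu> m x y))"
  unfolding J_graphon_def
proof (intro conjI ballI allI impI)
  fix x y :: real
  show "seq_functional \<rho> (\<lambda>m. \<mu> m x y) \<in> J_hat \<rho>"
    using \<mu>01 by (intro seq_functional_J_hat \<rho>) auto
  show "seq_functional \<rho> (\<lambda>m. \<mu> m x y) = seq_functional \<rho> (\<lambda>m. \<mu> m y x)"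
    by (intro arg_cong[where f="seq_functional \<rho>"] ext \<mu>_sym)
next
  show "weak_star_measurable \<rho> (\<lambda>x y. seq_functional \<rho> (\<lambda>m. \<mu> m x y))"
    unfolding weak_star_measurable_def case_prod_unfold
    by (intro ballI measurable_unit_square seq_functional_measurable component_measurable)
next
  fix p :: real assume p: "p \<ge> 1"
  obtain k :: nat where k: "p \<le> real k" using real_arch_simple by blast
  let ?J = "\<lambda>z. J_norm \<rho> (seq_functional \<rho> (\<lambda>m. \<mu> m (fst z) (snd z)))"
  let ?T = "\<lambda>z. \<Sum>m. ennreal (\<mu> m (fst z) (snd z) * (real (m + 1) ^ (2 * k) / \<rho> m ^ k))"
  let ?c = "ennreal ((\<Sum>m. 1 / real (m + 1) ^ 2) ^ k)"
  have Jm: "(\<lambda>z. ?J z powr p) \<in> borel_measurable (borel \<Otimes>\<^sub>M borel)"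
    using J_norm_measurable by measurable
  have Tm: "?T \<in> borel_measurable square"
    by (intro borel_measurable_suminf_order measurable_compose[OF _ measurable_ennreal]
        borel_measurable_times measurable_square[OF component_measurable] borel_measurable_const)
  have Jm': "(\<lambda>z. ennreal (?J z powr p)) \<in> borel_measurable (borel \<Otimes>\<^sub>M borel)"
    by (rule measurable_compose[OF Jm measurable_ennreal])
  interpret sq: finite_measure square
    by (intro finite_measure_pair_measure finite_measure_unit_interval)
  have "(\<integral>\<^sup>+z. ennreal (norm (?J z powr p)) \<partial>unit_square) = (\<integral>\<^sup>+z. ennreal (?J z powr p) \<partial>unit_square)"
    by simp
  also have "\<dots> = (\<integral>\<^sup>+z. ennreal (?J z powr p) \<partial>square)"
    by (rule nn_integral_unit_square[OF Jm'])
  also have "\<dots> \<le> (\<integral>\<^sup>+z. 1 + ?c * ?T z \<partial>square)"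
    by (intro nn_integral_mono J_norm_powr_le p k)
  also have "\<dots> = (\<integral>\<^sup>+z. 1 \<partial>square) + (\<integral>\<^sup>+z. ?c * ?T z \<partial>square)"
    by (intro nn_integral_add borel_measurable_times_ennreal Tm borel_measurable_const)
  also have "(\<integral>\<^sup>+z. ?c * ?T z \<partial>square) = ?c * (\<integral>\<^sup>+z. ?T z \<partial>square)"
    by (rule nn_integral_cmult[OF Tm])
  also have "(\<integral>\<^sup>+z. 1 \<partial>square) + ?c * (\<integral>\<^sup>+z. ?T z \<partial>square) < \<infinity>"
    using seq_moment_finite[of "2 * k" k] sq.emeasure_finite[of "space square"]
    by (simp add: ennreal_mult_eq_top_iff less_top[symmetric])
  finally show "integrable unit_square (\<lambda>(x, y). J_norm \<rho> (seq_functional \<rho> (\<lambda>m. \<mu> m x y)) powr p)"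
    unfolding case_prod_unfold by (intro integrableI_bounded measurable_unit_square Jm)
qed

end

section \<open>Homomorphism densities and truncation of multiplicities\<close>

lemma kernel_hom_two:
  "kernel_hom 2 {(0, 1)} n K = (\<Sum>u<n. \<Sum>v<n. K (0, 1) u v) / (real n)\<^sup>2"
  unfolding kernel_hom_def by (simp add: sum_PiE_two[unfolded One_nat_def])

lemma edge_set_edges: "edge_set (nodes F) (edges F)"
  by (auto simp: edge_set_def edges_def)

lemma hom_density_eq:
  "hom_density F G = kernel_hom (nodes F) (edges F) (nodes G) (\<lambda>e u v. real (mult G u v) ^ mult F (fst e) (snd e))"
  by (simp add: hom_density_def kernel_hom_def case_prod_unfold)

text \<open>Every assignment of positive exponents to edges comes from a multigraph, so the
  hypothesis on densities applies to all of them. Positivity ensures that no edge of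
  \<open>E\<close> disappears.\<close>

lemma multigraph_of_edge_set:
  assumes k: "k \<ge> 1" and E: "edge_set k E" and f: "\<And>e. e \<in> E \<Longrightarrow> f e > 0"
  shows "\<exists>F. is_multigraph F \<and> nodes F = k \<and> edges F = E \<and> (\<forall>e\<in>E. mult F (fst e) (snd e) = f e)"
proof (intro exI conjI ballI)
  define F where "F = \<lparr>nodes = k, mult = \<lambda>i j. if (i, j) \<in> E then f (i, j) else if (j, i) \<in> E then f (j, i) else 0\<rparr>"
  have asym: "i < j" if "(i, j) \<in> E" for i j using E that by (auto simp: edge_set_def)
  have lt: "j < k" if "(i, j) \<in> E" for i j using E that by (auto simp: edge_set_def)
  show "is_multigraph F"
    unfolding is_multigraph_def
  proof (intro conjI allI impI)
    show "mult F u v = mult F v u" for u v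
      using less_asym[OF asym asym, of u v] by (auto simp: F_def)
    show "mult F u u = 0" for u using asym[of u u] by (auto simp: F_def)
  qed (use k in \<open>simp add: F_def\<close>)
  show "nodes F = k" by (simp add: F_def)
  show "edges F = E"
    unfolding edges_def F_def using f by (auto dest: asym lt split: if_splits)
  show "mult F (fst e) (snd e) = f e" if "e \<in> E" for e using that by (simp add: F_def)
qed

text \<open>A multiplicity of at least \<open>M\<close> on the edge \<open>e0\<close> is paid for by one more parallel copy of \<open>e0\<close>.\<close>

lemma truncation_error:
  fixes g :: "nat \<Rightarrow> nat \<Rightarrow> nat" and f :: "nat \<times> nat \<Rightarrow> nat"
  assumes E: "finite E" and M: "M \<ge> 1"
  shows "\<bar>kernel_hom k E n (\<lambda>e u v. real (g u v) ^ f e)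
      - kernel_hom k E n (\<lambda>e u v. if g u v < M then real (g u v) ^ f e else 0)\<bar>
    \<le> (\<Sum>e0\<in>E. kernel_hom k E n (\<lambda>e u v. real (g u v) ^ (f e + of_bool (e = e0)))) / real M"
proof -
  let ?a = "\<lambda>\<phi> e. real (g (\<phi> (fst e)) (\<phi> (snd e))) ^ f e"
  let ?t = "\<lambda>\<phi> e. if g (\<phi> (fst e)) (\<phi> (snd e)) < M then ?a \<phi> e else 0"
  let ?b = "\<lambda>\<phi> e0. \<Prod>e\<in>E. real (g (\<phi> (fst e)) (\<phi> (snd e))) ^ (f e + of_bool (e = e0))"
  have b0: "0 \<le> ?b \<phi> e0" for \<phi> e0 by (intro prod_nonneg) auto
  have pt: "\<bar>(\<Prod>e\<in>E. ?a \<phi> e) - (\<Prod>e\<in>E. ?t \<phi> e)\<bar> \<le> (\<Sum>e0\<in>E. ?b \<phi> e0) / real M" for \<phi> :: "nat \<Rightarrow> nat"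
  proof (cases "\<forall>e\<in>E. g (\<phi> (fst e)) (\<phi> (snd e)) < M")
    case True
    then have "(\<Prod>e\<in>E. ?t \<phi> e) = (\<Prod>e\<in>E. ?a \<phi> e)" by (intro prod.cong) auto
    then show ?thesis using b0 by (simp add: sum_nonneg)
  next
    case False
    then obtain e0 where e0: "e0 \<in> E" "M \<le> g (\<phi> (fst e0)) (\<phi> (snd e0))" by (auto simp: not_less)
    have "(\<Prod>e\<in>E. ?t \<phi> e) = 0"
      by (rule prod_zero[OF E]) (use e0 in \<open>intro bexI[of _ e0], simp_all\<close>)
    moreover have "0 \<le> (\<Prod>e\<in>E. ?a \<phi> e)" by (intro prod_nonneg) auto
    ultimately have "\<bar>(\<Prod>e\<in>E. ?a \<phi> e) - (\<Prod>e\<in>E. ?t \<phi> e)\<bar> = (\<Prod>e\<in>E. ?a \<phi> e)" by simp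
    also have "\<dots> \<le> (\<Prod>e\<in>E. ?a \<phi> e) * (real (g (\<phi> (fst e0)) (\<phi> (snd e0))) / real M)"
    proof -
      have "1 \<le> real (g (\<phi> (fst e0)) (\<phi> (snd e0))) / real M" using e0 M by (simp add: le_divide_eq)
      from mult_left_mono[OF this, of "\<Prod>e\<in>E. ?a \<phi> e"] show ?thesis by (simp add: prod_nonneg)
    qed
    also have "\<dots> = ?b \<phi> e0 / real M"
    proof -
      have "?b \<phi> e0 = (\<Prod>e\<in>E. ?a \<phi> e * (if e = e0 then real (g (\<phi> (fst e)) (\<phi> (snd e))) else 1))"
        by (intro prod.cong refl) (simp add: power_add)
      also have "\<dots> = (\<Prod>e\<in>E. ?a \<phi> e) * real (g (\<phi> (fst e0)) (\<phi> (snd e0)))"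
        unfolding prod.distrib using e0 E by simp
      finally show ?thesis by simp
    qed
    also have "\<dots> \<le> (\<Sum>e0\<in>E. ?b \<phi> e0) / real M"
      using e0 E b0 by (intro divide_right_mono member_le_sum) auto
    finally show ?thesis .
  qed
  let ?X = "{..<k} \<rightarrow>\<^sub>E {..<n}"
  have "\<bar>(\<Sum>\<phi>\<in>?X. \<Prod>e\<in>E. ?a \<phi> e) - (\<Sum>\<phi>\<in>?X. \<Prod>e\<in>E. ?t \<phi> e)\<bar>
     \<le> (\<Sum>\<phi>\<in>?X. (\<Sum>e0\<in>E. ?b \<phi> e0) / real M)"
    unfolding sum_subtractf[symmetric] by (intro order.trans[OF sum_abs] sum_mono pt)
  also have "\<dots> = (\<Sum>e0\<in>E. \<Sum>\<phi>\<in>?X. ?b \<phi> e0) / real M"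
    unfolding sum_divide_distrib[symmetric] by (subst sum.swap) (rule refl)
  finally have "\<bar>(\<Sum>\<phi>\<in>?X. \<Prod>e\<in>E. ?a \<phi> e) - (\<Sum>\<phi>\<in>?X. \<Prod>e\<in>E. ?t \<phi> e)\<bar> / real n ^ k
     \<le> (\<Sum>e0\<in>E. \<Sum>\<phi>\<in>?X. ?b \<phi> e0) / real M / real n ^ k"
    by (rule divide_right_mono) simp
  then show ?thesis
    unfolding kernel_hom_def sum_divide_distrib[symmetric] diff_divide_distrib[symmetric] abs_divide
    by (simp add: mult.commute)
qed

text \<open>Below \<open>M\<close>, a power of the multiplicity is a combination of finitely many
  colour classes. Multiplying out over the edges gives one term for each assignment \<open>c\<close>
  of colours to edges.\<close>

lemma truncation_expansion:
  assumes E: "finite E"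
  shows "kernel_hom k E n (\<lambda>e u v. if g u v < M then real (g u v) ^ f e else 0)
    = (\<Sum>c\<in>E \<rightarrow>\<^sub>E {..<M}. (\<Prod>e\<in>E. real (c e) ^ f e) * kernel_hom k E n (\<lambda>e. colour_class g (c e)))"
proof -
  let ?X = "{..<k} \<rightarrow>\<^sub>E {..<n}"
  have *: "(if g u v < M then real (g u v) ^ i else 0) = (\<Sum>m<M. real m ^ i * colour_class g m u v)" for u v i
  proof -
    have "(\<Sum>m<M. real m ^ i * colour_class g m u v) = (\<Sum>m<M. if g u v = m then real m ^ i else 0)"
      by (intro sum.cong) (auto simp: colour_class_def)
    then show ?thesis by (simp add: sum.delta')
  qed
  have "(\<Sum>\<phi>\<in>?X. \<Prod>e\<in>E. if g (\<phi> (fst e)) (\<phi> (snd e)) < M then real (g (\<phi> (fst e)) (\<phi> (snd e))) ^ f e else 0)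
     = (\<Sum>\<phi>\<in>?X. \<Sum>c\<in>E \<rightarrow>\<^sub>E {..<M}. \<Prod>e\<in>E. real (c e) ^ f e * colour_class g (c e) (\<phi> (fst e)) (\<phi> (snd e)))"
    unfolding * by (intro sum.cong refl prod_sum_PiE E) simp
  also have "\<dots> = (\<Sum>c\<in>E \<rightarrow>\<^sub>E {..<M}. \<Sum>\<phi>\<in>?X. (\<Prod>e\<in>E. real (c e) ^ f e) * (\<Prod>e\<in>E. colour_class g (c e) (\<phi> (fst e)) (\<phi> (snd e))))"
    unfolding prod.distrib by (rule sum.swap)
  finally show ?thesis
    unfolding kernel_hom_def times_divide_eq_right
    by (simp only: sum_divide_distrib[symmetric] sum_distrib_left[symmetric])
qed

theorem theorem4p2:
  fixes G :: "nat \<Rightarrow> multigraph"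
  assumes "\<And>n. is_multigraph (G n)"
    and "\<And>F. is_multigraph F \<Longrightarrow> convergent (\<lambda>n. hom_density F (G n))"
  shows "\<exists>\<rho> W. weight_function \<rho> \<and> J_graphon \<rho> W \<and>
    (\<forall>F. is_multigraph F \<longrightarrow> (\<lambda>n. hom_density F (G n)) \<longlonglongrightarrow> graphon_density F W)"
proof -
  define n where "n l = nodes (G l)" for l
  define g where "g l = mult (G l)" for l
  have n1: "n l \<ge> 1" for l using assms(1) by (simp add: is_multigraph_def n_def)
  have g_sym: "g l u v = g l v u" if "u < n l" "v < n l" for l u v
    using assms(1)[of l] that by (simp add: is_multigraph_def n_def g_def)
  have conv: "convergent (\<lambda>l. kernel_hom k E (n l) (\<lambda>e u v. real (g l u v) ^ f e))"
    if kEf: "k \<ge> 1" "edge_set k E" "\<And>e. e \<in> E \<Longrightarrow> f e > 0" for k E and f :: "nat \<times> nat \<Rightarrow> nat"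
  proof -
    obtain F where F: "is_multigraph F" "nodes F = k" "edges F = E" "\<And>e. e \<in> E \<Longrightarrow> mult F (fst e) (snd e) = f e"
      using multigraph_of_edge_set[of k E f, OF kEf] by blast
    have "hom_density F (G l) = kernel_hom k E (n l) (\<lambda>e u v. real (g l u v) ^ f e)" for l
      unfolding hom_density_eq kernel_hom_def F(2,3) n_def g_def
      by (intro arg_cong2[where f="(/)"] sum.cong prod.cong refl) (simp add: F(4))
    then show ?thesis using assms(2)[OF F(1)] by simp
  qed
  have bounded: "\<exists>B. \<forall>l. kernel_hom k E (n l) (\<lambda>e u v. real (g l u v) ^ f e) \<le> B"
    if "k \<ge> 1" "edge_set k E" "\<And>e. e \<in> E \<Longrightarrow> f e > 0" for k E and f :: "nat \<times> nat \<Rightarrow> nat"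
  proof -
    have "Bseq (\<lambda>l. kernel_hom k E (n l) (\<lambda>e u v. real (g l u v) ^ f e))"
      by (rule convergent_imp_Bseq[OF conv[of k E f, OF that]])
    then obtain B where "\<And>l. norm (kernel_hom k E (n l) (\<lambda>e u v. real (g l u v) ^ f e)) \<le> B"
      unfolding Bseq_def by blast
    then have "kernel_hom k E (n l) (\<lambda>e u v. real (g l u v) ^ f e) \<le> B" for l
      unfolding real_norm_def by (rule abs_le_D1)
    then show ?thesis by blast
  qed
  obtain r \<mu> where r: "strict_mono r"
    and \<mu>_meas: "\<And>m. (\<lambda>(x, y). \<mu> m x y) \<in> borel_measurable (borel \<Otimes>\<^sub>M borel)"
    and \<mu>01: "\<And>m x y. 0 \<le> \<mu> m x y \<and> \<mu> m x y \<le> 1" and \<mu>_sym: "\<And>m x y. \<mu> m x y = \<mu> m y x"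
    and hom: "\<And>k E c. edge_set k E \<Longrightarrow>
      (\<lambda>l. kernel_hom k E (n (r l)) (\<lambda>e. colour_class (g (r l)) (c e)))
        \<longlonglongrightarrow> (LINT x|cube k. (\<Prod>e\<in>E. \<mu> (c e) (x (fst e)) (x (snd e))))"
    using coloured_limit[of n g, OF n1 g_sym] by blast

  define b where "b m = (LINT z|square. (case z of (x, y) \<Rightarrow> \<mu> m x y))" for m
  have edge01: "edge_set 2 {(0, 1)}" by (simp add: edge_set_def)
  have b_lim: "(\<lambda>l. kernel_hom 2 {(0, 1)} (n (r l)) (\<lambda>e. colour_class (g (r l)) m)) \<longlonglongrightarrow> b m" for m
  proof -
    have "(LINT x|cube 2. (\<Prod>e\<in>{(0, 1)}. \<mu> m (x (fst e)) (x (snd e)))) = (LINT x|cube 2. (case (x 0, x 1) of (x, y) \<Rightarrow> \<mu> m x y))"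
      by simp
    also have "\<dots> = b m"
      unfolding b_def by (rule integral_cube_pair[where f="\<lambda>z. case z of (x, y) \<Rightarrow> \<mu> m x y"]) (simp_all add: measurable_square \<mu>_meas)
    finally show ?thesis using hom[OF edge01, of "\<lambda>_. m"] by simp
  qed
  have b0: "0 \<le> b m" for m
    unfolding b_def using \<mu>01 by (intro integral_nonneg_AE) (auto simp: case_prod_unfold)
  have decay: "\<exists>C. \<forall>m. b m * real (m + 1) ^ p \<le> C" for p
  proof -
    \<comment> \<open>A single edge with \<open>p + 1\<close> parallel copies has bounded density,
      and Markov's inequality bounds \<open>b m\<close> by \<open>B / m^(p+1)\<close> for
      \<open>m \<ge> 1\<close>. The successor keeps the multiplicity positive when
      \<open>p = 0\<close>.\<close>
    let ?q = "Suc p"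
    obtain B where B: "\<And>l. kernel_hom 2 {(0, 1)} (n l) (\<lambda>e u v. real (g l u v) ^ ?q) \<le> B"
      using bounded[of 2 "{(0, 1)}" "\<lambda>_. ?q"] edge01 by auto
    have large: "b m * real m ^ ?q \<le> B" for m
    proof (rule LIMSEQ_le_const2)
      show "(\<lambda>l. kernel_hom 2 {(0, 1)} (n (r l)) (\<lambda>e. colour_class (g (r l)) m) * real m ^ ?q) \<longlonglongrightarrow> b m * real m ^ ?q"
        by (intro tendsto_mult_right b_lim)
      have "kernel_hom 2 {(0, 1)} (n l) (\<lambda>e. colour_class (g l) m) * real m ^ ?q \<le> B" for l
      proof -
        have "(\<Sum>u<n l. \<Sum>v<n l. colour_class (g l) m u v) * real m ^ ?q
            \<le> (\<Sum>u<n l. \<Sum>v<n l. real (g l u v) ^ ?q)"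
          unfolding sum_distrib_right by (intro sum_mono) (simp add: colour_class_def)
        then have "kernel_hom 2 {(0, 1)} (n l) (\<lambda>e. colour_class (g l) m) * real m ^ ?q
            \<le> kernel_hom 2 {(0, 1)} (n l) (\<lambda>e u v. real (g l u v) ^ ?q)"
          unfolding kernel_hom_two times_divide_eq_left by (rule divide_right_mono) simp
        then show ?thesis using B[of l] by linarith
      qed
      then show "\<exists>N. \<forall>l\<ge>N. kernel_hom 2 {(0, 1)} (n (r l)) (\<lambda>e. colour_class (g (r l)) m) * real m ^ ?q \<le> B" by blast
    qed
    \<comment> \<open>The moments say nothing about colour 0, which is bounded separately; for
      \<open>m \<ge> 1\<close>, \<open>m + 1 \<le> 2 * m\<close>.\<close>
    have "b m * real (m + 1) ^ p \<le> max (b 0) (2 ^ ?q * B)" for m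
    proof (cases "m = 0")
      case False
      have "b m * real (m + 1) ^ p \<le> b m * (2 * real m) ^ ?q"
      proof (rule mult_left_mono[OF _ b0])
        have "real (m + 1) ^ p \<le> real (m + 1) ^ ?q" by (rule power_increasing) auto
        also have "\<dots> \<le> (2 * real m) ^ ?q" using False by (intro power_mono) auto
        finally show "real (m + 1) ^ p \<le> (2 * real m) ^ ?q" .
      qed
      also have "\<dots> = 2 ^ ?q * (b m * real m ^ ?q)" by (simp only: power_mult_distrib mult_ac)
      also have "\<dots> \<le> 2 ^ ?q * B" by (intro mult_left_mono large) simp
      finally show ?thesis by simp
    qed simp
    then show ?thesis by blast
  qed
  from exists_weight_function[of b, OF b0 decay] obtain \<rho> where \<rho>: "weight_function \<rho>"
    and sum: "\<And>p q. summable (\<lambda>m. b m * (real (m + 1) ^ p / \<rho> m ^ q))" by blast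
  define W where "W x y = seq_functional \<rho> (\<lambda>m. \<mu> m x y)" for x y
  have graphon: "J_graphon \<rho> W"
    using seq_functional_graphon[of \<rho> \<mu>, OF \<rho> \<mu>_meas \<mu>01 \<mu>_sym sum[unfolded b_def]]
    by (simp add: W_def[abs_def])
  have AE_summable: "AE z in square. summable (\<lambda>m. \<mu> m (fst z) (snd z) / \<rho> m)"
    by (rule AE_seq_summable[of \<rho> \<mu>, OF \<rho> \<mu>_meas \<mu>01 \<mu>_sym sum[unfolded b_def]])

  have density: "(\<lambda>l. hom_density F (G l)) \<longlonglongrightarrow> graphon_density F W" if F: "is_multigraph F" for F
  proof -
    define k where "k = nodes F"
    define E where "E = edges F"
    define f where "f e = mult F (fst e) (snd e)" for e
    have k1: "k \<ge> 1" using F by (simp add: k_def is_multigraph_def)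
    have E: "edge_set k E" unfolding k_def E_def by (rule edge_set_edges)
    have f0: "f e > 0" if "e \<in> E" for e using that by (auto simp: E_def edges_def f_def)
    have fin: "finite E" by (rule edge_set_finite[OF E])
    have lt: "fst e < k" "snd e < k" "fst e \<noteq> snd e" if "e \<in> E" for e
      using E that by (force simp: edge_set_def)+
    define a where "a l = kernel_hom k E (n l) (\<lambda>e u v. real (g l u v) ^ f e)" for l
    have hd: "hom_density F (G l) = a l" for l
      by (simp add: hom_density_eq a_def k_def E_def f_def n_def g_def)
    \<comment> \<open>The limit exists along the whole sequence, so it may be computed along
      \<open>r\<close>.\<close>
    obtain L where L: "a \<longlonglongrightarrow> L"
      using conv[of k E f, OF k1 E f0] unfolding a_def[symmetric] convergent_def by blast
    \<comment> \<open>For each edge the series defining its factor is cut off at \<open>M\<close>;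
      the result is a finite combination of products of colour kernels, to which the colour limits
      apply.\<close>
    define P where "P M x = (\<Prod>e\<in>E. \<Sum>m<M. real m ^ f e * \<mu> m (x (fst e)) (x (snd e)))" for M and x :: "nat \<Rightarrow> real"
    define t where "t l M = kernel_hom k E (n l) (\<lambda>e u v. if g l u v < M then real (g l u v) ^ f e else 0)" for l M
    interpret cube: finite_measure "cube k" by (rule finite_measure_cube)
    have meas: "(\<lambda>x. \<mu> m (x (fst e)) (x (snd e))) \<in> borel_measurable (cube k)" if "e \<in> E" for e m
    proof -
      have "(\<lambda>x. (x (fst e), x (snd e))) \<in> cube k \<rightarrow>\<^sub>M square"
        using lt[OF that] by (intro measurable_Pair measurable_component_singleton) auto
      from measurable_compose[OF this measurable_square[OF \<mu>_meas]] show ?thesis by simp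
    qed
    have P_exp: "P M x = (\<Sum>c\<in>E \<rightarrow>\<^sub>E {..<M}. (\<Prod>e\<in>E. real (c e) ^ f e) * (\<Prod>e\<in>E. \<mu> (c e) (x (fst e)) (x (snd e))))" for M x
      unfolding P_def prod.distrib[symmetric] by (rule prod_sum_PiE) (simp_all add: fin)
    have int: "integrable (cube k) (\<lambda>x. \<Prod>e\<in>E. \<mu> (c e) (x (fst e)) (x (snd e)))" for c
    proof (rule cube.integrable_const_bound[of _ 1])
      have "\<bar>\<Prod>e\<in>E. \<mu> (c e) (x (fst e)) (x (snd e))\<bar> \<le> 1" for x
        unfolding abs_prod using \<mu>01 by (intro prod_le_1) auto
      then show "AE x in cube k. norm (\<Prod>e\<in>E. \<mu> (c e) (x (fst e)) (x (snd e))) \<le> 1" by simp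
    qed (intro borel_measurable_prod meas)
    have P_int: "integrable (cube k) (P M)" for M
      unfolding P_exp by (intro Bochner_Integration.integrable_sum integrable_mult_right int)
    have t_lim: "(\<lambda>l. t (r l) M) \<longlonglongrightarrow> (LINT x|cube k. P M x)" for M
    proof -
      let ?C = "E \<rightarrow>\<^sub>E {..<M}" and ?w = "\<lambda>c. \<Prod>e\<in>E. real (c e) ^ f e"
      let ?h = "\<lambda>c x. \<Prod>e\<in>E. \<mu> (c e) (x (fst e)) (x (snd e))"
      have "(LINT x|cube k. P M x) = (LINT x|cube k. (\<Sum>c\<in>?C. ?w c * ?h c x))"
        by (simp only: P_exp)
      also have "\<dots> = (\<Sum>c\<in>?C. LINT x|cube k. ?w c * ?h c x)"
        by (rule Bochner_Integration.integral_sum) (rule integrable_mult_right[OF int])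
      also have "\<dots> = (\<Sum>c\<in>?C. ?w c * (LINT x|cube k. ?h c x))"
        by (simp only: integral_mult_right_zero)
      finally have P_val: "(LINT x|cube k. P M x) = (\<Sum>c\<in>?C. ?w c * (LINT x|cube k. ?h c x))" .
      have "(\<lambda>l. \<Sum>c\<in>?C. ?w c * kernel_hom k E (n (r l)) (\<lambda>e. colour_class (g (r l)) (c e)))
          \<longlonglongrightarrow> (\<Sum>c\<in>?C. ?w c * (LINT x|cube k. ?h c x))"
        by (rule tendsto_sum, rule tendsto_mult_left, rule hom[OF E])
      then show ?thesis
        unfolding t_def truncation_expansion[OF fin] P_val .
    qed
    \<comment> \<open>Densities with one additional copy of an edge converge too, so they have
      bounds independent of the graph, and the truncation error is small uniformly in
      \<open>l\<close>.\<close>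
    obtain B where B: "\<And>e0 l. e0 \<in> E \<Longrightarrow> kernel_hom k E (n l) (\<lambda>e u v. real (g l u v) ^ (f e + of_bool (e = e0))) \<le> B e0"
    proof -
      have "\<exists>B. \<forall>l. kernel_hom k E (n l) (\<lambda>e u v. real (g l u v) ^ (f e + of_bool (e = e0))) \<le> B" for e0
        by (rule bounded[where f="\<lambda>e. f e + of_bool (e = e0)", OF k1 E]) (simp add: f0)
      then have "\<forall>e0. \<exists>B. \<forall>l. kernel_hom k E (n l) (\<lambda>e u v. real (g l u v) ^ (f e + of_bool (e = e0))) \<le> B"
        by (rule allI)
      from choice[OF this] show ?thesis using that by blast
    qed
    have err: "\<bar>a l - t l (Suc M)\<bar> \<le> sum B E / real (Suc M)" for l M
    proof -
      have "\<bar>a l - t l (Suc M)\<bar>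
        \<le> (\<Sum>e0\<in>E. kernel_hom k E (n l) (\<lambda>e u v. real (g l u v) ^ (f e + of_bool (e = e0)))) / real (Suc M)"
        unfolding a_def t_def by (rule truncation_error[OF fin]) simp
      also have "\<dots> \<le> sum B E / real (Suc M)" by (intro divide_right_mono sum_mono B) auto
      finally show ?thesis .
    qed
    have err_lim: "\<bar>L - (LINT x|cube k. P (Suc M) x)\<bar> \<le> sum B E / real (Suc M)" for M
    proof (rule LIMSEQ_le_const2)
      show "(\<lambda>l. \<bar>a (r l) - t (r l) (Suc M)\<bar>) \<longlonglongrightarrow> \<bar>L - (LINT x|cube k. P (Suc M) x)\<bar>"
        using LIMSEQ_subseq_LIMSEQ[OF L r] by (intro tendsto_intros t_lim) (simp add: o_def)
      show "\<exists>N. \<forall>l\<ge>N. \<bar>a (r l) - t (r l) (Suc M)\<bar> \<le> sum B E / real (Suc M)" using err by blast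
    qed
    have "(\<lambda>M. L - (LINT x|cube k. P (Suc M) x)) \<longlonglongrightarrow> 0"
    proof (rule Lim_null_comparison)
      show "eventually (\<lambda>M. norm (L - (LINT x|cube k. P (Suc M) x)) \<le> sum B E / real (Suc M)) sequentially"
        using err_lim by simp
      show "(\<lambda>M. sum B E / real (Suc M)) \<longlonglongrightarrow> 0"
        using LIMSEQ_inverse_real_of_nat tendsto_mult_right_zero[of "\<lambda>M. inverse (real (Suc M))" sequentially "sum B E"]
        by (simp add: divide_inverse)
    qed
    then have "(\<lambda>M. L - (L - (LINT x|cube k. P (Suc M) x))) \<longlonglongrightarrow> L - 0" by (intro tendsto_diff tendsto_const)
    then have P_lim: "(\<lambda>M. LINT x|cube k. P (Suc M) x) \<longlonglongrightarrow> L" by simp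
    define u where "u x = (\<Prod>e\<in>E. W (x (fst e)) (x (snd e)) (poly_seq (monom 1 (f e))))" for x :: "nat \<Rightarrow> real"
    have u_meas: "u \<in> borel_measurable (cube k)"
    proof -
      have "(\<lambda>x. seq_functional \<rho> (\<lambda>m. \<mu> m (x (fst e)) (x (snd e))) h) \<in> borel_measurable (cube k)"
        if "e \<in> E" for e h
        by (rule seq_functional_measurable[where \<mu>="\<lambda>m x. \<mu> m (x (fst e)) (x (snd e))", OF meas[OF that]])
      then show ?thesis unfolding u_def[abs_def] W_def by (rule borel_measurable_prod)
    qed
    have "integral\<^sup>L (cube k) u = L"
    \<comment> \<open>All summands are nonnegative, so the truncated integrands increase with
      \<open>M\<close>, and the limit of their integrals is already known to be
      \<open>L\<close>.\<close>
    proof (rule integral_monotone_convergence[of "cube k" "\<lambda>M. P (Suc M)"])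
      show "integrable (cube k) (P (Suc M))" for M by (rule P_int)
      have "mono (\<lambda>M. P (Suc M) x)" for x
      proof (rule monoI)
        fix M M' :: nat assume le: "M \<le> M'"
        have nn: "0 \<le> real m ^ f e * \<mu> m (x (fst e)) (x (snd e))" for m e
          by (rule mult_nonneg_nonneg) (simp_all add: \<mu>01)
        show "P (Suc M) x \<le> P (Suc M') x"
          unfolding P_def
        proof (rule prod_mono)
          fix e
          have sub: "{..<Suc M} \<subseteq> {..<Suc M'}" using le by auto
          show "0 \<le> (\<Sum>m<Suc M. real m ^ f e * \<mu> m (x (fst e)) (x (snd e))) \<and>
            (\<Sum>m<Suc M. real m ^ f e * \<mu> m (x (fst e)) (x (snd e)))
              \<le> (\<Sum>m<Suc M'. real m ^ f e * \<mu> m (x (fst e)) (x (snd e)))"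
            by (rule conjI, rule sum_nonneg, rule nn, rule sum_mono2[OF finite_lessThan sub], rule nn)
        qed
      qed
      then show "AE x in cube k. mono (\<lambda>M. P (Suc M) x)" by simp
      \<comment> \<open>\<open>W\<close> is given by its series only where
        \<open>\<mu> m x y / \<rho> m\<close> is summable in \<open>m\<close>; for finitely many
        edges this excludes a null set of the cube.\<close>
      have "AE x in cube k. \<forall>e\<in>E. summable (\<lambda>m. \<mu> m (x (fst e)) (x (snd e)) / \<rho> m)"
        using fin
      proof (rule AE_finite_allI)
        fix e assume "e \<in> E"
        show "AE x in cube k. summable (\<lambda>m. \<mu> m (x (fst e)) (x (snd e)) / \<rho> m)"
          using AE_cube_pair[OF lt[OF \<open>e \<in> E\<close>] AE_summable] by simp
      qed
      then show "AE x in cube k. (\<lambda>M. P (Suc M) x) \<longlonglongrightarrow> u x"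
      proof eventually_elim
        case (elim x)
        have "(\<lambda>M. \<Sum>m<M. real m ^ f e * \<mu> m (x (fst e)) (x (snd e)))
            \<longlonglongrightarrow> W (x (fst e)) (x (snd e)) (poly_seq (monom 1 (f e)))" if "e \<in> E" for e
        proof -
          have S: "summable (\<lambda>m. \<mu> m (x (fst e)) (x (snd e)) / \<rho> m)" using elim that by blast
          have "summable (\<lambda>m. \<mu> m (x (fst e)) (x (snd e)) * poly_seq (monom 1 (f e)) m)"
            using \<mu>01 by (intro summable_seq_pairing(1)[OF \<rho> _ S poly_seq_C[OF \<rho>]]) auto
          then have "(\<lambda>M. \<Sum>m<M. \<mu> m (x (fst e)) (x (snd e)) * poly_seq (monom 1 (f e)) m)
             \<longlonglongrightarrow> (\<Sum>m. \<mu> m (x (fst e)) (x (snd e)) * poly_seq (monom 1 (f e)) m)"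
            by (rule summable_LIMSEQ)
          then show ?thesis
            using S poly_seq_in_R_space[OF \<rho>, of "monom 1 (f e)"]
            by (simp add: W_def seq_functional_def) (simp add: poly_seq_def poly_monom mult.commute)
        qed
        then have "(\<lambda>M. P M x) \<longlonglongrightarrow> u x" unfolding P_def u_def by (intro tendsto_prod)
        then show ?case by (rule LIMSEQ_Suc)
      qed
      show "(\<lambda>M. LINT x|cube k. P (Suc M) x) \<longlonglongrightarrow> L" by (rule P_lim)
    qed (rule u_meas)
    \<comment> \<open>Since \<open>u\<close> is measurable for the product measure itself, passing
      to the completion leaves its integral unchanged.\<close>
    moreover have "graphon_density F W = integral\<^sup>L (cube k) u"
    proof -
      have "graphon_density F W = (LINT x|completion (cube k). u x)"
        by (simp add: graphon_density_def decorated_density_def unit_cube_def u_def k_def E_def f_def case_prod_unfold)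
      also have "\<dots> = integral\<^sup>L (cube k) u" by (rule integral_completion[OF u_meas])
      finally show ?thesis .
    qed
    ultimately show ?thesis using L by (simp add: hd)
  qed
  show ?thesis
    by (rule exI[of _ \<rho>], rule exI[of _ W]) (intro conjI allI impI \<rho> graphon density)
qed

end
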